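(* Let $f$ be a convenient and nondegenerate polynomial on $\mathbb{C}^n$ with Newton polytope $P$ and Newton function $\nu$. Then the toric Newton spectrum of $f$ is given by $$P_{\mathrm{gr}^{\mathcal{N}}(\mathcal{B}/\mathcal{L})}(z)=(1-z)^n\sum_{v\in\mathbb{N}^n} z^{\nu(v)}.$$ In particular, the toric Newton spectrum of $f$ depends only on its Newton polytope.
   Context: Let $n\ge 1$, $\mathbb{N}=\{0,1,2,\dots\}$, $\mathcal{B}=\mathbb{C}[u_1,\dots,u_n]$, $u^m=u_1^{m_1}\cdots u_n^{m_n}$. For $g=\sum_{m\in\mathbb{N}^n}a_mu^m\in\mathcal{B}$, $\mathrm{supp}(g)=\{m: a_m\ne 0\}$, and the Newton polytope of $g$ is the convex hull of $\{0\}\cup\mathrm{supp}(g)$ in $\mathbb{R}^n_+$. The Newton boundary of a Newton polytope is the union of its closed faces that do not contain the origin. A polynomial $f$ is convenient if for each $i=1,\dots,n$ there is an integer $n_i\ge1$ such that $u_i^{n_i}$ appears in $f$ with nonzero coefficient. It is (Newton) nondegenerate if, for each closed face $\Delta$ of the Newton boundary of its Newton polytope, the system $(u_1\frac{\partial f}{\partial u_1})_\Delta=\dots=(u_n\frac{\partial f}{\partial u_n})_\Delta=0$ has no solution in $(\mathbb{C}^* )^n$, where $g_\Delta=\sum_{m\in\mathbb{N}^n\cap\Delta}b_mu^m$ for $g=\sum b_mu^m$. For a facet $F$ (face of dimension $n-1$) of the Newton boundary of $P$, let $u_F\in\mathbb{Q}^n$ be such that $F=P\cap\{x\in\mathbb{R}^n:\langle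 u_F,x\rangle=1\}$. The Newton function $\nu:\mathbb{N}^n\to\mathbb{Q}$ is $\nu(a)=\max_F\langle u_F,a\rangle$, the maximum being over the facets of the Newton boundary of $P$. The Newton filtration is the increasing filtration $\mathcal{N}_\alpha\mathcal{B}=\{g\in\mathcal{B}:\nu(m)\le\alpha \text{ for all } m\in\mathrm{supp}(g)\}$, $\alpha\in\mathbb{Q}$. Let $\mathcal{L}$ be the ideal of $\mathcal{B}$ generated by $u_1\frac{\partial f}{\partial u_1},\dots,u_n\frac{\partial f}{\partial u_n}$. The Newton filtration induces by projection a filtration $\mathcal{N}_\bullet$ on $\mathcal{B}/\mathcal{L}$, with graded ring $\mathrm{gr}^{\mathcal{N}}(\mathcal{B}/\mathcal{L})=\bigoplus_{\alpha\in\mathbb{Q}}\mathrm{gr}^{\mathcal{N}}_\alpha(\mathcal{B}/\mathcal{L})$. The toric Newton spectrum of $f$ is $P_{\mathrm{gr}^{\mathcal{N}}(\mathcal{B}/\mathcal{L})}(z)=\sum_{\alpha\in\mathbb{Q}}\dim_{\mathbb{C}}\mathrm{gr}^{\mathcal{N}}_\alpha(\mathcal{B}/\mathcal{L})\,z^\alpha$. Identities are between formal series in $z$ with rational exponents. *)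

theory Defs
  imports
    "HOL-Analysis.Analysis"
    "HOL-Library.Poly_Mapping"
    "HOL-Algebra.QuotRing"
    "HOL-Algebra.Module"
begin

section \<open>Polynomials and partial derivatives\<close>

text \<open>The index type \<open>'n\<close> plays the role of the set of indices from 1 to n. A polynomial is a
  finitely supported family of coefficients indexed by exponent vectors; its support is
  \<^const>\<open>Poly_Mapping.keys\<close> and its multiplication is that of the library.\<close>

type_synonym 'n cpoly = "(nat ^ 'n) \<Rightarrow>\<^sub>0 complex"

definition var :: "'n::finite \<Rightarrow> 'n cpoly" where
  "var i = Poly_Mapping.single (axis i 1) 1"

text \<open>The subtraction of exponents truncates only where the coefficient \<open>m $ i\<close> vanishes.\<close>

definition partial :: "'n::finite \<Rightarrow> 'n cpoly \<Rightarrow> 'n cpoly" where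
  "partial i f = (\<Sum>m\<in>Poly_Mapping.keys f.
     Poly_Mapping.single (m - axis i 1) (of_nat (m $ i) * Poly_Mapping.lookup f m))"

definition log_partial :: "'n::finite \<Rightarrow> 'n cpoly \<Rightarrow> 'n cpoly" where
  "log_partial i f = var i * partial i f"

definition eval_cpoly :: "'n::finite cpoly \<Rightarrow> complex ^ 'n \<Rightarrow> complex" where
  "eval_cpoly g x = (\<Sum>m\<in>Poly_Mapping.keys g. Poly_Mapping.lookup g m * (\<Prod>i\<in>UNIV. (x $ i) ^ (m $ i)))"


section \<open>Newton polytopes, convenience and nondegeneracy\<close>

definition exp_point :: "nat ^ 'n \<Rightarrow> real ^ 'n" where
  "exp_point m = (\<chi> i. real (m $ i))"

definition newton_polytope :: "'n::finite cpoly \<Rightarrow> (real ^ 'n) set" where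
  "newton_polytope g = convex hull (insert 0 (exp_point ` Poly_Mapping.keys g))"

text \<open>The closed faces making up the Newton boundary. The library counts the empty set as a face;
  it has to be excluded, since every restriction to it is the zero polynomial.\<close>

definition boundary_faces :: "(real ^ 'n::finite) set \<Rightarrow> (real ^ 'n) set set" where
  "boundary_faces P = {F. F face_of P \<and> F \<noteq> {} \<and> 0 \<notin> F}"

definition boundary_facets :: "(real ^ 'n::finite) set \<Rightarrow> (real ^ 'n) set set" where
  "boundary_facets P = {F \<in> boundary_faces P. aff_dim F = int CARD('n) - 1}"

definition restrict_to :: "(real ^ 'n::finite) set \<Rightarrow> 'n cpoly \<Rightarrow> 'n cpoly" where
  "restrict_to D g = (\<Sum>m\<in>{m \<in> Poly_Mapping.keys g. exp_point m \<in> D}.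
     Poly_Mapping.single m (Poly_Mapping.lookup g m))"

definition convenient :: "'n::finite cpoly \<Rightarrow> bool" where
  "convenient f \<longleftrightarrow> (\<forall>i. \<exists>k\<ge>1. Poly_Mapping.lookup f (axis i k) \<noteq> 0)"

definition nondegenerate :: "'n::finite cpoly \<Rightarrow> bool" where
  "nondegenerate f \<longleftrightarrow>
     (\<forall>D\<in>boundary_faces (newton_polytope f).
        \<not> (\<exists>x :: complex ^ 'n. (\<forall>i. x $ i \<noteq> 0) \<and>
              (\<forall>i. eval_cpoly (restrict_to D (log_partial i f)) x = 0)))"


section \<open>The Newton function and the Newton filtration\<close>

text \<open>When the facet \<open>F\<close> has dimension \<open>n - 1\<close> and avoids the origin, its affine hull is a
  hyperplane not through the origin, so there is at most one such covector.\<close>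

definition facet_covector :: "(real ^ 'n::finite) set \<Rightarrow> (real ^ 'n) set \<Rightarrow> rat ^ 'n" where
  "facet_covector P F =
     (SOME u. F = P \<inter> {x. (\<Sum>i\<in>UNIV. real_of_rat (u $ i) * x $ i) = 1})"

definition newton_function :: "(real ^ 'n::finite) set \<Rightarrow> nat ^ 'n \<Rightarrow> rat" where
  "newton_function P a =
     Max ((\<lambda>F. \<Sum>i\<in>UNIV. facet_covector P F $ i * of_nat (a $ i)) ` boundary_facets P)"

definition newton_filtration :: "(real ^ 'n::finite) set \<Rightarrow> rat \<Rightarrow> 'n cpoly set" where
  "newton_filtration P \<alpha> = {g. \<forall>m\<in>Poly_Mapping.keys g. newton_function P m \<le> \<alpha>}"


section \<open>Quotients and dimension\<close>

text \<open>The quotient of an algebra by an ideal, extending \<^const>\<open>FactRing\<close> by scalar multiplication.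
  It is also used for the quotient of a vector space by a subspace; the fields \<open>mult\<close> and \<open>one\<close>
  are then meaningless and play no role.\<close>

definition quotient_module :: "('c, 'b) module \<Rightarrow> 'b set \<Rightarrow> ('c, 'b set) module" where
  "quotient_module M W =
     \<lparr>carrier = a_rcosets\<^bsub>M\<^esub> W, mult = rcoset_mult M W, one = W +>\<^bsub>M\<^esub> \<one>\<^bsub>M\<^esub>,
      zero = W, add = set_add M,
      smult = (\<lambda>c X. \<Union>x\<in>X. W +>\<^bsub>M\<^esub> (c \<odot>\<^bsub>M\<^esub> x))\<rparr>"

definition finite_basis :: "('c, 'b) module \<Rightarrow> 'b set \<Rightarrow> bool" where
  "finite_basis M S \<longleftrightarrow> finite S \<and> S \<subseteq> carrier M \<and>
     (\<forall>v\<in>carrier M. \<exists>!c. c \<in> extensional S \<and> v = (\<Oplus>\<^bsub>M\<^esub>b\<in>S. c b \<odot>\<^bsub>M\<^esub> b))"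

definition finite_dimensional :: "('c, 'b) module \<Rightarrow> bool" where
  "finite_dimensional M \<longleftrightarrow> (\<exists>S. finite_basis M S)"

definition dimension_of :: "('c, 'b) module \<Rightarrow> nat" where
  "dimension_of M = (THE d. \<exists>S. finite_basis M S \<and> card S = d)"


section \<open>The toric Newton spectrum\<close>

definition cpoly_algebra :: "(complex, 'n::finite cpoly) module" where
  "cpoly_algebra =
     \<lparr>carrier = UNIV, mult = (*), one = 1, zero = 0, add = (+),
      smult = (\<lambda>c g. Poly_Mapping.single 0 c * g)\<rparr>"

definition toric_ideal :: "'n::finite cpoly \<Rightarrow> 'n cpoly set" where
  "toric_ideal f = Idl\<^bsub>cpoly_algebra\<^esub> (range (\<lambda>i. log_partial i f))"

definition toric_quotient :: "'n::finite cpoly \<Rightarrow> (complex, 'n cpoly set) module" where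
  "toric_quotient f = quotient_module cpoly_algebra (toric_ideal f)"

definition quotient_filtration :: "'n::finite cpoly \<Rightarrow> rat \<Rightarrow> 'n cpoly set set" where
  "quotient_filtration f \<alpha> =
     (\<lambda>g. toric_ideal f +>\<^bsub>cpoly_algebra\<^esub> g) ` newton_filtration (newton_polytope f) \<alpha>"

text \<open>The graded piece of degree \<open>\<alpha>\<close>, i.e. the step \<open>\<alpha>\<close> of the filtration modulo the union of
  all steps \<open>\<beta> < \<alpha>\<close>.\<close>

definition graded_piece :: "'n::finite cpoly \<Rightarrow> rat \<Rightarrow> (complex, 'n cpoly set set) module" where
  "graded_piece f \<alpha> =
     quotient_module (toric_quotient f\<lparr>carrier := quotient_filtration f \<alpha>\<rparr>)
       (\<Union>\<beta>\<in>{..<\<alpha>}. quotient_filtration f \<beta>)"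

text \<open>A formal series with rational exponents is given by its coefficients.\<close>

type_synonym qseries = "rat \<Rightarrow> int"

definition toric_newton_spectrum :: "'n::finite cpoly \<Rightarrow> qseries" where
  "toric_newton_spectrum f = (\<lambda>\<alpha>. int (dimension_of (graded_piece f \<alpha>)))"

text \<open>The formal sum of the monomials with exponent \<open>e v\<close>, over all \<open>v\<close>; it makes sense when each
  exponent is attained finitely often.\<close>

definition monomial_summable :: "('a \<Rightarrow> rat) \<Rightarrow> bool" where
  "monomial_summable e \<longleftrightarrow> (\<forall>\<alpha>. finite {v. e v = \<alpha>})"

definition monomial_series :: "('a \<Rightarrow> rat) \<Rightarrow> qseries" where
  "monomial_series e = (\<lambda>\<alpha>. int (card {v. e v = \<alpha>}))"

text \<open>Cauchy product of a finite combination of powers of \<open>z\<close> with a formal series. The power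
  \<open>z\<close> to the \<open>\<alpha>\<close> is \<open>Poly_Mapping.single \<alpha> 1\<close>.\<close>

definition poly_times_series :: "(rat \<Rightarrow>\<^sub>0 int) \<Rightarrow> qseries \<Rightarrow> qseries" where
  "poly_times_series p s = (\<lambda>\<gamma>. \<Sum>\<alpha>\<in>Poly_Mapping.keys p. Poly_Mapping.lookup p \<alpha> * s (\<gamma> - \<alpha>))"

end

theory Submission
  imports Defs "HOL-Computational_Algebra.Fundamental_Theorem_Algebra"
begin

text \<open>
  The associated graded ring of the Newton filtration on polynomials has the monomials as a basis, and
  two monomials multiply to zero unless their exponents lie in a common cone over a facet of the
  Newton boundary. The formula follows once the degree 1 parts of the \<open>log_partial i f\<close> are known to form
  a regular sequence there: the quotient by the ideal they generate then has \<open>(1 - z)\<^sup>n\<close> times the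
  Hilbert series of the ring, and acyclicity of the Koszul complex in degree 1 also shows that this ideal
  consists of the leading forms of \<open>toric_ideal f\<close>.

  Regularity is obtained from the Koszul complex of the \<open>N\<close> monomials of \<open>f\<close> on the Newton boundary.
  After a small generic perturbation every exponent has a lexicographically cheapest representation by
  \<open>n\<close> of these monomials. Filtering by these representations reduces the complex to a direct sum of
  Koszul complexes of free modules over polynomial rings in \<open>n\<close> variables, so the homology vanishes above degree
  \<open>N - n\<close>. Nondegeneracy and the Nullstellensatz on the torus make every monomial
  other than 1 nilpotent modulo the degree 1 parts. By depth sensitivity of the Koszul complex the
  homology of the \<open>n\<close> degree 1 parts vanishes in positive degrees.
\<close>

text \<open>The facets need not be simplices, and the lattice points of their cones need not be
  integer combinations of the exponents of \<open>f\<close>, so the graded ring has no evident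
  structure of a free module over a polynomial ring. Shifting all exponents by one small vector
  cures both defects: each shifted point receives one simplicial cone, spanned by n exponents of
  \<open>f\<close>, that contains it in its interior, and these n shifts act freely on the exponents
  that share a cone. A shift by any other monomial, when it survives in the graded ring, makes the
  representation strictly cheaper than the sum of the two, so it contributes lower terms only.

  The degrees fit as follows. The \<open>N\<close> monomials have no homology above
  \<open>N - n\<close>, hence the monomials together with the n forms have none above
  \<open>N\<close>. Each monomial is nilpotent modulo the forms, so removing it lowers the bound by
  one, and after \<open>N\<close> removals the bound is 0.

  Convenience makes the cones over the facets of the Newton boundary cover the orthant. Therefore
  \<open>nu\<close> is the least total weight of a representation, and each of its levels is
  finite.\<close>

section \<open>Koszul complexes of commuting operators\<close>

text \<open>The sign of the permutation that moves \<open>j\<close> past the smaller elements of \<open>I\<close>.\<close>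

definition sg :: "nat \<Rightarrow> nat set \<Rightarrow> 'm::ab_group_add \<Rightarrow> 'm" where
  "sg j I a = (if even (card {i\<in>I. i < j}) then a else - a)"

lemma sg_zero [simp]: "sg j I 0 = 0"
  by (simp add: sg_def)

lemma sg_sg [simp]: "sg j I (sg j I a) = a"
  by (simp add: sg_def)

lemma sg_add: "sg j I (a + b) = sg j I a + sg j I b"
  by (simp add: sg_def)

lemma sg_minus: "sg j I (- a) = - sg j I a"
  by (simp add: sg_def)

lemma sg_sum: "sg j I (sum h X) = (\<Sum>i\<in>X. sg j I (h i))"
  by (simp add: sg_def sum_negf)

lemma sg_eq_0_iff [simp]: "sg j I a = 0 \<longleftrightarrow> a = 0"
  by (simp add: sg_def)

text \<open>The smaller of \<open>i\<close> and \<open>j\<close> is counted when the larger one is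
  moved past the set, but not conversely, so exactly one of the two orders picks up an extra
  sign.\<close>

lemma sg_anticommute:
  assumes "finite I" "i \<notin> I" "j \<notin> I" "i \<noteq> j"
  shows "sg j I (sg i (insert j I) a) = - sg i I (sg j (insert i I) a)"
proof -
  have *: "card {k\<in>insert b I. k < a} = (if b < a then Suc (card {k\<in>I. k < a}) else card {k\<in>I. k < a})"
    if "b \<notin> I" for a b :: nat
  proof -
    have "{k\<in>insert b I. k < a} = (if b < a then insert b {k\<in>I. k < a} else {k\<in>I. k < a})"
      by auto
    then show ?thesis using that assms(1) by simp
  qed
  show ?thesis
    unfolding sg_def *[OF assms(2)] *[OF assms(3)] using assms(4) by auto
qed

text \<open>The operators act on the whole type while \<open>M\<close> is a stable subgroup, so one
  differential serves several submodules. Requiring only commuting additive operators covers the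
  graded ring, the polynomial ring and the partial shifts inside cells alike.\<close>

locale koszul =
  fixes x :: "nat \<Rightarrow> 'm::ab_group_add \<Rightarrow> 'm" and M :: "'m set"
  assumes op_add: "x j (a + b) = x j a + x j b"
    and op_commute: "x i (x j a) = x j (x i a)"
    and zero_mem: "0 \<in> M"
    and diff_mem: "a \<in> M \<Longrightarrow> b \<in> M \<Longrightarrow> a - b \<in> M"
    and op_mem: "a \<in> M \<Longrightarrow> x j a \<in> M"
begin

lemma uminus_mem: "a \<in> M \<Longrightarrow> - a \<in> M"
  using diff_mem[OF zero_mem] by simp

lemma add_mem: "a \<in> M \<Longrightarrow> b \<in> M \<Longrightarrow> a + b \<in> M"
  using diff_mem[of a "- b"] uminus_mem by simp

lemma sg_mem: "a \<in> M \<Longrightarrow> sg j I a \<in> M"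
  by (simp add: sg_def uminus_mem)

lemma op_zero [simp]: "x j 0 = 0"
  using op_add[of j 0 0] by simp

lemma op_uminus: "x j (- a) = - x j a"
  using op_add[of j a "- a"] by (simp add: eq_neg_iff_add_eq_0 add.commute)

lemma op_sg: "x j (sg i I a) = sg i I (x j a)"
  by (simp add: sg_def op_uminus)

text \<open>The Koszul differential, given by the coefficient that each index set receives. The
  value 0 outside \<open>T\<close> makes equality of chains plain equality of functions.\<close>

definition kd :: "nat set \<Rightarrow> (nat set \<Rightarrow> 'm) \<Rightarrow> nat set \<Rightarrow> 'm" where
  "kd T z I = (if I \<subseteq> T then \<Sum>j\<in>T - I. sg j I (x j (z (insert j I))) else 0)"

definition chain :: "nat set \<Rightarrow> nat \<Rightarrow> (nat set \<Rightarrow> 'm) \<Rightarrow> bool" where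
  "chain T p z \<longleftrightarrow> (\<forall>I. z I \<in> M) \<and> (\<forall>I. z I \<noteq> 0 \<longrightarrow> I \<subseteq> T \<and> card I = p)"

definition boundary :: "nat set \<Rightarrow> nat \<Rightarrow> (nat set \<Rightarrow> 'm) \<Rightarrow> bool" where
  "boundary T p z \<longleftrightarrow> (\<exists>w. chain T (Suc p) w \<and> kd T w = z)"

definition acyclic_at :: "nat set \<Rightarrow> nat \<Rightarrow> bool" where
  "acyclic_at T p \<longleftrightarrow> (\<forall>z. chain T p z \<and> kd T z = (\<lambda>_. 0) \<longrightarrow> boundary T p z)"

lemma sum_mem: "(\<And>i. i \<in> X \<Longrightarrow> h i \<in> M) \<Longrightarrow> sum h X \<in> M"
  by (induction X rule: infinite_finite_induct) (auto simp: zero_mem add_mem)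

lemma chainI:
  assumes "\<And>I. z I \<in> M" "\<And>I. \<not> (I \<subseteq> T \<and> card I = p) \<Longrightarrow> z I = 0"
  shows "chain T p z"
  using assms by (auto simp: chain_def)

lemma chain_mem: "chain T p z \<Longrightarrow> z I \<in> M"
  by (simp add: chain_def)

lemma chain_eq_0: "chain T p z \<Longrightarrow> \<not> (I \<subseteq> T \<and> card I = p) \<Longrightarrow> z I = 0"
  by (auto simp: chain_def)

lemma kd_outside: "\<not> I \<subseteq> T \<Longrightarrow> kd T z I = 0"
  by (simp add: kd_def)

lemma kd_add: "kd T (\<lambda>I. z I + w I) = (\<lambda>I. kd T z I + kd T w I)"
  by (auto simp: kd_def op_add sg_add sum.distrib)

lemma kd_uminus: "kd T (\<lambda>I. - z I) = (\<lambda>I. - kd T z I)"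
  by (auto simp: kd_def op_uminus sg_minus sum_negf)

lemma kd_diff: "kd T (\<lambda>I. z I - w I) = (\<lambda>I. kd T z I - kd T w I)"
  using kd_add[of T z "\<lambda>I. - w I"] by (simp add: kd_uminus)

lemma kd_zero [simp]: "kd T (\<lambda>I. 0) = (\<lambda>I. 0)"
  by (auto simp: kd_def)

text \<open>Two maps are allowed because a truncation by weight changes its bound by 1 across an
  operator of weight 1.\<close>

lemma kd_intertwine:
  assumes "\<And>a b. \<phi> (a + b) = \<phi> a + \<phi> b" and "\<And>j a. j \<in> T \<Longrightarrow> \<phi> (x j a) = x j (\<phi>' a)"
  shows "kd T (\<lambda>I. \<phi>' (z I)) = (\<lambda>I. \<phi> (kd T z I))"
proof -
  have 0: "\<phi> 0 = 0" using assms(1)[of 0 0] by simp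
  have m: "\<phi> (- a) = - \<phi> a" for a
    using assms(1)[of a "- a"] 0 by (simp add: eq_neg_iff_add_eq_0 add.commute)
  have s: "\<phi> (sum h X) = (\<Sum>i\<in>X. \<phi> (h i))" for h :: "nat \<Rightarrow> _" and X
    by (induction X rule: infinite_finite_induct) (simp_all add: assms 0)
  have "\<phi> (sg j I a) = sg j I (\<phi> a)" for j I a by (simp add: sg_def m)
  then show ?thesis
    by (auto simp: kd_def s assms(2) 0 intro!: sum.cong)
qed

lemma kd_op: "kd T (\<lambda>I. x j (z I)) = (\<lambda>I. x j (kd T z I))"
  by (rule kd_intertwine[of "x j"]) (simp_all add: op_add op_commute)

lemma chain_add: "chain T p z \<Longrightarrow> chain T p w \<Longrightarrow> chain T p (\<lambda>I. z I + w I)"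
  by (rule chainI) (simp_all add: chain_mem chain_eq_0 add_mem)

lemma chain_uminus: "chain T p z \<Longrightarrow> chain T p (\<lambda>I. - z I)"
  by (rule chainI) (simp_all add: chain_mem chain_eq_0 uminus_mem)

lemma chain_diff: "chain T p z \<Longrightarrow> chain T p w \<Longrightarrow> chain T p (\<lambda>I. z I - w I)"
  using chain_add[of T p z "\<lambda>I. - w I"] chain_uminus by simp

lemma chain_zero: "chain T p (\<lambda>I. 0)"
  by (simp add: chain_def zero_mem)

lemma chain_op: "chain T p z \<Longrightarrow> chain T p (\<lambda>I. x j (z I))"
  by (rule chainI) (simp_all add: chain_mem chain_eq_0 op_mem)

lemma chain_kd:
  assumes "finite T" "chain T (Suc p) w"
  shows "chain T p (kd T w)"
  unfolding chain_def
proof (intro conjI allI impI)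
  fix I
  show "kd T w I \<in> M"
    using assms(2) by (auto simp: kd_def chain_def zero_mem intro!: sum_mem sg_mem op_mem)
  assume nz: "kd T w I \<noteq> 0"
  then show IT: "I \<subseteq> T" using kd_outside by blast
  with nz have "(\<Sum>j\<in>T - I. sg j I (x j (w (insert j I)))) \<noteq> 0" by (simp add: kd_def)
  then obtain j where "j \<in> T - I" "sg j I (x j (w (insert j I))) \<noteq> 0"
    by (meson sum.not_neutral_contains_not_neutral)
  moreover have "w (insert j I) \<noteq> 0" using calculation by auto
  then have "card (insert j I) = Suc p" using assms(2) by (auto simp: chain_def)
  ultimately show "card I = p"
    using finite_subset[OF IT assms(1)] by simp
qed

lemma boundaryI: "chain T (Suc p) w \<Longrightarrow> kd T w = z \<Longrightarrow> boundary T p z"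
  by (auto simp: boundary_def)

lemma boundaryE:
  assumes "boundary T p z"
  obtains w where "chain T (Suc p) w" "kd T w = z"
  using assms by (auto simp: boundary_def)

lemma acyclic_atD: "acyclic_at T p \<Longrightarrow> chain T p z \<Longrightarrow> kd T z = (\<lambda>_. 0) \<Longrightarrow> boundary T p z"
  by (simp add: acyclic_at_def)

lemma boundary_add:
  assumes "boundary T p z" "boundary T p w"
  shows "boundary T p (\<lambda>I. z I + w I)"
proof -
  obtain a b where "chain T (Suc p) a" "kd T a = z" "chain T (Suc p) b" "kd T b = w"
    using assms(1) by (rule boundaryE) (rule boundaryE[OF assms(2)])
  then show ?thesis by (intro boundaryI[of _ _ "\<lambda>I. a I + b I"]) (simp_all add: kd_add chain_add)
qed

lemma boundary_zero: "boundary T p (\<lambda>_. 0)"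
  by (rule boundaryI[of _ _ "\<lambda>_. 0"]) (simp_all add: chain_zero)

lemma boundary_sum:
  "(\<And>k. k \<in> X \<Longrightarrow> boundary T p (h k)) \<Longrightarrow> boundary T p (\<lambda>I. \<Sum>k\<in>X. h k I)"
  by (induction X rule: infinite_finite_induct) (simp_all add: boundary_zero boundary_add)

text \<open>For \<open>j \<notin> T\<close> the complex of \<open>insert j T\<close> is the mapping cone of \<open>x j\<close> on the complex of \<open>T\<close>:
  a chain \<open>z\<close> corresponds to the pair of its restriction to subsets of \<open>T\<close> and of \<open>slice j T z\<close>.\<close>

definition slice :: "nat \<Rightarrow> nat set \<Rightarrow> (nat set \<Rightarrow> 'm) \<Rightarrow> nat set \<Rightarrow> 'm" where
  "slice j T z I = (if I \<subseteq> T then sg j I (z (insert j I)) else 0)"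

definition base :: "nat set \<Rightarrow> (nat set \<Rightarrow> 'm) \<Rightarrow> nat set \<Rightarrow> 'm" where
  "base T z I = (if I \<subseteq> T then z I else 0)"

definition join :: "nat \<Rightarrow> (nat set \<Rightarrow> 'm) \<Rightarrow> (nat set \<Rightarrow> 'm) \<Rightarrow> nat set \<Rightarrow> 'm" where
  "join j z0 z1 I = (if j \<in> I then sg j (I - {j}) (z1 (I - {j})) else z0 I)"

lemma base_zero [simp]: "base T (\<lambda>_. 0) = (\<lambda>_. 0)"
  by (simp add: base_def fun_eq_iff)

lemma slice_zero [simp]: "slice j T (\<lambda>_. 0) = (\<lambda>_. 0)"
  by (simp add: slice_def fun_eq_iff)

context
  fixes j :: nat and T :: "nat set"
  assumes fin: "finite T" and j: "j \<notin> T"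
begin

lemma base_kd: "base T (kd (insert j T) z) I = kd T (base T z) I + x j (slice j T z I)"
proof (cases "I \<subseteq> T")
  case True
  have "insert j T - I = insert j (T - I)" using True j by auto
  then have "kd (insert j T) z I = sg j I (x j (z (insert j I))) +
      (\<Sum>i\<in>T - I. sg i I (x i (z (insert i I))))"
    using True fin j by (auto simp: kd_def)
  moreover have "(\<Sum>i\<in>T - I. sg i I (x i (z (insert i I)))) = kd T (base T z) I"
    using True by (auto simp: kd_def base_def intro!: sum.cong)
  ultimately show ?thesis using True by (simp add: slice_def base_def op_sg)
qed (simp add: base_def kd_def slice_def)

text \<open>The sign of a mapping cone: moving \<open>j\<close> to the front anticommutes with the
  differential of \<open>T\<close>.\<close>

lemma slice_kd: "slice j T (kd (insert j T) z) I = - kd T (slice j T z) I"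
proof (cases "I \<subseteq> T")
  case True
  have fI: "finite I" using True fin finite_subset by blast
  have e: "insert j T - insert j I = T - I" using True j by auto
  have "slice j T (kd (insert j T) z) I =
      (\<Sum>i\<in>T - I. sg j I (sg i (insert j I) (x i (z (insert i (insert j I))))))"
    using True by (simp add: slice_def kd_def e sg_sum subset_insertI2)
  also have "\<dots> = (\<Sum>i\<in>T - I. - sg i I (sg j (insert i I) (x i (z (insert j (insert i I))))))"
  proof (rule sum.cong)
    fix i assume "i \<in> T - I"
    then show "sg j I (sg i (insert j I) (x i (z (insert i (insert j I))))) =
        - sg i I (sg j (insert i I) (x i (z (insert j (insert i I)))))"
      using sg_anticommute[OF fI, of i j] j True by (auto simp: insert_commute)
  qed simp
  also have "\<dots> = - kd T (slice j T z) I"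
    using True by (auto simp: kd_def slice_def sum_negf op_sg intro!: sum.cong)
  finally show ?thesis .
qed (simp add: slice_def kd_def)

lemma base_join: "chain T p z0 \<Longrightarrow> base T (join j z0 z1) = z0"
  using j by (auto simp: base_def join_def chain_eq_0 fun_eq_iff)

lemma slice_join:
  assumes "chain T p z1"
  shows "slice j T (join j z0 z1) = z1"
proof
  fix I
  have "I \<subseteq> T \<Longrightarrow> insert j I - {j} = I" using j by auto
  then show "slice j T (join j z0 z1) I = z1 I"
    using assms by (auto simp: slice_def join_def chain_eq_0)
qed

lemma cone_eqI:
  assumes "\<And>I. \<not> I \<subseteq> insert j T \<Longrightarrow> z I = w I" "base T z = base T w" "slice j T z = slice j T w"
  shows "z = w"
proof
  fix I
  consider "\<not> I \<subseteq> insert j T" | "I \<subseteq> T" | "j \<in> I" "I \<subseteq> insert j T" by blast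
  then show "z I = w I"
  proof cases
    case 2
    then show ?thesis using assms(2) by (metis base_def)
  next
    case 3
    then have "I - {j} \<subseteq> T" "insert j (I - {j}) = I" by auto
    then have "sg j (I - {j}) (z I) = sg j (I - {j}) (w I)"
      using fun_cong[OF assms(3), of "I - {j}"] by (simp add: slice_def)
    then show ?thesis by (metis sg_sg)
  qed (use assms in auto)
qed

lemma chain_base: "chain (insert j T) p z \<Longrightarrow> chain T p (base T z)"
  by (auto simp: chain_def base_def zero_mem)

lemma chain_slice: "chain (insert j T) (Suc p) z \<Longrightarrow> chain T p (slice j T z)"
  unfolding chain_def
proof (intro conjI allI impI; elim conjE)
  fix I assume *: "\<forall>I. z I \<in> M" "\<forall>I. z I \<noteq> 0 \<longrightarrow> I \<subseteq> insert j T \<and> card I = Suc p"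
  show "slice j T z I \<in> M" using * by (auto simp: slice_def zero_mem sg_mem)
  assume nz: "slice j T z I \<noteq> 0"
  then show "I \<subseteq> T" by (auto simp: slice_def split: if_splits)
  with nz have "z (insert j I) \<noteq> 0" by (auto simp: slice_def)
  then have "card (insert j I) = Suc p" using * by blast
  then show "card I = p"
    using \<open>I \<subseteq> T\<close> j finite_subset[OF \<open>I \<subseteq> T\<close> fin] by (auto simp: card_insert_if split: if_splits)
qed

lemma chain_join:
  assumes "chain T (Suc p) z0" "chain T p z1"
  shows "chain (insert j T) (Suc p) (join j z0 z1)"
  unfolding chain_def
proof (intro conjI allI impI)
  fix I
  show "join j z0 z1 I \<in> M" using assms by (auto simp: chain_def join_def sg_mem)
  assume nz: "join j z0 z1 I \<noteq> 0"
  have "I \<subseteq> insert j T \<and> card I = Suc p"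
  proof (cases "j \<in> I")
    case True
    then have "z1 (I - {j}) \<noteq> 0" using nz by (auto simp: join_def)
    then have "I - {j} \<subseteq> T" "card (I - {j}) = p" using assms by (auto simp: chain_def)
    moreover have "finite (I - {j})" using \<open>I - {j} \<subseteq> T\<close> fin finite_subset by blast
    ultimately show ?thesis using True card.remove[of I j] by auto
  next
    case False
    then show ?thesis using nz assms by (auto simp: join_def chain_def)
  qed
  then show "I \<subseteq> insert j T" "card I = Suc p" by auto
qed

text \<open>A segment of the long exact sequence of the cone: its homology in degree
  \<open>Suc p\<close> lies between that of \<open>T\<close> in the same degree and the kernel of
  \<open>x j\<close> on the homology of \<open>T\<close> in degree \<open>p\<close>.\<close>

lemma acyclic_at_insertI:
  assumes "acyclic_at T (Suc p)"
    and inj: "\<And>z. chain T p z \<Longrightarrow> kd T z = (\<lambda>_. 0) \<Longrightarrow> boundary T p (\<lambda>I. x j (z I)) \<Longrightarrow> boundary T p z"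
  shows "acyclic_at (insert j T) (Suc p)"
  unfolding acyclic_at_def
proof (intro allI impI, elim conjE)
  fix z assume z: "chain (insert j T) (Suc p) z" and cyc: "kd (insert j T) z = (\<lambda>_. 0)"
  define z0 z1 where "z0 = base T z" and "z1 = slice j T z"
  have c0: "chain T (Suc p) z0" and c1: "chain T p z1"
    using z chain_base chain_slice by (auto simp: z0_def z1_def)
  have e0: "kd T z0 I + x j (z1 I) = 0" for I
    using base_kd[of z I] cyc by (simp add: z0_def z1_def)
  have e1: "kd T z1 = (\<lambda>_. 0)"
    using slice_kd[of z] cyc by (simp add: z1_def fun_eq_iff)
  have "kd T (\<lambda>I. - z0 I) = (\<lambda>I. x j (z1 I))"
    using e0 by (simp add: kd_uminus fun_eq_iff neg_eq_iff_add_eq_0)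
  then have "boundary T p (\<lambda>I. x j (z1 I))"
    by (rule boundaryI[OF chain_uminus[OF c0]])
  then obtain w1' where w1': "chain T (Suc p) w1'" "kd T w1' = z1"
    by (rule boundaryE[OF inj[OF c1 e1]])
  \<comment> \<open>The sign compensates the one in \<open>slice_kd\<close>.\<close>
  define w1 where "w1 = (\<lambda>I. - w1' I)"
  have w1: "chain T (Suc p) w1" "kd T w1 = (\<lambda>I. - z1 I)"
    using w1' by (auto simp: w1_def chain_uminus kd_uminus)
  \<comment> \<open>Subtracting \<open>x j (w1 I)\<close> turns \<open>z0\<close> into a cycle of
    \<open>T\<close>: both have the boundary \<open>- x j (z1 I)\<close>.\<close>
  have "chain T (Suc p) (\<lambda>I. z0 I - x j (w1 I))"
    using c0 w1 by (intro chain_diff chain_op)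
  moreover have "kd T (\<lambda>I. z0 I - x j (w1 I)) = (\<lambda>_. 0)"
    using e0 by (simp only: kd_diff kd_op w1 op_uminus diff_minus_eq_add)
  ultimately have "boundary T (Suc p) (\<lambda>I. z0 I - x j (w1 I))"
    by (rule acyclic_atD[OF assms(1)])
  then obtain w0 where w0: "chain T (Suc (Suc p)) w0" "kd T w0 = (\<lambda>I. z0 I - x j (w1 I))"
    by (rule boundaryE)
  define w where "w = join j w0 w1"
  have bw: "base T w = w0" "slice j T w = w1"
    using w0 w1 base_join slice_join by (auto simp: w_def)
  have "kd (insert j T) w = z"
  proof (rule cone_eqI)
    show "base T (kd (insert j T) w) = base T z"
      using w0 by (simp add: fun_eq_iff base_kd bw z0_def)
    show "slice j T (kd (insert j T) w) = slice j T z"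
      using w1 by (simp add: fun_eq_iff slice_kd bw z1_def)
    fix I assume "\<not> I \<subseteq> insert j T"
    then show "kd (insert j T) w I = z I"
      using chain_eq_0[OF z] by (simp add: kd_outside)
  qed
  then show "boundary (insert j T) (Suc p) z"
    using chain_join[OF w0(1) w1(1)] by (intro boundaryI[of _ _ w]) (simp_all add: w_def)
qed

text \<open>If \<open>w\<close> bounds the multiple of \<open>z\<close> by \<open>x j\<close>, then
  \<open>- w\<close> and \<open>z\<close> together form a cycle of the cone. A chain that bounds
  this cycle has a slice that bounds \<open>z\<close> up to sign.\<close>

lemma boundary_of_op_boundary:
  assumes "acyclic_at (insert j T) (Suc p)" "chain T p z" "kd T z = (\<lambda>_. 0)"
    and "boundary T p (\<lambda>I. x j (z I))"
  shows "boundary T p z"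
proof -
  obtain w where w: "chain T (Suc p) w" "kd T w = (\<lambda>I. x j (z I))"
    using assms(4) by (rule boundaryE)
  define y where "y = join j (\<lambda>I. - w I) z"
  have cy: "chain (insert j T) (Suc p) y"
    using chain_join[OF chain_uminus[OF w(1)] assms(2)] by (simp add: y_def)
  have by': "base T y = (\<lambda>I. - w I)" "slice j T y = z"
    using base_join[OF chain_uminus[OF w(1)]] slice_join[OF assms(2)] by (auto simp: y_def)
  have "kd (insert j T) y = (\<lambda>_. 0)"
  proof (rule cone_eqI)
    show "base T (kd (insert j T) y) = base T (\<lambda>_. 0)"
      by (simp add: fun_eq_iff base_kd by' kd_uminus w)
    show "slice j T (kd (insert j T) y) = slice j T (\<lambda>_. 0)"
      by (simp add: fun_eq_iff slice_kd by' assms)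
  qed (simp add: kd_outside)
  then obtain v where v: "chain (insert j T) (Suc (Suc p)) v" "kd (insert j T) v = y"
    by (rule boundaryE[OF acyclic_atD[OF assms(1) cy]])
  have "z = (\<lambda>I. - kd T (slice j T v) I)"
    using by'(2) slice_kd[of v] v(2) by (auto simp: fun_eq_iff)
  then have "kd T (\<lambda>I. - slice j T v I) = z" by (simp add: kd_uminus)
  then show ?thesis
    by (rule boundaryI[OF chain_uminus[OF chain_slice[OF v(1)]]])
qed

text \<open>The surjectivity half of the long exact sequence of the cone.\<close>

lemma cycle_eq_boundary_plus_op:
  assumes "acyclic_at (insert j T) (Suc p)" "chain T (Suc p) z" "kd T z = (\<lambda>_. 0)"
  obtains a b where "chain T (Suc (Suc p)) a" "chain T (Suc p) b" "kd T b = (\<lambda>_. 0)"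
    "z = (\<lambda>I. kd T a I + x j (b I))"
proof -
  define y where "y = join j z (\<lambda>_. 0)"
  have cy: "chain (insert j T) (Suc p) y"
    using chain_join[OF assms(2) chain_zero] by (simp add: y_def)
  have by': "base T y = z" "slice j T y = (\<lambda>_. 0)"
    using base_join[OF assms(2)] slice_join[OF chain_zero] by (auto simp: y_def)
  have "kd (insert j T) y = (\<lambda>_. 0)"
  proof (rule cone_eqI)
    show "base T (kd (insert j T) y) = base T (\<lambda>_. 0)"
      by (simp add: fun_eq_iff base_kd by' assms)
    show "slice j T (kd (insert j T) y) = slice j T (\<lambda>_. 0)"
      by (simp add: fun_eq_iff slice_kd by')
  qed (simp add: kd_outside)
  then obtain v where v: "chain (insert j T) (Suc (Suc p)) v" "kd (insert j T) v = y"
    by (rule boundaryE[OF acyclic_atD[OF assms(1) cy]])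
  show thesis
  proof (rule that[of "base T v" "slice j T v"])
    show "kd T (slice j T v) = (\<lambda>_. 0)"
      using by'(2) slice_kd[of v] v(2) by (auto simp: fun_eq_iff)
    show "z = (\<lambda>I. kd T (base T v) I + x j (slice j T v I))"
      using by'(1) base_kd[of v] v(2) by (auto simp: fun_eq_iff)
  qed (use chain_base chain_slice v in auto)
qed

end

text \<open>The operators of a Koszul complex act as zero on its homology; the contracting homotopy
  is the exterior product with the basis vector of \<open>j\<close>.\<close>

lemma boundary_op:
  assumes "finite T" "j \<in> T" "chain T p z" "kd T z = (\<lambda>_. 0)"
  shows "boundary T p (\<lambda>I. x j (z I))"
proof -
  define T' where "T' = T - {j}"
  have T: "T = insert j T'" and fin: "finite T'" and j: "j \<notin> T'"
    using assms by (auto simp: T'_def)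
  \<comment> \<open>The exterior product: the part of \<open>z\<close> without \<open>j\<close> is
    moved into the slot of \<open>j\<close>.\<close>
  define y where "y = join j (\<lambda>_. 0) (base T' z)"
  have c: "chain T' p (base T' z)" using chain_base[OF fin j] assms(3) T by simp
  have by': "base T' y = (\<lambda>_. 0)" "slice j T' y = base T' z"
    using base_join[OF fin j chain_zero] slice_join[OF fin j c] by (auto simp: y_def)
  have e: "kd T' (base T' z) I + x j (slice j T' z I) = 0" for I
    using base_kd[OF fin j, of z I] assms(4)[unfolded T] by simp
  have "kd T y = (\<lambda>I. x j (z I))"
    unfolding T
  proof (rule cone_eqI[OF fin j])
    show "base T' (kd (insert j T') y) = base T' (\<lambda>I. x j (z I))"
      by (auto simp add: fun_eq_iff base_kd[OF fin j] by') (auto simp: base_def)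
    show "slice j T' (kd (insert j T') y) = slice j T' (\<lambda>I. x j (z I))"
    proof
      fix I
      have "slice j T' (kd (insert j T') y) I = x j (slice j T' z I)"
        using e[of I] by (simp add: slice_kd[OF fin j] by' neg_eq_iff_add_eq_0)
      also have "\<dots> = slice j T' (\<lambda>I. x j (z I)) I" by (simp add: slice_def op_sg)
      finally show "slice j T' (kd (insert j T') y) I = slice j T' (\<lambda>I. x j (z I)) I" .
    qed
    fix I assume "\<not> I \<subseteq> insert j T'"
    then show "kd (insert j T') y I = x j (z I)"
      using chain_eq_0[OF assms(3)] by (simp add: kd_outside T)
  qed
  moreover have "chain T (Suc p) y"
    using chain_join[OF fin j chain_zero c] T by (simp add: y_def)
  ultimately show ?thesis by (intro boundaryI)
qed

text \<open>In the cone decomposition the two mixed terms cancel, because \<open>x j\<close>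
  commutes with the differential of the smaller complex and the slice carries a minus sign.\<close>

lemma kd_kd:
  assumes "finite T"
  shows "kd T (kd T z) = (\<lambda>_. 0)"
  using assms
proof (induction T arbitrary: z rule: finite_induct)
  case empty
  show ?case by (auto simp: kd_def)
next
  case (insert j T)
  note ins = insert.hyps
  have b: "base T (kd (insert j T) z) = (\<lambda>I. kd T (base T z) I + x j (slice j T z I))" for z
    using base_kd[OF ins] by (simp add: fun_eq_iff)
  have s: "slice j T (kd (insert j T) z) = (\<lambda>I. - kd T (slice j T z) I)" for z
    using slice_kd[OF ins] by (simp add: fun_eq_iff)
  show ?case
  proof (rule cone_eqI[OF ins])
    show "base T (kd (insert j T) (kd (insert j T) z)) = base T (\<lambda>_. 0)"
      by (simp add: b s kd_add kd_op op_uminus insert.IH fun_eq_iff)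
    show "slice j T (kd (insert j T) (kd (insert j T) z)) = slice j T (\<lambda>_. 0)"
      by (simp add: s kd_uminus insert.IH fun_eq_iff)
  qed (simp add: kd_outside)
qed

text \<open>Whatever the new operator is, it raises the top degree of homology by at most one: the
  kernel in the cone sequence is then taken in a degree where the homology already vanishes.\<close>

lemma acyclic_at_Un:
  assumes "finite T" "finite Z" "Z \<inter> T = {}" "\<And>p. p > q \<Longrightarrow> acyclic_at T p"
    and "p > q + card Z"
  shows "acyclic_at (T \<union> Z) p"
  using assms(2,3,5)
proof (induction Z arbitrary: p rule: finite_induct)
  case empty
  then show ?case using assms by simp
next
  case (insert j Z)
  obtain p' where p: "p = Suc p'" using insert.prems by (cases p) auto
  have "acyclic_at (T \<union> Z) p'" "acyclic_at (T \<union> Z) p"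
    using insert.IH insert.hyps insert.prems p by auto
  then have "acyclic_at (insert j (T \<union> Z)) (Suc p')"
    using insert.hyps insert.prems assms(1) p
    by (intro acyclic_at_insertI) (auto elim: acyclic_atD)
  then show ?case using p by simp
qed

text \<open>Depth sensitivity of the Koszul complex: adjoining an operator that acts nilpotently on the
  homology raises the top nonvanishing degree by exactly one.\<close>

theorem acyclic_at_transfer:
  assumes "finite T" "finite Z" "Z \<inter> T = {}"
    and nil: "\<And>j. j \<in> Z \<Longrightarrow> \<exists>N b. (\<forall>m. (x j ^^ N) m = (\<Sum>i\<in>T. x i (b i m))) \<and>
        (\<forall>i m m'. b i (m + m') = b i m + b i m') \<and> (\<forall>i k m. b i (x k m) = x k (b i m)) \<and>
        (\<forall>i. \<forall>m\<in>M. b i m \<in> M)"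
    and "\<And>p. p > card Z \<Longrightarrow> acyclic_at (T \<union> Z) p"
  shows "p > 0 \<Longrightarrow> acyclic_at T p"
  using assms(2,3,4,5)
proof (induction Z arbitrary: p rule: finite_induct)
  case empty
  then show ?case by simp
next
  case (insert j Z)
  have fin: "finite (T \<union> Z)" using insert.hyps assms(1) by simp
  have jn: "j \<notin> T \<union> Z" using insert.hyps insert.prems by auto
  from insert.prems(3)[OF insertI1] obtain N b where
    b: "(\<forall>m. (x j ^^ N) m = (\<Sum>i\<in>T. x i (b i m))) \<and>
        (\<forall>i m m'. b i (m + m') = b i m + b i m') \<and> (\<forall>i k m. b i (x k m) = x k (b i m)) \<and>
        (\<forall>i. \<forall>m\<in>M. b i m \<in> M)"
    by (elim exE) (rule that)
  have N: "(x j ^^ N) m = (\<Sum>i\<in>T. x i (b i m))" and badd: "b i (m + m') = b i m + b i m'"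
    and bcomm: "b i (x k m) = x k (b i m)" and bM: "m \<in> M \<Longrightarrow> b i m \<in> M" for i k m m'
    using b by simp_all
  have bz: "b i 0 = 0" for i using badd[of i 0 0] by simp
  have "acyclic_at (T \<union> Z) p" if "p > card Z" for p
    unfolding acyclic_at_def
  proof (intro allI impI, elim conjE)
    fix z assume z: "chain (T \<union> Z) p z" "kd (T \<union> Z) z = (\<lambda>_. 0)"
    have ac: "acyclic_at (insert j (T \<union> Z)) (Suc p)"
      using insert.prems(4)[of "Suc p"] that insert.hyps by simp
    \<comment> \<open>Acyclicity of the larger complex one degree higher makes \<open>x j\<close>
      injective on homology in degree \<open>p\<close>, so the powers of \<open>x j\<close> can be
      peeled off one at a time.\<close>
    have step: "boundary (T \<union> Z) p z'"
      if "chain (T \<union> Z) p z'" "kd (T \<union> Z) z' = (\<lambda>_. 0)"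
        "boundary (T \<union> Z) p (\<lambda>I. (x j ^^ k) (z' I))" for k z'
      using that
    proof (induction k arbitrary: z')
      case (Suc k)
      have "(\<lambda>I. (x j ^^ Suc k) (z' I)) = (\<lambda>I. (x j ^^ k) (x j (z' I)))"
        by (simp only: funpow_Suc_right comp_apply)
      then have b': "boundary (T \<union> Z) p (\<lambda>I. (x j ^^ k) (x j (z' I)))"
        using Suc.prems(3) by (simp only:)
      have "kd (T \<union> Z) (\<lambda>I. x j (z' I)) = (\<lambda>_. 0)"
        by (simp only: kd_op Suc.prems(2) op_zero)
      from Suc.IH[OF chain_op[OF Suc.prems(1)] this b'] have "boundary (T \<union> Z) p (\<lambda>I. x j (z' I))" .
      then show ?case
        by (rule boundary_of_op_boundary[OF fin jn ac Suc.prems(1,2)])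
    qed simp
    \<comment> \<open>Additivity and commutation make \<open>b i\<close> a map of complexes, so its
      value on \<open>z\<close> is again a cycle, which \<open>x i\<close> turns into a
      boundary.\<close>
    have "boundary (T \<union> Z) p (\<lambda>I. x i (b i (z I)))" if "i \<in> T" for i
    proof (rule boundary_op[OF fin])
      show "chain (T \<union> Z) p (\<lambda>I. b i (z I))"
        by (rule chainI) (simp_all add: bM[OF chain_mem[OF z(1)]] chain_eq_0[OF z(1)] bz)
      show "kd (T \<union> Z) (\<lambda>I. b i (z I)) = (\<lambda>_. 0)"
        by (simp only: kd_intertwine[of "b i" _ "b i", OF badd bcomm] z(2) bz)
    qed (use that in auto)
    then have "boundary (T \<union> Z) p (\<lambda>I. (x j ^^ N) (z I))"
      unfolding N by (rule boundary_sum)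
    then show "boundary (T \<union> Z) p z" by (rule step[OF z])
  qed
  then show ?case using insert.IH[OF insert.prems(1)] insert.prems by auto
qed

text \<open>Homology in degree 0 is the quotient by the ideal of the operators; this embedding
  translates ideal membership into being a boundary.\<close>

definition degree0 :: "'m \<Rightarrow> nat set \<Rightarrow> 'm" where
  "degree0 m I = (if I = {} then m else 0)"

lemma chain_degree0: "m \<in> M \<Longrightarrow> chain T 0 (degree0 m)"
  by (rule chainI) (auto simp: degree0_def zero_mem)

lemma kd_degree0: "kd T (degree0 m) = (\<lambda>_. 0)"
  by (auto simp: kd_def degree0_def fun_eq_iff)

lemma boundary_degree0:
  assumes "finite T"
  shows "boundary T 0 (degree0 m) \<longleftrightarrow> (\<exists>h. (\<forall>j. h j \<in> M) \<and> m = (\<Sum>j\<in>T. x j (h j)))"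
proof
  assume "boundary T 0 (degree0 m)"
  then obtain w where w: "chain T (Suc 0) w" "kd T w = degree0 m" by (rule boundaryE)
  have "m = kd T w {}" by (simp add: w(2) degree0_def)
  also have "\<dots> = (\<Sum>j\<in>T. x j (w {j}))" by (simp add: kd_def sg_def)
  finally show "\<exists>h. (\<forall>j. h j \<in> M) \<and> m = (\<Sum>j\<in>T. x j (h j))"
    using chain_mem[OF w(1)] by (intro exI[of _ "\<lambda>j. w {j}"]) simp
next
  assume "\<exists>h. (\<forall>j. h j \<in> M) \<and> m = (\<Sum>j\<in>T. x j (h j))"
  then obtain h where h: "\<forall>j. h j \<in> M" "m = (\<Sum>j\<in>T. x j (h j))" by blast
  define w where "w I = (if I \<subseteq> T \<and> card I = Suc 0 then h (the_elem I) else 0)" for I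
  have "chain T (Suc 0) w" by (rule chainI) (auto simp: w_def h(1) zero_mem)
  moreover have "kd T w = degree0 m"
  proof
    fix I
    show "kd T w I = degree0 m I"
    proof (cases "I = {}")
      case True
      then show ?thesis by (simp add: kd_def sg_def w_def degree0_def h(2))
    next
      case False
      have "w (insert j I) = 0" if "I \<subseteq> T" "j \<notin> I" for j
      proof -
        have "finite I" using that(1) assms finite_subset by blast
        then have "card (insert j I) \<noteq> Suc 0" using that(2) False by simp
        then show ?thesis by (simp add: w_def)
      qed
      then show ?thesis using False by (simp add: kd_def degree0_def)
    qed
  qed
  ultimately show "boundary T 0 (degree0 m)" by (rule boundaryI)
qed

end

section \<open>Lexicographic linear programs\<close>

definition lexneg :: "(nat \<Rightarrow> real) \<Rightarrow> bool" where
  "lexneg f \<longleftrightarrow> (\<exists>k. f k < 0 \<and> (\<forall>j<k. f j = 0))"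

lemma lexneg_total: "f k \<noteq> 0 \<Longrightarrow> lexneg f \<or> lexneg (\<lambda>i. - f i)"
proof -
  assume "f k \<noteq> 0"
  define m where "m = (LEAST k. f k \<noteq> 0)"
  have "f m \<noteq> 0" unfolding m_def by (rule LeastI) fact
  moreover have "f j = 0" if "j < m" for j
    using not_less_Least[of j "\<lambda>k. f k \<noteq> 0"] that by (auto simp: m_def)
  ultimately show ?thesis
    unfolding lexneg_def by (metis linorder_neqE_linordered_idom neg_less_0_iff_less neg_equal_0_iff_equal)
qed

lemma lexneg_add:
  assumes "lexneg f" "lexneg g"
  shows "lexneg (\<lambda>i. f i + g i)"
proof -
  obtain k l where kl: "f k < 0" "\<forall>j<k. f j = 0" "g l < 0" "\<forall>j<l. g j = 0"
    using assms by (auto simp: lexneg_def)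
  consider "k < l" | "l < k" | "k = l" by linarith
  then show ?thesis
    unfolding lexneg_def using kl by cases (auto intro!: exI[of _ "min k l"])
qed

lemma lexneg_scale: "c > 0 \<Longrightarrow> lexneg f \<Longrightarrow> lexneg (\<lambda>i. c * f i)"
  unfolding lexneg_def by (auto intro!: mult_pos_neg)

lemma lexneg_obtains_neg: "lexneg f \<Longrightarrow> \<exists>k. f k < 0"
  by (auto simp: lexneg_def)

locale cone_program =
  fixes w :: "nat \<Rightarrow> real ^ 'n" and N :: nat
begin

definition val :: "(nat \<Rightarrow> real) \<Rightarrow> real ^ 'n" where
  "val l = (\<Sum>i<N. l i *\<^sub>R w i)"

text \<open>The total weight comes first, so \<open>cheaper\<close> compares total weights and breaks ties lexicographically.\<close>

definition cost :: "(nat \<Rightarrow> real) \<Rightarrow> nat \<Rightarrow> real" where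
  "cost l k = (case k of 0 \<Rightarrow> \<Sum>i<N. l i | Suc i \<Rightarrow> l i)"

definition supp :: "(nat \<Rightarrow> real) \<Rightarrow> nat set" where
  "supp l = {i. l i \<noteq> 0}"

definition feasible :: "real ^ 'n \<Rightarrow> (nat \<Rightarrow> real) \<Rightarrow> bool" where
  "feasible z l \<longleftrightarrow> (\<forall>i. 0 \<le> l i) \<and> supp l \<subseteq> {..<N} \<and> val l = z"

definition cheaper :: "(nat \<Rightarrow> real) \<Rightarrow> (nat \<Rightarrow> real) \<Rightarrow> bool" where
  "cheaper l l' \<longleftrightarrow> lexneg (cost (\<lambda>i. l i - l' i))"

definition optimal :: "real ^ 'n \<Rightarrow> (nat \<Rightarrow> real) \<Rightarrow> bool" where
  "optimal z l \<longleftrightarrow> feasible z l \<and> (\<forall>l'. feasible z l' \<longrightarrow> \<not> cheaper l' l)"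

definition indep :: "nat set \<Rightarrow> bool" where
  "indep S \<longleftrightarrow> (\<forall>m. supp m \<subseteq> S \<and> val m = 0 \<longrightarrow> m = (\<lambda>_. 0))"

lemma indepD: "indep S \<Longrightarrow> supp m \<subseteq> S \<Longrightarrow> val m = 0 \<Longrightarrow> m = (\<lambda>_. 0)"
  by (simp add: indep_def)

lemma val_add: "val (\<lambda>i. l i + m i) = val l + val m"
  by (simp add: val_def scaleR_add_left sum.distrib)

lemma val_diff: "val (\<lambda>i. l i - m i) = val l - val m"
  by (simp add: val_def scaleR_diff_left sum_subtractf)

lemma val_scale: "val (\<lambda>i. c * l i) = c *\<^sub>R val l"
  by (simp add: val_def scaleR_sum_right)

lemma val_unit: "j < N \<Longrightarrow> val (\<lambda>i. of_bool (i = j)) = w j"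
proof -
  assume "j < N"
  have "val (\<lambda>i. of_bool (i = j)) = (\<Sum>i<N. if i = j then w i else 0)"
    unfolding val_def by (intro sum.cong) auto
  with \<open>j < N\<close> show ?thesis by simp
qed

lemma cost_add: "cost (\<lambda>i. l i + m i) = (\<lambda>k. cost l k + cost m k)"
  by (auto simp: cost_def sum.distrib split: nat.split)

lemma cost_uminus: "cost (\<lambda>i. - l i) = (\<lambda>k. - cost l k)"
  by (auto simp: cost_def sum_negf split: nat.split)

lemma cost_scale: "cost (\<lambda>i. c * l i) = (\<lambda>k. c * cost l k)"
  by (auto simp: cost_def sum_distrib_left split: nat.split)

lemma cheaper_irrefl: "\<not> cheaper l l"
  using lexneg_obtains_neg by (fastforce simp: cheaper_def cost_def split: nat.splits)

lemma cheaper_trans: "cheaper a b \<Longrightarrow> cheaper b c \<Longrightarrow> cheaper a c"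
  unfolding cheaper_def
  using lexneg_add[of "cost (\<lambda>i. a i - b i)" "cost (\<lambda>i. b i - c i)"]
  by (simp add: cost_add[symmetric])

lemma cheaper_total: "l \<noteq> m \<Longrightarrow> cheaper l m \<or> cheaper m l"
proof -
  assume "l \<noteq> m"
  then obtain i where "l i \<noteq> m i" by auto
  then have "cost (\<lambda>i. l i - m i) (Suc i) \<noteq> 0" by (simp add: cost_def)
  from lexneg_total[of "cost (\<lambda>i. l i - m i)", OF this] show ?thesis
    by (simp add: cheaper_def cost_uminus[symmetric])
qed

lemma cheaper_add: "cheaper (\<lambda>i. a i + c i) (\<lambda>i. b i + c i) \<longleftrightarrow> cheaper a b"
  by (simp add: cheaper_def)

lemma optimal_unique: "optimal z l \<Longrightarrow> optimal z m \<Longrightarrow> l = m"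
  using cheaper_total unfolding optimal_def by blast

text \<open>The pivot step of the simplex method: follow a linear dependency in the direction of
  decreasing cost until a coefficient reaches 0.\<close>

lemma feasible_supp_decrease:
  assumes l: "feasible z l" and m: "supp m \<subseteq> supp l" "val m = 0" "m \<noteq> (\<lambda>_. 0)"
  obtains l' where "feasible z l'" "cheaper l' l" "supp l' \<subset> supp l"
proof -
  \<comment> \<open>Either \<open>m\<close> or its negative decreases the cost.\<close>
  have "\<exists>m. supp m \<subseteq> supp l \<and> val m = 0 \<and> lexneg (cost m)"
  proof -
    from m(3) obtain i where "m i \<noteq> 0" by auto
    then have "cost m (Suc i) \<noteq> 0" by (simp add: cost_def)
    from lexneg_total[of "cost m", OF this] show ?thesis
    proof
      assume "lexneg (\<lambda>i. - cost m i)"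
      then show ?thesis using m val_scale[of "-1" m]
        by (intro exI[of _ "\<lambda>i. - m i"]) (auto simp: cost_uminus supp_def)
    qed (use m in auto)
  qed
  then obtain m where m: "supp m \<subseteq> supp l" "val m = 0" and neg: "lexneg (cost m)" by blast
  \<comment> \<open>Some entry must be negative, for otherwise every entry of the cost would be
    nonnegative. So the motion along \<open>m\<close> is blocked by a constraint.\<close>
  have "\<exists>i. m i < 0"
  proof (rule ccontr)
    assume "\<not> (\<exists>i. m i < 0)"
    then have "cost m k \<ge> 0" for k
      by (auto simp: cost_def not_less intro!: sum_nonneg split: nat.split)
    then show False using lexneg_obtains_neg[OF neg] by (metis not_less)
  qed
  define Neg where "Neg = {i. m i < 0}"
  have "Neg \<subseteq> supp m" by (auto simp: Neg_def supp_def)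
  with \<open>\<exists>i. m i < 0\<close> m(1) have Neg: "Neg \<noteq> {}" "Neg \<subseteq> supp l" by (auto simp: Neg_def)
  have fin: "finite (supp l)" using l by (auto simp: feasible_def intro: finite_subset)
  then have finN: "finite Neg" using Neg finite_subset by blast
  \<comment> \<open>The longest step that keeps all coefficients nonnegative; an index attaining the
    minimum leaves the support.\<close>
  define t where "t = Min ((\<lambda>i. l i / (- m i)) ` Neg)"
  have "t \<in> (\<lambda>i. l i / (- m i)) ` Neg" unfolding t_def using finN Neg by (intro Min_in) auto
  then obtain k where k: "k \<in> Neg" "t = l k / (- m k)" by blast
  have pos: "l i > 0" if "i \<in> supp l" for i
    using l that by (auto simp: feasible_def supp_def less_le)
  have "k \<in> supp l" "m k < 0" using k Neg by (auto simp: Neg_def)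
  then have tpos: "t > 0" using k(2) pos[of k] by (simp add: divide_pos_neg)
  have tle: "t * (- m i) \<le> l i" if "i \<in> Neg" for i
  proof -
    have "t \<le> l i / (- m i)" unfolding t_def using finN that by (intro Min_le) auto
    moreover have "- m i > 0" using that by (simp add: Neg_def)
    ultimately show ?thesis by (simp only: pos_le_divide_eq)
  qed
  define l' where "l' = (\<lambda>i. l i + t * m i)"
  have l0: "0 \<le> l i" for i using l by (simp add: feasible_def)
  have nn: "0 \<le> l' i" for i
  proof (cases "i \<in> Neg")
    case True
    then show ?thesis using tle[of i] by (simp add: l'_def)
  next
    case False
    then have "0 \<le> m i" by (simp add: Neg_def)
    then show ?thesis using l0[of i] tpos by (simp add: l'_def)
  qed
  have sub: "supp l' \<subseteq> supp l" using m(1) by (auto simp: l'_def supp_def)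
  have "l' k = 0" using k by (auto simp: l'_def Neg_def)
  then have "k \<notin> supp l'" "k \<in> supp l" using k Neg by (auto simp: supp_def)
  show thesis
  proof (rule that)
    show "feasible z l'"
      using nn sub l m(2) by (auto simp: feasible_def l'_def val_add val_scale)
    show "cheaper l' l"
      using lexneg_scale[OF tpos neg] by (simp add: cheaper_def l'_def cost_scale)
    show "supp l' \<subset> supp l" using sub \<open>k \<notin> supp l'\<close> \<open>k \<in> supp l\<close> by blast
  qed
qed

lemma feasible_basic:
  assumes "feasible z l"
  shows "\<exists>l'. feasible z l' \<and> (l' = l \<or> cheaper l' l) \<and> indep (supp l')"
  using assms
proof (induction "card (supp l)" arbitrary: l rule: less_induct)
  case less
  show ?case
  proof (cases "indep (supp l)")
    case False
    then obtain m where "supp m \<subseteq> supp l" "val m = 0" "m \<noteq> (\<lambda>_. 0)"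
      by (auto simp: indep_def)
    then obtain l' where l': "feasible z l'" "cheaper l' l" "supp l' \<subset> supp l"
      using feasible_supp_decrease[OF less.prems] by blast
    have "finite (supp l)" using less.prems by (auto simp: feasible_def intro: finite_subset)
    then have "card (supp l') < card (supp l)" using l'(3) by (rule psubset_card_mono)
    from less.hyps[OF this l'(1)] show ?thesis using l'(2) cheaper_trans by blast
  qed (use less.prems in blast)
qed

text \<open>An independent support determines its coefficients, so there are finitely many basic
  representations. One of them is minimal, and by \<open>feasible_basic\<close> it is not beaten by
  nonbasic ones either.\<close>

lemma optimal_exists:
  assumes "feasible z l"
  shows "\<exists>l. optimal z l"
proof -
  define B where "B = {l. feasible z l \<and> indep (supp l)}"
  have inj: "inj_on supp B"
  proof (rule inj_onI)
    fix a b assume ab: "a \<in> B" "b \<in> B" "supp a = supp b"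
    then have "supp (\<lambda>i. a i - b i) \<subseteq> supp a" "val (\<lambda>i. a i - b i) = 0"
      by (auto simp: B_def feasible_def val_diff supp_def)
    moreover have "indep (supp a)" using ab by (simp add: B_def)
    ultimately have "(\<lambda>i. a i - b i) = (\<lambda>_. 0)" by (intro indepD)
    then show "a = b" by (simp add: fun_eq_iff)
  qed
  have "finite (supp ` B)"
    by (rule finite_subset[of _ "Pow {..<N}"]) (auto simp: B_def feasible_def)
  then have fin: "finite B" using inj finite_imageD by blast
  have "B \<noteq> {}" using feasible_basic[OF assms] by (auto simp: B_def)
  have "asymp_on B cheaper"
    by (rule asymp_onI) (use cheaper_trans cheaper_irrefl in blast)
  moreover have "transp_on B cheaper"
    by (rule transp_onI) (use cheaper_trans in blast)
  ultimately obtain m where m: "m \<in> B" "\<And>l. l \<in> B \<Longrightarrow> l \<noteq> m \<Longrightarrow> \<not> cheaper l m"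
    using Finite_Set.bex_min_element[OF fin _ _ \<open>B \<noteq> {}\<close>, of cheaper] by blast
  have "\<not> cheaper l' m" if l': "feasible z l'" for l'
  proof
    assume "cheaper l' m"
    obtain b where "feasible z b" "b = l' \<or> cheaper b l'" "indep (supp b)"
      using feasible_basic[OF l'] by blast
    then have "b \<in> B" "cheaper b m" using \<open>cheaper l' m\<close> cheaper_trans by (auto simp: B_def)
    then show False using m cheaper_irrefl by blast
  qed
  then show ?thesis using m by (auto simp: optimal_def B_def)
qed

lemma optimal_indep: "optimal z l \<Longrightarrow> indep (supp l)"
  using feasible_basic unfolding optimal_def by blast

text \<open>If \<open>m'\<close> were cheaper than \<open>m\<close>, a small multiple of
  \<open>m' - m\<close> could be added to \<open>l\<close>: the possibly negative entries lie in the
  support of \<open>l\<close>, where there is room.\<close>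

lemma optimal_face:
  assumes l: "optimal z l" and m: "supp m \<subseteq> supp l" "\<And>i. 0 \<le> m i"
  shows "optimal (val m) m"
  unfolding optimal_def
proof (intro conjI allI impI notI)
  have fl: "feasible z l" using l by (simp add: optimal_def)
  then have sN: "supp l \<subseteq> {..<N}" by (simp add: feasible_def)
  show "feasible (val m) m" using m sN by (auto simp: feasible_def)
  fix m' assume m': "feasible (val m) m'" and ch: "cheaper m' m"
  define d where "d = (\<lambda>i. m' i - m i)"
  \<comment> \<open>The denominators \<open>1 + m i\<close> cannot vanish and still give
    \<open>t * m i \<le> l i\<close>; the element 1 covers an empty support.\<close>
  define t where "t = Min (insert 1 ((\<lambda>i. l i / (1 + m i)) ` supp l))"
  have fin: "finite (supp l)" using sN finite_subset by blast
  have l0: "0 \<le> l i" for i using fl by (simp add: feasible_def)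
  have tpos: "t > 0"
    unfolding t_def using fin l0 m(2)
    by (subst Min_gr_iff) (auto simp: supp_def less_le add_nonneg_eq_0_iff intro!: divide_pos_pos add_pos_nonneg)
  have tle: "t * m i \<le> l i" for i
  proof (cases "i \<in> supp l")
    case True
    have "t \<le> l i / (1 + m i)" unfolding t_def using fin True by (intro Min_le) auto
    then have "t * (1 + m i) \<le> l i" using m(2)[of i] by (subst (asm) pos_le_divide_eq) auto
    then show ?thesis using tpos by (simp add: algebra_simps)
  next
    case False
    then have "m i = 0" using m(1) by (auto simp: supp_def)
    then show ?thesis using l0 by simp
  qed
  define l' where "l' = (\<lambda>i. l i + t * d i)"
  have "0 \<le> l' i" for i
  proof -
    have "0 \<le> t * m' i" using tpos m' by (simp add: feasible_def)
    then show ?thesis using tle[of i] by (simp add: l'_def d_def algebra_simps)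
  qed
  moreover have "supp l' \<subseteq> {..<N}"
  proof
    fix i assume "i \<in> supp l'"
    then have "i \<in> supp l \<or> i \<in> supp m \<or> i \<in> supp m'"
      by (auto simp: supp_def l'_def d_def)
    then show "i \<in> {..<N}" using sN m m' by (auto simp: feasible_def)
  qed
  moreover have "val l' = z"
    using fl m' by (simp add: l'_def d_def val_add val_scale val_diff feasible_def)
  moreover have "cheaper l' l"
    using lexneg_scale[OF tpos ch[unfolded cheaper_def]] by (simp add: cheaper_def l'_def cost_scale d_def)
  ultimately show False using l by (auto simp: optimal_def feasible_def)
qed

text \<open>\<open>indep\<close> concerns the indexed family, so injectivity of \<open>w\<close> on
  \<open>S\<close> must be extracted before the bound on the size of independent sets of vectors
  applies.\<close>

lemma indep_card_le:
  assumes "indep S" "S \<subseteq> {..<N}"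
  shows "inj_on w S" "independent (w ` S)" "card S \<le> CARD('n)"
proof -
  have fin: "finite S" using assms finite_subset by blast
  have z: "m i = 0" if "i \<in> S" "supp m \<subseteq> S" "(\<Sum>i\<in>S. m i *\<^sub>R w i) = 0" for m i
  proof -
    have "val m = (\<Sum>i\<in>S. m i *\<^sub>R w i)"
      unfolding val_def using that assms by (intro sum.mono_neutral_right) (auto simp: supp_def)
    then have "val m = 0" using that by simp
    then have "m = (\<lambda>_. 0)" using assms(1) that(2) by (intro indepD)
    then show ?thesis by simp
  qed
  show inj: "inj_on w S"
  proof (rule inj_onI, rule ccontr)
    fix i j assume ij: "i \<in> S" "j \<in> S" "w i = w j" "i \<noteq> j"
    define m where "m k = (if k = i then 1 else if k = j then - 1 else 0 :: real)" for k
    have "(\<Sum>k\<in>S. m k *\<^sub>R w k) = (\<Sum>k\<in>S. (if k = i then w k else 0)) - (\<Sum>k\<in>S. (if k = j then w k else 0))"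
      unfolding sum_subtractf[symmetric] using ij by (intro sum.cong) (auto simp: m_def)
    also have "\<dots> = 0" using ij fin by simp
    finally have "m i = 0" using ij by (intro z) (auto simp: m_def supp_def split: if_splits)
    then show False by (simp add: m_def)
  qed
  show ind: "independent (w ` S)"
    unfolding independent_explicit_finite_subsets
  proof (intro allI impI ballI)
    fix A u v assume A: "A \<subseteq> w ` S" "finite A" and s: "(\<Sum>v\<in>A. u v *\<^sub>R v) = 0" and v: "v \<in> A"
    define m where "m i = (if i \<in> S \<and> w i \<in> A then u (w i) else 0)" for i
    have "(\<Sum>i\<in>S. m i *\<^sub>R w i) = (\<Sum>i\<in>{i\<in>S. w i \<in> A}. u (w i) *\<^sub>R w i)"
      using fin by (intro sum.mono_neutral_cong_right) (auto simp: m_def)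
    also have "\<dots> = (\<Sum>v\<in>w ` {i\<in>S. w i \<in> A}. u v *\<^sub>R v)"
      by (subst sum.reindex) (auto intro: inj_on_subset[OF inj])
    also have "w ` {i\<in>S. w i \<in> A} = A" using A by auto
    finally have e: "(\<Sum>i\<in>S. m i *\<^sub>R w i) = 0" using s by simp
    obtain i where i: "i \<in> S" "v = w i" using A v by auto
    have "m i = 0" using i e by (intro z) (auto simp: m_def supp_def split: if_splits)
    then show "u v = 0" using i v by (simp add: m_def)
  qed
  have "card S = card (w ` S)" using inj by (simp add: card_image)
  also have "\<dots> \<le> DIM(real ^ 'n)" using independent_bound[OF ind] by simp
  finally show "card S \<le> CARD('n)" by simp
qed

end

section \<open>Representations of perturbed lattice points\<close>

lemma exp_point_add: "exp_point (a + b) = exp_point a + exp_point b"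
  by (simp add: exp_point_def vec_eq_iff)

lemma exp_point_nonneg: "0 \<le> exp_point a $ i"
  by (simp add: exp_point_def)

lemma exp_point_inj: "exp_point a = exp_point b \<longleftrightarrow> a = b"
  by (simp add: exp_point_def vec_eq_iff)

text \<open>For \<open>U\<close> the covectors of the facets, this is the piecewise linear extension
  of the Newton function to real points.\<close>

definition height :: "(real ^ 'n) set \<Rightarrow> real ^ 'n \<Rightarrow> real" where
  "height U x = Max ((\<lambda>u. u \<bullet> x) ` U)"

lemma inner_le_height: "finite U \<Longrightarrow> u \<in> U \<Longrightarrow> u \<bullet> x \<le> height U x"
  unfolding height_def by (intro Max_ge) auto

lemma height_attained:
  assumes "finite U" "U \<noteq> {}"
  shows "\<exists>u\<in>U. u \<bullet> x = height U x"
proof -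
  have "height U x \<in> (\<lambda>u. u \<bullet> x) ` U"
    unfolding height_def using assms by (intro Max_in) auto
  then show ?thesis by auto
qed

text \<open>All that the combinatorial part takes from the polytope: monomials of height 1, and
  representations whose total weight is the height.\<close>

locale newton_cone =
  fixes U :: "(real ^ 'n::finite) set" and vs :: "nat \<Rightarrow> nat ^ 'n" and N :: nat
  assumes finite_U: "finite U" and nonempty_U: "U \<noteq> {}"
    and height_vs: "j < N \<Longrightarrow> height U (exp_point (vs j)) = 1"
    and representation: "(\<And>i. 0 \<le> x $ i) \<Longrightarrow>
      \<exists>l. (\<forall>i. 0 \<le> l i) \<and> (\<forall>i\<ge>N. l i = 0) \<and> x = (\<Sum>i<N. l i *\<^sub>R exp_point (vs i)) \<and>
        (\<Sum>i<N. l i) = height U x"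
begin

abbreviation w :: "nat \<Rightarrow> real ^ 'n" where
  "w i \<equiv> exp_point (vs i)"

sublocale cone_program w N .

lemma supp_eq_0: "supp l \<subseteq> S \<Longrightarrow> i \<notin> S \<Longrightarrow> l i = 0"
  by (auto simp: supp_def)

lemma supp_subsetI: "(\<And>i. i \<notin> S \<Longrightarrow> l i = 0) \<Longrightarrow> supp l \<subseteq> S"
  by (auto simp: supp_def)

lemma representation': "(\<And>i. 0 \<le> x $ i) \<Longrightarrow> \<exists>l. feasible x l \<and> (\<Sum>i<N. l i) = height U x"
proof -
  assume "\<And>i. 0 \<le> x $ i"
  from representation[OF this] obtain l where
    "\<forall>i. 0 \<le> l i" "\<forall>i\<ge>N. l i = 0" "x = (\<Sum>i<N. l i *\<^sub>R w i)" "(\<Sum>i<N. l i) = height U x"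
    by blast
  then show ?thesis
    by (intro exI[of _ l]) (auto simp: feasible_def val_def supp_def not_le[symmetric])
qed

lemmas cone_inner_le = inner_le_height[OF finite_U]
lemmas cone_attained = height_attained[OF finite_U nonempty_U]

lemma height_leI: "(\<And>u. u \<in> U \<Longrightarrow> u \<bullet> x \<le> c) \<Longrightarrow> height U x \<le> c"
  using cone_attained[of x] by metis

lemma height_add: "height U (x + y) \<le> height U x + height U y"
  by (rule height_leI) (simp add: inner_add_right add_mono cone_inner_le)

lemma height_scale: "c \<ge> 0 \<Longrightarrow> height U (c *\<^sub>R x) = c * height U x"
proof (rule antisym)
  assume c: "c \<ge> 0"
  show "height U (c *\<^sub>R x) \<le> c * height U x"
    by (rule height_leI) (simp add: mult_left_mono c cone_inner_le)
  obtain u where "u \<in> U" "u \<bullet> x = height U x" using cone_attained by blast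
  then show "c * height U x \<le> height U (c *\<^sub>R x)"
    using cone_inner_le[of u "c *\<^sub>R x"] by simp
qed

lemma inner_val: "u \<bullet> val l = (\<Sum>i<N. l i * (u \<bullet> w i))"
  by (simp add: val_def inner_sum_right)

lemma height_val_le:
  assumes "\<And>i. 0 \<le> l i"
  shows "height U (val l) \<le> (\<Sum>i<N. l i)"
proof (rule height_leI)
  fix u assume u: "u \<in> U"
  have "l i * (u \<bullet> w i) \<le> l i" if "i < N" for i
    using cone_inner_le[OF u, of "w i"] height_vs[OF that] mult_left_mono[OF _ assms, of "u \<bullet> w i" 1 i]
    by simp
  then show "u \<bullet> val l \<le> (\<Sum>i<N. l i)"
    unfolding inner_val by (intro sum_mono) auto
qed

lemma height_val_eq:
  assumes "u \<in> U" "\<And>i. 0 \<le> l i" "\<And>i. i \<in> supp l \<Longrightarrow> u \<bullet> w i = 1"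
  shows "height U (val l) = (\<Sum>i<N. l i)"
proof (rule antisym)
  have "u \<bullet> val l = (\<Sum>i<N. l i)"
    unfolding inner_val using assms(3) by (intro sum.cong) (auto simp: supp_def)
  then show "(\<Sum>i<N. l i) \<le> height U (val l)" using cone_inner_le[OF assms(1)] by metis
qed (use height_val_le assms in blast)

lemma cheaper_if_sum_less:
  assumes "(\<Sum>i<N. l i) < (\<Sum>i<N. m i)"
  shows "cheaper l m"
  unfolding cheaper_def lexneg_def
  using assms by (intro exI[of _ 0]) (simp add: cost_def sum_subtractf)

text \<open>Complementary slackness: an optimal representation has total weight equal to the height,
  so a functional that attains the height must take its maximal value 1 on each monomial
  involved.\<close>

lemma optimal_common_facet:
  assumes "optimal z l" "\<And>i. 0 \<le> z $ i"
  shows "\<exists>u\<in>U. \<forall>i\<in>supp l. u \<bullet> w i = 1"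
proof -
  have fl: "feasible z l" using assms(1) by (simp add: optimal_def)
  obtain l' where l': "feasible z l'" "(\<Sum>i<N. l' i) = height U z"
    using representation'[of z] assms(2) by blast
  have "\<not> (\<Sum>i<N. l' i) < (\<Sum>i<N. l i)"
    using assms(1) l'(1) cheaper_if_sum_less by (auto simp: optimal_def)
  moreover have "height U z \<le> (\<Sum>i<N. l i)" using height_val_le[of l] fl by (auto simp: feasible_def)
  ultimately have s: "(\<Sum>i<N. l i) = height U z" using l' by simp
  obtain u where u: "u \<in> U" "u \<bullet> z = height U z" using cone_attained by blast
  have le: "u \<bullet> w i \<le> 1" if "i < N" for i
    using cone_inner_le[OF u(1), of "w i"] height_vs[OF that] by simp
  have "(\<Sum>i<N. l i * (1 - u \<bullet> w i)) = 0"
    using s u fl inner_val[of u l] by (simp add: feasible_def algebra_simps sum_subtractf)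
  moreover have "0 \<le> l i * (1 - u \<bullet> w i)" if "i < N" for i
    using le[OF that] fl by (simp add: feasible_def)
  ultimately have z: "l i * (1 - u \<bullet> w i) = 0" if "i < N" for i
    using that by (subst (asm) sum_nonneg_eq_0_iff) auto
  have "u \<bullet> w i = 1" if "i \<in> supp l" for i
  proof -
    have "i < N" using that fl by (auto simp: feasible_def)
    from z[OF this] show ?thesis using that by (simp add: supp_def)
  qed
  then show ?thesis using u by blast
qed

text \<open>For the matrix of the chosen basis, \<open>D\<close> is the absolute value of its
  determinant and \<open>K\<close> a bound for the operator norm of its inverse.\<close>

lemma basis_bounds:
  assumes S: "S \<subseteq> {..<N}" "indep S" "card S = CARD('n)"
  obtains D K :: real where "D > 0" "K > 0"
    "\<And>l i. supp l \<subseteq> S \<Longrightarrow> i \<in> S \<Longrightarrow> (\<forall>k. val l $ k \<in> \<int>) \<Longrightarrow> D * l i \<in> \<int>"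
    "\<And>l i. supp l \<subseteq> S \<Longrightarrow> i \<in> S \<Longrightarrow> \<bar>l i\<bar> \<le> K * norm (val l)"
    "\<And>y. \<exists>l. supp l \<subseteq> S \<and> val l = y"
proof -
  have fin: "finite S" using S finite_subset by blast
  obtain e where e: "bij_betw e (UNIV :: 'n set) S"
    using finite_same_card_bij[OF finite fin, of "UNIV :: 'n set"] S(3) by auto
  define A :: "real ^ 'n ^ 'n" where "A = (\<chi> i j. w (e j) $ i)"
  define coords :: "(nat \<Rightarrow> real) \<Rightarrow> real ^ 'n" where "coords l = (\<chi> j. l (e j))" for l
  have val: "val l = A *v coords l" if "supp l \<subseteq> S" for l
  proof -
    have "val l = (\<Sum>i\<in>S. l i *\<^sub>R w i)"
      unfolding val_def using S(1) supp_eq_0[OF that] by (intro sum.mono_neutral_right) auto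
    also have "\<dots> = (\<Sum>j\<in>UNIV. l (e j) *\<^sub>R w (e j))"
      using sum.reindex_bij_betw[OF e, of "\<lambda>i. l i *\<^sub>R w i"] by simp
    finally show ?thesis
      by (simp add: vec_eq_iff matrix_vector_mult_def A_def coords_def mult.commute)
  qed
  have eS: "e j \<in> S" for j using e by (auto simp: bij_betw_def)
  define uncoords where "uncoords x i = (if i \<in> S then x $ (inv_into UNIV e i) else 0 :: real)" for x :: "real ^ 'n" and i
  have inj: "inj e" using e by (simp add: bij_betw_def)
  have vb: "coords (uncoords x) = x" and sb: "supp (uncoords x) \<subseteq> S" for x
    using inj eS by (auto simp: coords_def uncoords_def vec_eq_iff supp_def)
  have "x = 0" if "A *v x = 0" for x
  proof -
    have "val (uncoords x) = 0" using val[OF sb, of x] vb that by simp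
    then have "uncoords x = (\<lambda>_. 0)" using S(2) sb by (intro indepD)
    then have "coords (uncoords x) = 0" by (simp add: coords_def vec_eq_iff)
    then show "x = 0" by (simp add: vb)
  qed
  then obtain B where B: "B ** A = mat 1" using matrix_left_invertible_ker[of A] by blast
  then have "invertible A" by (auto simp: invertible_left_inverse)
  then have det: "det A \<noteq> 0" by (simp add: invertible_det_nz)
  have AB: "A ** B = mat 1" using B by (simp add: matrix_left_right_inverse)
  obtain K where K: "K > 0" "\<And>x. norm (B *v x) \<le> norm x * K"
    using bounded_linear.pos_bounded[OF matrix_vector_mul_bounded_linear[of B]] by blast
  show thesis
  proof (rule that[of "\<bar>det A\<bar>" K])
    fix l i assume l: "supp l \<subseteq> S" and i: "i \<in> S"
    obtain j where j: "i = e j" using i e by (auto simp: bij_betw_def)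
    have "\<bar>l i\<bar> = \<bar>coords l $ j\<bar>" by (simp add: coords_def j)
    also have "\<dots> \<le> norm (coords l)" by (rule component_le_norm_cart)
    also have "coords l = B *v val l" using val[OF l] B by (simp add: matrix_vector_mul_assoc)
    finally show "\<bar>l i\<bar> \<le> K * norm (val l)" using K(2)[of "val l"] by (simp add: mult.commute)
    assume int: "\<forall>k. val l $ k \<in> \<int>"
    \<comment> \<open>Cramer's rule: all entries are integers, and the determinant is
      \<open>det A\<close> times the coefficient.\<close>
    have "det ((\<chi> i k. if k = j then (A *v coords l) $ i else A $ i $ k) :: real ^ 'n ^ 'n) \<in> \<int>"
      unfolding det_def using int val[OF l]
      by (intro Ints_sum Ints_mult Ints_prod) (auto simp: A_def exp_point_def)
    then have "coords l $ j * det A \<in> \<int>" by (simp add: cramer_lemma)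
    then show "\<bar>det A\<bar> * l i \<in> \<int>"
      by (auto simp: abs_if coords_def j mult.commute)
  next
    show "\<exists>l. supp l \<subseteq> S \<and> val l = y" for y
      using val[OF sb, of "B *v y"] sb vb AB
      by (intro exI[of _ "uncoords (B *v y)"]) (simp add: matrix_vector_mul_assoc)
  qed (use det K in auto)
qed

text \<open>The first condition is genericity: the optimal representation of a shifted lattice point involves a
  basis. The second says that \<open>y\<close> is small: by Cramer's rule the coefficients of a lattice point have
  bounded denominators, so they cannot be slightly negative.\<close>

definition perturbation :: "real ^ 'n \<Rightarrow> bool" where
  "perturbation y \<longleftrightarrow> (\<forall>i. 0 \<le> y $ i) \<and>
     (\<forall>x S. S \<subseteq> {..<N} \<longrightarrow> card S < CARD('n) \<longrightarrow> exp_point x + y \<notin> span (w ` S)) \<and>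
     (\<forall>x S l. S \<subseteq> {..<N} \<longrightarrow> indep S \<longrightarrow> card S = CARD('n) \<longrightarrow> (\<forall>k. x $ k \<in> \<int>) \<longrightarrow>
        supp l \<subseteq> S \<longrightarrow> (\<forall>i. 0 \<le> l i) \<longrightarrow> (\<forall>i\<in>S. 0 < l i) \<longrightarrow> val l = x + y \<longrightarrow>
        (\<exists>c. (\<forall>i. 0 \<le> c i) \<and> supp c \<subseteq> S \<and> val c = x))"

lemma perturbation_cell:
  assumes "perturbation y" "S \<subseteq> {..<N}" "indep S" "card S = CARD('n)" "\<And>k. x $ k \<in> \<int>"
    "supp l \<subseteq> S" "\<And>i. 0 \<le> l i" "\<And>i. i \<in> S \<Longrightarrow> 0 < l i" "val l = x + y"
  shows "\<exists>c. (\<forall>i. 0 \<le> c i) \<and> supp c \<subseteq> S \<and> val c = x"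
  using assms unfolding perturbation_def by simp

text \<open>Genericity excludes countably many translates of proper subspaces, a null set, while
  smallness allows a whole nonempty open box of positive vectors.\<close>

lemma perturbation_exists: "\<exists>y. perturbation y"
proof -
  define Bases where "Bases = {S. S \<subseteq> {..<N} \<and> indep S \<and> card S = CARD('n)}"
  have finB: "finite Bases" by (rule finite_subset[of _ "Pow {..<N}"]) (auto simp: Bases_def)
  define good where "good S \<epsilon> \<longleftrightarrow> \<epsilon> > 0 \<and> (\<forall>y x l. norm y < \<epsilon> \<longrightarrow> (\<forall>k. x $ k \<in> \<int>) \<longrightarrow> supp l \<subseteq> S \<longrightarrow>
      (\<forall>i\<in>S. 0 < l i) \<longrightarrow> val l = x + y \<longrightarrow> (\<exists>c. (\<forall>i. 0 \<le> c i) \<and> supp c \<subseteq> S \<and> val c = x))"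
    for S \<epsilon>
  have "\<exists>\<epsilon>. good S \<epsilon>" if "S \<in> Bases" for S
  proof -
    have S: "S \<subseteq> {..<N}" "indep S" "card S = CARD('n)" using that by (auto simp: Bases_def)
    obtain D K :: real where D: "D > 0" and K: "K > 0"
      and int: "\<And>l i. supp l \<subseteq> S \<Longrightarrow> i \<in> S \<Longrightarrow> (\<forall>k. val l $ k \<in> \<int>) \<Longrightarrow> D * l i \<in> \<int>"
      and bd: "\<And>l i. supp l \<subseteq> S \<Longrightarrow> i \<in> S \<Longrightarrow> \<bar>l i\<bar> \<le> K * norm (val l)"
      and ex: "\<And>y. \<exists>l. supp l \<subseteq> S \<and> val l = y"
      using basis_bounds[OF S] by blast
    show ?thesis
      unfolding good_def
    \<comment> \<open>Below this norm the coefficients of \<open>y\<close> are less than 1/D in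
      absolute value. Those of the lattice point are multiples of 1/D, so being greater than -1/D
      forces them to be nonnegative.\<close>
    proof (intro exI[of _ "1 / (K * D)"] conjI allI impI)
      fix y x l assume y: "norm y < 1 / (K * D)" and x: "\<forall>k. x $ k \<in> \<int>"
        and l: "supp l \<subseteq> S" "\<forall>i\<in>S. 0 < l i" "val l = x + y"
      obtain m where m: "supp m \<subseteq> S" "val m = y" using ex by blast
      define c where "c i = l i - m i" for i
      have c: "supp c \<subseteq> S" "val c = x"
        using l m by (auto simp: c_def[abs_def] val_diff supp_eq_0 intro!: supp_subsetI)
      have "0 \<le> c i" for i
      proof (cases "i \<in> S")
        case True
        have "\<bar>m i\<bar> \<le> K * norm y" using bd[OF m(1) True] m(2) by simp
        also have "\<dots> < 1 / D" using y K D by (simp add: field_simps)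
        finally have "c i > - (1 / D)" using l(2) True by (fastforce simp: c_def)
        then have "D * c i > - 1" using D by (simp add: field_simps)
        moreover obtain k where k: "D * c i = of_int k"
          using int[OF c(1) True] x c(2) by (auto elim: Ints_cases)
        ultimately have "0 \<le> D * c i" by simp
        then show ?thesis using D by (simp add: zero_le_mult_iff)
      next
        case False
        then show ?thesis using supp_eq_0[OF c(1)] by simp
      qed
      then show "\<exists>c. (\<forall>i. 0 \<le> c i) \<and> supp c \<subseteq> S \<and> val c = x" using c by blast
    qed (use D K in simp)
  qed
  then obtain \<epsilon> where good: "\<And>S. S \<in> Bases \<Longrightarrow> good S (\<epsilon> S)" by metis
  have \<epsilon>: "\<epsilon> S > 0" if "S \<in> Bases" for S using good[OF that] by (simp add: good_def)
  have small: "\<exists>c. (\<forall>i. 0 \<le> c i) \<and> supp c \<subseteq> S \<and> val c = x"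
    if "S \<in> Bases" "norm y < \<epsilon> S" "\<forall>k. x $ k \<in> \<int>" "supp l \<subseteq> S" "\<forall>i\<in>S. 0 < l i" "val l = x + y" for S y x l
    using good[OF that(1)] that(2-) by (auto simp: good_def)
  define \<delta> where "\<delta> = Min (insert 1 (\<epsilon> ` Bases))"
  have \<delta>: "\<delta> > 0" unfolding \<delta>_def using finB \<epsilon> by (subst Min_gr_iff) auto
  have \<delta>_le: "\<delta> \<le> \<epsilon> S" if "S \<in> Bases" for S
    unfolding \<delta>_def using finB that by (intro Min_le) auto
  define Bad where "Bad = (\<Union>x :: nat ^ 'n. \<Union>S\<in>{S. S \<subseteq> {..<N} \<and> card S < CARD('n)}.
    (+) (- exp_point x) ` span (w ` S))"
  have "negligible Bad"
  proof -
    have "negligible ((+) (- exp_point x) ` span (w ` S))" if "S \<subseteq> {..<N}" "card S < CARD('n)" for x S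
    proof (rule negligible_translation, rule negligible_lowdim)
      have "finite S" using that finite_subset by blast
      then have "dim (span (w ` S)) \<le> card (w ` S)" by (simp add: dim_le_card')
      also have "\<dots> \<le> card S" using \<open>finite S\<close> by (rule card_image_le)
      finally show "dim (span (w ` S)) < DIM(real ^ 'n)" using that by simp
    qed
    moreover have "countable {S. S \<subseteq> {..<N} \<and> card S < CARD('n)}"
      by (rule countable_finite, rule finite_subset[of _ "Pow {..<N}"]) auto
    ultimately show ?thesis
      unfolding Bad_def by (intro negligible_countable_Union countable_image) auto
  qed
  \<comment> \<open>With this side length the sum of the coordinates, which bounds the norm, stays
    below \<delta>.\<close>
  define W :: "(real ^ 'n) set" where "W = box 0 (\<chi> i. \<delta> / (2 * CARD('n)))"
  have "open W" "W \<noteq> {}"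
    using \<delta> by (auto simp: W_def open_box box_ne_empty Basis_vec_def inner_axis)
  then have "\<not> W \<subseteq> Bad"
    using open_not_negligible negligible_subset[OF \<open>negligible Bad\<close>] by blast
  then obtain y where y: "y \<in> W" "y \<notin> Bad" by blast
  have yi: "0 < y $ i" "y $ i < \<delta> / (2 * CARD('n))" for i
    using y(1) by (auto simp: W_def mem_box_cart)
  have "norm y \<le> (\<Sum>i\<in>UNIV. \<bar>y $ i\<bar>)" by (rule norm_le_l1_cart)
  also have "\<dots> \<le> (\<Sum>i\<in>(UNIV::'n set). \<delta> / (2 * CARD('n)))"
    using yi by (intro sum_mono) (simp add: less_imp_le)
  also have "\<dots> < \<delta>" using \<delta> by (simp add: field_simps)
  finally have ny: "norm y < \<delta>" .
  have "perturbation y"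
    unfolding perturbation_def
  proof (intro conjI allI impI)
    show "0 \<le> y $ i" for i using yi less_imp_le by blast
  next
    fix x :: "nat ^ 'n" and S assume S: "S \<subseteq> {..<N}" "card S < CARD('n)"
    show "exp_point x + y \<notin> span (w ` S)"
    proof
      assume "exp_point x + y \<in> span (w ` S)"
      then have "y \<in> (+) (- exp_point x) ` span (w ` S)"
        by (rule rev_image_eqI) simp
      then show False using y(2) S unfolding Bad_def by blast
    qed
  next
    fix x :: "real ^ 'n" and S l
    assume S: "S \<subseteq> {..<N}" "indep S" "card S = CARD('n)" and *: "\<forall>k. x $ k \<in> \<int>" "supp l \<subseteq> S"
      "\<forall>i\<in>S. 0 < l i" "val l = x + y"
    then have "S \<in> Bases" by (simp add: Bases_def)
    then show "\<exists>c. (\<forall>i. 0 \<le> c i) \<and> supp c \<subseteq> S \<and> val c = x"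
      using small[of S y x l] * order_less_le_trans[OF ny \<delta>_le[of S]] by blast
  qed
  then show ?thesis by blast
qed

end

locale perturbed_cone = newton_cone U vs N
  for U :: "(real ^ 'n::finite) set" and vs :: "nat \<Rightarrow> nat ^ 'n" and N :: nat +
  fixes y :: "real ^ 'n"
  assumes y: "perturbation y"
begin

definition rep :: "nat ^ 'n \<Rightarrow> nat \<Rightarrow> real" where
  "rep x = (SOME l. optimal (exp_point x + y) l)"

definition cell :: "nat ^ 'n \<Rightarrow> nat set" where
  "cell x = supp (rep x)"

lemma shifted_nonneg: "0 \<le> (exp_point x + y) $ i"
  using y exp_point_nonneg[of x i] by (simp add: perturbation_def)

lemma optimal_rep: "optimal (exp_point x + y) (rep x)"
proof -
  obtain l where "feasible (exp_point x + y) l"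
    using representation'[of "exp_point x + y"] shifted_nonneg by blast
  then have "\<exists>l. optimal (exp_point x + y) l" by (rule optimal_exists)
  then show ?thesis unfolding rep_def by (rule someI_ex)
qed

lemma rep_eqI: "optimal (exp_point x + y) l \<Longrightarrow> rep x = l"
  using optimal_rep optimal_unique by blast

lemma rep_nonneg: "0 \<le> rep x i"
  using optimal_rep[of x] by (simp add: optimal_def feasible_def)

lemma cell_subset: "cell x \<subseteq> {..<N}"
  using optimal_rep[of x] by (simp add: cell_def optimal_def feasible_def)

lemma val_rep: "val (rep x) = exp_point x + y"
  using optimal_rep[of x] by (simp add: optimal_def feasible_def)

lemma indep_cell: "indep (cell x)"
  unfolding cell_def by (rule optimal_indep[OF optimal_rep])

lemma val_in_span: "supp l \<subseteq> S \<Longrightarrow> val l \<in> span (w ` S)"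
  unfolding val_def
proof (rule span_sum)
  fix i assume "supp l \<subseteq> S"
  then show "l i *\<^sub>R w i \<in> span (w ` S)"
    using supp_eq_0[of l S i]
    by (cases "i \<in> S") (simp_all add: span_zero span_scale span_base)
qed

lemma card_supp_ge:
  assumes "supp l \<subseteq> {..<N}" "val l = exp_point x + y"
  shows "CARD('n) \<le> card (supp l)"
proof (rule ccontr)
  assume "\<not> ?thesis"
  then have "exp_point x + y \<notin> span (w ` supp l)"
    using y assms(1) by (auto simp: perturbation_def)
  then show False using val_in_span[of l "supp l"] assms(2) by simp
qed

text \<open>Genericity gives the lower bound and independence of optimal supports the upper
  one.\<close>

lemma card_cell: "card (cell x) = CARD('n)"
  using card_supp_ge[OF cell_subset[unfolded cell_def] val_rep, of x] indep_card_le(3)[OF indep_cell cell_subset, of x]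
  by (simp add: cell_def)

lemma rep_pos: "i \<in> cell x \<Longrightarrow> 0 < rep x i"
  using rep_nonneg[of x i] by (auto simp: cell_def supp_def less_le)

text \<open>This is where smallness of \<open>y\<close> is used: the shifted point is interior to
  the cone of the cell, and the lattice point itself still lies in the closed cone.\<close>

lemma cell_contains:
  assumes "\<And>k. x $ k \<in> \<int>" "supp l = cell z" "\<And>i. 0 \<le> l i" "val l = x + y"
  shows "\<exists>c. (\<forall>i. 0 \<le> c i) \<and> supp c \<subseteq> cell z \<and> val c = x"
proof -
  have "\<forall>i\<in>cell z. 0 < l i" using assms(2,3) by (auto simp: supp_def less_le)
  with assms show ?thesis
    by (intro perturbation_cell[OF y cell_subset indep_cell card_cell]) auto
qed

text \<open>The point and the monomial both lie in the closed cone of the cell, hence over a common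
  facet, where the height is linear.\<close>

lemma cell_height:
  assumes "v \<in> cell x"
  shows "height U (exp_point (x + vs v)) = height U (exp_point x) + 1"
proof -
  obtain c where c: "\<forall>i. 0 \<le> c i" "supp c \<subseteq> cell x" "val c = exp_point x"
    using cell_contains[of "exp_point x" "rep x" x] rep_nonneg val_rep
    by (auto simp: cell_def exp_point_def)
  obtain u where u: "u \<in> U" "\<forall>i\<in>cell x. u \<bullet> w i = 1"
    using optimal_common_facet[OF optimal_rep shifted_nonneg, of x] by (auto simp: cell_def)
  have vN: "v < N" using assms cell_subset by blast
  define e :: "nat \<Rightarrow> real" where "e i = of_bool (i = v)" for i
  have "height U (exp_point x) = (\<Sum>i<N. c i)"
    using height_val_eq[OF u(1), of c] c u(2) by auto
  moreover have "height U (val (\<lambda>i. c i + e i)) = (\<Sum>i<N. c i + e i)"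
  proof (rule height_val_eq[OF u(1)])
    fix i assume "i \<in> supp (\<lambda>i. c i + e i)"
    then have "i \<in> cell x"
      using supp_eq_0[OF c(2), of i] assms by (cases "i = v") (auto simp: supp_def e_def)
    then show "u \<bullet> w i = 1" using u(2) by blast
  qed (use c in \<open>auto simp: e_def\<close>)
  moreover have "val (\<lambda>i. c i + e i) = exp_point (x + vs v)"
    using c(3) val_unit[OF vN] by (simp add: val_add exp_point_add e_def[abs_def])
  moreover have "(\<Sum>i<N. e i) = 1" using vN by (simp add: e_def of_bool_def)
  ultimately show ?thesis by (simp add: sum.distrib)
qed

lemma feasible_shift:
  assumes "v < N"
  shows "feasible (exp_point (x + vs v) + y) (\<lambda>i. rep x i + of_bool (i = v))"
  using optimal_rep[of x] assms val_unit[OF assms]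
  by (auto simp: optimal_def feasible_def val_add exp_point_add supp_def)

text \<open>Adding a monomial of the cell does not enlarge the support, and nonnegative coefficients
  on an optimal support are optimal by \<open>optimal_face\<close>.\<close>

lemma rep_shift:
  assumes "v \<in> cell x"
  shows "rep (x + vs v) = (\<lambda>i. rep x i + of_bool (i = v))"
proof (rule rep_eqI)
  define l where "l = (\<lambda>i. rep x i + of_bool (i = v))"
  have vN: "v < N" using assms cell_subset by blast
  have "supp l \<subseteq> supp (rep x)"
    using assms by (auto simp: cell_def supp_def l_def split: if_splits)
  moreover have "0 \<le> l i" for i using rep_nonneg[of x i] by (simp add: l_def)
  ultimately have "optimal (val l) l" by (intro optimal_face[OF optimal_rep])
  then show "optimal (exp_point (x + vs v) + y) (\<lambda>i. rep x i + of_bool (i = v))"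
    using feasible_shift[OF vN, of x] by (simp add: feasible_def l_def)
qed

lemma cell_shift:
  assumes "v \<in> cell x"
  shows "cell (x + vs v) = cell x"
  using assms rep_nonneg[of x v] by (auto simp: cell_def rep_shift[OF assms] supp_def split: if_splits)

text \<open>The sum has n + 1 monomials in its support and optimal representations have n, so the
  sum is feasible without being optimal.\<close>

lemma rep_shift_cheaper:
  assumes "v < N" "v \<notin> cell x"
  shows "cheaper (rep (x + vs v)) (\<lambda>i. rep x i + of_bool (i = v))"
proof -
  define l where "l = (\<lambda>i. rep x i + of_bool (i = v))"
  have fl: "feasible (exp_point (x + vs v) + y) l"
    using feasible_shift[OF assms(1)] by (simp add: l_def)
  have "supp l = insert v (cell x)"
    using assms(2) rep_nonneg by (auto simp: supp_def l_def cell_def split: if_splits)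
  then have "card (supp l) = Suc CARD('n)"
    using assms(2) card_cell finite_subset[OF cell_subset] by simp
  then have "rep (x + vs v) \<noteq> l" using card_cell[of "x + vs v"] by (auto simp: cell_def)
  moreover have "\<not> cheaper l (rep (x + vs v))"
    using fl optimal_rep[of "x + vs v"] by (simp add: optimal_def)
  ultimately show ?thesis using cheaper_total unfolding l_def by blast
qed

text \<open>A coefficient above 1 stays positive after subtracting 1, so the support is unchanged.
  By \<open>cell_contains\<close> the difference of exponents lies in the cone, so it has
  nonnegative coordinates and the subtraction of natural numbers does not truncate.\<close>

lemma rep_unshift:
  assumes v: "v \<in> cell x" "1 < rep x v"
  obtains x' where "x = x' + vs v" "cell x' = cell x"
proof -
  define l where "l = (\<lambda>i. rep x i - of_bool (i = v))"
  have vN: "v < N" using v(1) cell_subset by blast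
  have supp: "supp l = cell x"
    using v rep_pos[OF v(1)] by (auto simp: supp_def l_def cell_def split: if_splits)
  have nn: "0 \<le> l i" for i using rep_nonneg[of x i] v(2) by (simp add: l_def)
  have val: "val l = (exp_point x - w v) + y"
    by (simp add: l_def val_diff val_rep val_unit[OF vN])
  obtain c where c: "\<forall>i. 0 \<le> c i" "val c = exp_point x - w v"
    using cell_contains[OF _ supp nn val] by (auto simp: exp_point_def)
  have "0 \<le> val c $ k" for k
    unfolding val_def using c(1) by (auto intro!: sum_nonneg mult_nonneg_nonneg exp_point_nonneg)
  then have "vs v $ k \<le> x $ k" for k
    using c(2) by (simp add: exp_point_def)
  then have x: "x = (x - vs v) + vs v" by (simp add: vec_eq_iff)
  from arg_cong[OF this, of exp_point] have "exp_point x = exp_point (x - vs v) + w v"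
    by (simp only: exp_point_add)
  then have "val l = exp_point (x - vs v) + y" using val by simp
  moreover have "optimal (val l) l"
    using supp nn by (intro optimal_face[OF optimal_rep[of x]]) (auto simp: cell_def)
  ultimately have "rep (x - vs v) = l" by (intro rep_eqI) simp
  then have "cell (x - vs v) = cell x" using supp by (simp add: cell_def)
  with x show thesis by (rule that)
qed

end

section \<open>The associated graded ring of a subadditive weight\<close>

lemma poly_mapping_eq_sum_single:
  assumes "finite A" "Poly_Mapping.keys g \<subseteq> A"
  shows "g = (\<Sum>m\<in>A. Poly_Mapping.single m (Poly_Mapping.lookup g m))"
proof (rule poly_mapping_eqI)
  fix k
  have "(\<Sum>m\<in>A. Poly_Mapping.lookup g m when m = k) = (\<Sum>m\<in>A. if m = k then Poly_Mapping.lookup g k else 0)"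
    by (intro sum.cong) (auto simp: when_def)
  also have "\<dots> = Poly_Mapping.lookup g k"
    using assms by (auto simp: in_keys_iff)
  finally show "Poly_Mapping.lookup g k =
      Poly_Mapping.lookup (\<Sum>m\<in>A. Poly_Mapping.single m (Poly_Mapping.lookup g m)) k"
    by (simp add: lookup_sum lookup_single)
qed

lemma additive_sum:
  fixes \<phi> :: "'a::ab_group_add \<Rightarrow> 'b::ab_group_add"
  assumes "\<And>a b. \<phi> (a + b) = \<phi> a + \<phi> b"
  shows "\<phi> (sum h X) = (\<Sum>i\<in>X. \<phi> (h i))"
proof -
  have 0: "\<phi> 0 = 0" using assms[of 0 0] by simp
  show ?thesis by (induction X rule: infinite_finite_induct) (simp_all add: assms 0)
qed

lemma additive_ext:
  fixes \<phi> \<psi> :: "('a \<Rightarrow>\<^sub>0 'c::ab_group_add) \<Rightarrow> 'b::ab_group_add"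
  assumes "\<And>a b. \<phi> (a + b) = \<phi> a + \<phi> b" "\<And>a b. \<psi> (a + b) = \<psi> a + \<psi> b"
    and "\<And>m c. \<phi> (Poly_Mapping.single m c) = \<psi> (Poly_Mapping.single m c)"
  shows "\<phi> g = \<psi> g"
proof -
  have "\<phi> g = \<phi> (\<Sum>m\<in>Poly_Mapping.keys g. Poly_Mapping.single m (Poly_Mapping.lookup g m))"
    using poly_mapping_eq_sum_single[of "Poly_Mapping.keys g" g] by simp
  also have "\<dots> = \<psi> (\<Sum>m\<in>Poly_Mapping.keys g. Poly_Mapping.single m (Poly_Mapping.lookup g m))"
    by (simp only: additive_sum[of \<phi>, OF assms(1)] additive_sum[of \<psi>, OF assms(2)] assms(3))
  also have "\<dots> = \<psi> g"
    using poly_mapping_eq_sum_single[of "Poly_Mapping.keys g" g] by simp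
  finally show ?thesis .
qed

definition pm_filter :: "('a \<Rightarrow> bool) \<Rightarrow> ('a \<Rightarrow>\<^sub>0 'b::comm_monoid_add) \<Rightarrow> 'a \<Rightarrow>\<^sub>0 'b" where
  "pm_filter Q g = (\<Sum>m\<in>{m\<in>Poly_Mapping.keys g. Q m}. Poly_Mapping.single m (Poly_Mapping.lookup g m))"

lemma lookup_pm_filter: "Poly_Mapping.lookup (pm_filter Q g) k = (if Q k then Poly_Mapping.lookup g k else 0)"
proof -
  have "Poly_Mapping.lookup (pm_filter Q g) k =
      (\<Sum>m\<in>{m\<in>Poly_Mapping.keys g. Q m}. if m = k then Poly_Mapping.lookup g k else 0)"
    unfolding pm_filter_def lookup_sum by (intro sum.cong) (auto simp: lookup_single when_def)
  then show ?thesis by (auto simp: in_keys_iff)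
qed

lemma keys_pm_filter: "Poly_Mapping.keys (pm_filter Q g) = {m\<in>Poly_Mapping.keys g. Q m}"
  by (auto simp: in_keys_iff lookup_pm_filter split: if_splits)

lemma pm_filter_add: "pm_filter Q (g + h) = pm_filter Q g + pm_filter Q h"
  by (rule poly_mapping_eqI) (simp add: lookup_pm_filter lookup_add)

lemma pm_filter_diff: "pm_filter Q (g - h) = pm_filter Q g - pm_filter Q h"
  for g h :: "'a \<Rightarrow>\<^sub>0 'b::ab_group_add"
  by (rule poly_mapping_eqI) (simp add: lookup_pm_filter lookup_minus)

lemma pm_filter_zero [simp]: "pm_filter Q 0 = 0"
  by (rule poly_mapping_eqI) (simp add: lookup_pm_filter)

lemma pm_filter_single:
  "pm_filter Q (Poly_Mapping.single m c) = (if Q m then Poly_Mapping.single m c else 0)"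
  by (rule poly_mapping_eqI) (simp add: lookup_pm_filter lookup_single when_def)

lemma pm_filter_id: "(\<And>m. m \<in> Poly_Mapping.keys g \<Longrightarrow> Q m) \<Longrightarrow> pm_filter Q g = g"
  by (rule poly_mapping_eqI) (auto simp: lookup_pm_filter in_keys_iff)

lemma pm_filter_eq_0: "(\<And>m. m \<in> Poly_Mapping.keys g \<Longrightarrow> \<not> Q m) \<Longrightarrow> pm_filter Q g = 0"
  by (rule poly_mapping_eqI) (auto simp: lookup_pm_filter in_keys_iff)

text \<open>Multiplication by a monomial that kills the terms violating \<open>c\<close>. Products
  with a monomial in the graded ring and the operators inside cells are the two instances.\<close>

definition shift :: "('a \<Rightarrow> bool) \<Rightarrow> 'a \<Rightarrow> ('a::cancel_comm_monoid_add \<Rightarrow>\<^sub>0 'b::comm_monoid_add) \<Rightarrow> 'a \<Rightarrow>\<^sub>0 'b" where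
  "shift c v g = (\<Sum>b\<in>{b\<in>Poly_Mapping.keys g. c b}. Poly_Mapping.single (b + v) (Poly_Mapping.lookup g b))"

lemma lookup_shift: "Poly_Mapping.lookup (shift c v g) (b + v) = (if c b then Poly_Mapping.lookup g b else 0)"
proof -
  have "Poly_Mapping.lookup (shift c v g) (b + v) =
      (\<Sum>m\<in>{m\<in>Poly_Mapping.keys g. c m}. if m = b then Poly_Mapping.lookup g b else 0)"
    unfolding shift_def lookup_sum by (intro sum.cong) (auto simp: lookup_single when_def)
  then show ?thesis by (auto simp: in_keys_iff)
qed

lemma lookup_shift_other: "(\<And>b. k \<noteq> b + v) \<Longrightarrow> Poly_Mapping.lookup (shift c v g) k = 0"
  unfolding shift_def lookup_sum by (intro sum.neutral) (auto simp: lookup_single when_def)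

lemma keys_shiftE:
  assumes "k \<in> Poly_Mapping.keys (shift c v g)"
  obtains b where "k = b + v" "c b" "b \<in> Poly_Mapping.keys g"
proof -
  have "Poly_Mapping.lookup (shift c v g) k \<noteq> 0" using assms by (simp add: in_keys_iff)
  then obtain b where "k = b + v" using lookup_shift_other by metis
  then show thesis
    using assms that by (auto simp: in_keys_iff lookup_shift split: if_splits)
qed

lemma shift_add: "shift c v (g + h) = shift c v g + shift c v h"
proof (rule poly_mapping_eqI)
  fix k
  show "Poly_Mapping.lookup (shift c v (g + h)) k = Poly_Mapping.lookup (shift c v g + shift c v h) k"
    by (cases "\<exists>b. k = b + v") (auto simp: lookup_shift lookup_add lookup_shift_other)
qed

lemma shift_zero [simp]: "shift c v 0 = 0"
  by (simp add: shift_def)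

lemma shift_single:
  "shift c v (Poly_Mapping.single b d) = (if c b then Poly_Mapping.single (b + v) d else 0)"
proof (cases "d = 0")
  case False
  then have "{k\<in>Poly_Mapping.keys (Poly_Mapping.single b d). c k} = (if c b then {b} else {})" by auto
  then show ?thesis by (simp add: shift_def)
qed (simp add: shift_def)

lemma shift_diff_cond:
  fixes g :: "'a::cancel_comm_monoid_add \<Rightarrow>\<^sub>0 'b::ab_group_add"
  assumes "\<And>b. c' b \<Longrightarrow> c b"
  shows "shift c v g - shift c' v g = shift (\<lambda>b. c b \<and> \<not> c' b) v g"
proof (rule poly_mapping_eqI)
  fix k
  show "Poly_Mapping.lookup (shift c v g - shift c' v g) k = Poly_Mapping.lookup (shift (\<lambda>b. c b \<and> \<not> c' b) v g) k"
    using assms by (cases "\<exists>b. k = b + v") (auto simp: lookup_shift lookup_minus lookup_shift_other)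
qed

text \<open>For a subadditive weight the associated graded ring of the monoid algebra has the monomials as
  a basis; a product of two monomials survives when the weights add up.\<close>

locale subadditive =
  fixes nu :: "'a::cancel_comm_monoid_add \<Rightarrow> real"
  assumes nu_add: "nu (a + b) \<le> nu a + nu b" and nu_zero: "nu 0 = 0"
begin

definition gmul :: "('a \<Rightarrow>\<^sub>0 complex) \<Rightarrow> ('a \<Rightarrow>\<^sub>0 complex) \<Rightarrow> 'a \<Rightarrow>\<^sub>0 complex" where
  "gmul g h = (\<Sum>a\<in>Poly_Mapping.keys g. \<Sum>b\<in>Poly_Mapping.keys h.
     Poly_Mapping.single (a + b) (Poly_Mapping.lookup g a * Poly_Mapping.lookup h b when nu (a + b) = nu a + nu b))"

lemma gmul_expand:
  assumes "finite A" "Poly_Mapping.keys g \<subseteq> A" "finite B" "Poly_Mapping.keys h \<subseteq> B"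
  shows "gmul g h = (\<Sum>a\<in>A. \<Sum>b\<in>B.
     Poly_Mapping.single (a + b) (Poly_Mapping.lookup g a * Poly_Mapping.lookup h b when nu (a + b) = nu a + nu b))"
proof -
  have "gmul g h = (\<Sum>a\<in>A. \<Sum>b\<in>Poly_Mapping.keys h.
     Poly_Mapping.single (a + b) (Poly_Mapping.lookup g a * Poly_Mapping.lookup h b when nu (a + b) = nu a + nu b))"
    unfolding gmul_def using assms by (intro sum.mono_neutral_left) (auto simp: in_keys_iff)
  also have "\<dots> = (\<Sum>a\<in>A. \<Sum>b\<in>B.
     Poly_Mapping.single (a + b) (Poly_Mapping.lookup g a * Poly_Mapping.lookup h b when nu (a + b) = nu a + nu b))"
    using assms by (intro sum.cong sum.mono_neutral_left) (auto simp: in_keys_iff)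
  finally show ?thesis .
qed

lemma gmul_commute: "gmul g h = gmul h g"
  unfolding gmul_def by (subst sum.swap) (simp add: add.commute mult.commute)

lemma gmul_add_left: "gmul (g + g') h = gmul g h + gmul g' h"
proof -
  define A where "A = Poly_Mapping.keys g \<union> Poly_Mapping.keys g'"
  have A: "finite A" "Poly_Mapping.keys g \<subseteq> A" "Poly_Mapping.keys g' \<subseteq> A" "Poly_Mapping.keys (g + g') \<subseteq> A"
    using keys_add[of g g'] by (auto simp: A_def)
  have *: "(x + y when P) = (x when P) + (y when P)" for x y :: complex and P by (simp add: when_def)
  show ?thesis
    using A by (simp add: gmul_expand[of A _ "Poly_Mapping.keys h"] lookup_add ring_distribs * single_add sum.distrib)
qed

lemma gmul_add_right: "gmul h (g + g') = gmul h g + gmul h g'"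
  using gmul_add_left by (simp add: gmul_commute[of h])

lemma gmul_zero [simp]: "gmul 0 g = 0" "gmul g 0 = 0"
  by (simp_all add: gmul_def)

lemma gmul_sum_left: "gmul (sum h X) g = (\<Sum>i\<in>X. gmul (h i) g)"
  by (rule additive_sum) (rule gmul_add_left)

lemma gmul_sum_right: "gmul g (sum h X) = (\<Sum>i\<in>X. gmul g (h i))"
  by (rule additive_sum) (rule gmul_add_right)

lemma gmul_single:
  "gmul (Poly_Mapping.single a c) (Poly_Mapping.single b d) =
    (if nu (a + b) = nu a + nu b then Poly_Mapping.single (a + b) (c * d) else 0)"
  by (subst gmul_expand[of "{a}" _ "{b}"]) (auto simp: when_def)

lemma gmul_single_one: "gmul (Poly_Mapping.single v 1) g = shift (\<lambda>b. nu (b + v) = nu b + nu v) v g"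
  by (rule additive_ext[of "gmul (Poly_Mapping.single v 1)"])
    (simp_all add: gmul_add_right shift_add gmul_single shift_single add.commute)

text \<open>The source of associativity: by subadditivity, no weight is lost in total exactly when
  none is lost at either of the two steps.\<close>

lemma triple_weights:
  "nu (a + b) = nu a + nu b \<and> nu (a + b + c) = nu (a + b) + nu c \<longleftrightarrow> nu (a + b + c) = nu a + nu b + nu c"
  using nu_add[of a b] nu_add[of "a + b" c] by linarith

lemma gmul_assoc_single:
  "gmul (gmul (Poly_Mapping.single a r) (Poly_Mapping.single b s)) (Poly_Mapping.single c t) =
    (if nu (a + b + c) = nu a + nu b + nu c then Poly_Mapping.single (a + b + c) (r * s * t) else 0)"
  using triple_weights[of a b c] by (auto simp: gmul_single)

lemma gmul_assoc: "gmul (gmul g h) k = gmul g (gmul h k)"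
proof (rule additive_ext[of "\<lambda>k. gmul (gmul g h) k"])
  fix c t
  show "gmul (gmul g h) (Poly_Mapping.single c t) = gmul g (gmul h (Poly_Mapping.single c t))"
  proof (rule additive_ext[of "\<lambda>h. gmul (gmul g h) (Poly_Mapping.single c t)"])
    fix b s
    show "gmul (gmul g (Poly_Mapping.single b s)) (Poly_Mapping.single c t) =
        gmul g (gmul (Poly_Mapping.single b s) (Poly_Mapping.single c t))"
    proof (rule additive_ext[of "\<lambda>g. gmul (gmul g (Poly_Mapping.single b s)) (Poly_Mapping.single c t)"])
      fix a r
      show "gmul (gmul (Poly_Mapping.single a r) (Poly_Mapping.single b s)) (Poly_Mapping.single c t) =
          gmul (Poly_Mapping.single a r) (gmul (Poly_Mapping.single b s) (Poly_Mapping.single c t))"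
        unfolding gmul_commute[of "Poly_Mapping.single a r" "gmul _ _"] gmul_assoc_single
        by (simp add: ac_simps)
    qed (simp_all add: gmul_add_left gmul_add_right)
  qed (simp_all add: gmul_add_left gmul_add_right)
qed (simp_all add: gmul_add_left gmul_add_right)

lemma gmul_left_commute: "gmul g (gmul h k) = gmul h (gmul g k)"
  by (metis gmul_assoc gmul_commute)

lemma gmul_one: "gmul (Poly_Mapping.single 0 1) g = g"
  by (rule additive_ext[of "gmul (Poly_Mapping.single 0 1)"])
    (simp_all add: gmul_add_right gmul_single nu_zero del: single_one)

lemma pm_filter_gmul:
  assumes "\<And>a. a \<in> Poly_Mapping.keys g \<Longrightarrow> nu a = d"
  shows "pm_filter (\<lambda>x. Q (nu x)) (gmul g h) = gmul g (pm_filter (\<lambda>x. Q (d + nu x)) h)"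
proof -
  have "pm_filter (\<lambda>x. Q (nu x)) (gmul (Poly_Mapping.single a c) h) =
      gmul (Poly_Mapping.single a c) (pm_filter (\<lambda>x. Q (d + nu x)) h)" if "nu a = d" for a c
    by (rule additive_ext[of "\<lambda>h. pm_filter (\<lambda>x. Q (nu x)) (gmul (Poly_Mapping.single a c) h)"])
      (simp_all add: gmul_add_right pm_filter_add gmul_single pm_filter_single that)
  moreover define G where "G a = Poly_Mapping.single a (Poly_Mapping.lookup g a)" for a
  ultimately have *: "pm_filter (\<lambda>x. Q (nu x)) (gmul (G a) h) = gmul (G a) (pm_filter (\<lambda>x. Q (d + nu x)) h)"
    if "a \<in> Poly_Mapping.keys g" for a using that assms by simp
  have g: "g = (\<Sum>a\<in>Poly_Mapping.keys g. G a)"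
    unfolding G_def by (rule poly_mapping_eq_sum_single) auto
  have "pm_filter (\<lambda>x. Q (nu x)) (gmul g h) = (\<Sum>a\<in>Poly_Mapping.keys g. pm_filter (\<lambda>x. Q (nu x)) (gmul (G a) h))"
    by (subst g, simp only: gmul_sum_left, rule additive_sum) (rule pm_filter_add)
  also have "\<dots> = (\<Sum>a\<in>Poly_Mapping.keys g. gmul (G a) (pm_filter (\<lambda>x. Q (d + nu x)) h))"
    using * by simp
  also have "\<dots> = gmul g (pm_filter (\<lambda>x. Q (d + nu x)) h)"
    by (simp only: gmul_sum_left[symmetric] g[symmetric])
  finally show ?thesis .
qed

lemma koszul_gmul: "koszul (\<lambda>j. gmul (a j)) UNIV"
  by unfold_locales (auto simp: gmul_add_right gmul_left_commute)

end

section \<open>Acyclicity of the monomials on the Newton boundary\<close>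

lemma finite_bounded_nat_vec: "finite {x :: nat ^ 'n::finite. \<forall>k. x $ k \<le> b}"
proof -
  have "inj_on (($) :: nat ^ 'n \<Rightarrow> _) {x. \<forall>k. x $ k \<le> b}"
    by (rule inj_onI) (simp add: vec_eq_iff)
  moreover have "(($) :: nat ^ 'n \<Rightarrow> _) ` {x. \<forall>k. x $ k \<le> b} \<subseteq> PiE UNIV (\<lambda>_. {..b})"
    by auto
  moreover have "finite (PiE (UNIV :: 'n set) (\<lambda>_. {..b}))" by (rule finite_PiE) auto
  ultimately show ?thesis by (meson finite_imageD finite_subset)
qed

section \<open>The Newton weight on exponents and the finiteness of its levels\<close>

context newton_cone
begin

definition nu :: "nat ^ 'n \<Rightarrow> real" where
  "nu x = height U (exp_point x)"

lemma nu_nonneg: "0 \<le> nu x"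
proof -
  obtain l where "feasible (exp_point x) l" "(\<Sum>i<N. l i) = nu x"
    using representation'[of "exp_point x"] exp_point_nonneg[of x] unfolding nu_def by blast
  moreover from this have "0 \<le> (\<Sum>i<N. l i)" by (intro sum_nonneg) (simp add: feasible_def)
  ultimately show ?thesis by simp
qed

sublocale subadditive nu
proof
  show "nu (a + b) \<le> nu a + nu b" for a b
    unfolding nu_def exp_point_add by (rule height_add)
  have "exp_point (0 :: nat ^ 'n) = 0" by (simp add: exp_point_def vec_eq_iff)
  then show "nu 0 = 0" using height_scale[of 0 0] by (simp add: nu_def)
qed

lemma nu_vs: "j < N \<Longrightarrow> nu (vs j) = 1"
  by (simp add: nu_def height_vs)

lemma finite_nu_le: "finite {x. nu x \<le> L}"
proof -
  \<comment> \<open>A crude common bound for all coordinates of all the monomials; a point of weight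
    at most \<open>L\<close> then has coordinates at most \<open>L * B\<close>.\<close>
  define B where "B = (\<Sum>i<N. \<Sum>k\<in>UNIV. w i $ k)"
  have "x $ k \<le> nat \<lceil>L * B\<rceil>" if "nu x \<le> L" for x k
  proof -
    obtain l where l: "feasible (exp_point x) l" "(\<Sum>i<N. l i) = nu x"
      using representation'[of "exp_point x"] exp_point_nonneg[of x] unfolding nu_def by blast
    have B0: "0 \<le> B" by (auto simp: B_def exp_point_def intro!: sum_nonneg)
    have wB: "w i $ k \<le> B" if "i < N" for i
    proof -
      have "w i $ k \<le> (\<Sum>k\<in>UNIV. w i $ k)"
        by (rule member_le_sum) (auto simp: exp_point_def)
      also have "\<dots> \<le> B" unfolding B_def
        using that by (intro member_le_sum) (auto simp: exp_point_def intro!: sum_nonneg)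
      finally show ?thesis .
    qed
    have "exp_point x = val l" using l by (simp add: feasible_def)
    then have "real (x $ k) = val l $ k" by (simp add: exp_point_def[of x] vec_eq_iff)
    also have "\<dots> = (\<Sum>i<N. l i * (w i $ k))" by (simp add: val_def)
    also have "\<dots> \<le> (\<Sum>i<N. l i * B)"
      using l wB by (intro sum_mono mult_left_mono) (auto simp: feasible_def)
    also have "\<dots> = nu x * B" using l by (simp add: sum_distrib_right[symmetric])
    also have "\<dots> \<le> L * B" using that B0 by (rule mult_right_mono)
    finally show ?thesis by linarith
  qed
  then show ?thesis
    by (intro finite_subset[OF _ finite_bounded_nat_vec[of "nat \<lceil>L * B\<rceil>"]]) auto
qed

end

section \<open>Support conditions on the monomial basis of a Koszul complex\<close>

definition supported :: "('a \<Rightarrow> nat set \<Rightarrow> bool) \<Rightarrow> (nat set \<Rightarrow> 'a \<Rightarrow>\<^sub>0 'b::zero) \<Rightarrow> bool" where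
  "supported Q u \<longleftrightarrow> (\<forall>I. \<forall>x\<in>Poly_Mapping.keys (u I). Q x I)"

lemma keys_sum_subset: "k \<in> Poly_Mapping.keys (sum h X) \<Longrightarrow> \<exists>i\<in>X. k \<in> Poly_Mapping.keys (h i)"
  by (rule ccontr) (simp add: in_keys_iff lookup_sum sum.neutral)

lemma keys_sg [simp]: "Poly_Mapping.keys (sg j I a) = Poly_Mapping.keys a"
  by (auto simp: sg_def in_keys_iff)

lemma supported_kd:
  fixes x :: "nat \<Rightarrow> ('a::cancel_comm_monoid_add \<Rightarrow>\<^sub>0 'b::ab_group_add) \<Rightarrow> _"
  assumes "koszul x M" and shift: "\<And>j. j \<in> T \<Longrightarrow> x j = shift (c j) (v j)"
    and step: "\<And>b I j. I \<subseteq> T \<Longrightarrow> j \<in> T \<Longrightarrow> j \<notin> I \<Longrightarrow> c j b \<Longrightarrow> Q b (insert j I) \<Longrightarrow> Q' (b + v j) I"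
    and u: "supported Q u"
  shows "supported Q' (koszul.kd x T u)"
  unfolding supported_def
proof (intro allI ballI)
  interpret koszul x M by fact
  fix I k assume k: "k \<in> Poly_Mapping.keys (kd T u I)"
  then have IT: "I \<subseteq> T" by (auto simp: kd_def split: if_splits)
  with k obtain j where j: "j \<in> T - I" "k \<in> Poly_Mapping.keys (x j (u (insert j I)))"
    using keys_sum_subset[of k "\<lambda>j. sg j I (x j (u (insert j I)))" "T - I"] by (auto simp: kd_def)
  then have "k \<in> Poly_Mapping.keys (shift (c j) (v j) (u (insert j I)))" by (simp add: shift)
  then obtain b where b: "k = b + v j" "c j b" "b \<in> Poly_Mapping.keys (u (insert j I))"
    by (rule keys_shiftE)
  with u have "Q b (insert j I)" by (auto simp: supported_def)
  then show "Q' k I" using step[OF IT, of j b] j(1) b by simp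
qed

definition chain_filter :: "('a \<Rightarrow> nat set \<Rightarrow> bool) \<Rightarrow> (nat set \<Rightarrow> 'a \<Rightarrow>\<^sub>0 'b) \<Rightarrow> nat set \<Rightarrow> 'a \<Rightarrow>\<^sub>0 'b::comm_monoid_add" where
  "chain_filter Q u I = pm_filter (\<lambda>x. Q x I) (u I)"

lemma supported_chain_filter: "supported Q (chain_filter Q u)"
  by (auto simp: supported_def chain_filter_def keys_pm_filter)

lemma supported_filter_complement:
  "supported (\<lambda>x I. \<not> Q x I) (\<lambda>I. u I - chain_filter Q u I)"
  for u :: "nat set \<Rightarrow> 'a \<Rightarrow>\<^sub>0 'b::ab_group_add"
  by (auto simp: supported_def chain_filter_def in_keys_iff lookup_minus lookup_pm_filter)

lemma chain_filter_id: "supported Q u \<Longrightarrow> chain_filter Q u = u"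
  by (auto simp: chain_filter_def supported_def fun_eq_iff intro!: pm_filter_id)

lemma chain_filter_eq_0: "supported (\<lambda>x I. \<not> Q x I) u \<Longrightarrow> chain_filter Q u = (\<lambda>_. 0)"
  by (auto simp: chain_filter_def supported_def fun_eq_iff intro!: pm_filter_eq_0)

lemma chain_filter_add: "chain_filter Q (\<lambda>I. u I + v I) = (\<lambda>I. chain_filter Q u I + chain_filter Q v I)"
  by (simp add: chain_filter_def pm_filter_add fun_eq_iff)

lemma supported_add:
  "supported Q u \<Longrightarrow> supported Q v \<Longrightarrow> supported Q (\<lambda>I. u I + v I)"
  for u :: "nat set \<Rightarrow> 'a \<Rightarrow>\<^sub>0 'b::ab_group_add"
  unfolding supported_def by (intro allI ballI) (use keys_add[of "u _" "v _"] in blast)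

lemma supported_diff:
  "supported Q u \<Longrightarrow> supported Q v \<Longrightarrow> supported Q (\<lambda>I. u I - v I)"
  for u :: "nat set \<Rightarrow> 'a \<Rightarrow>\<^sub>0 'b::ab_group_add"
  unfolding supported_def by (intro allI ballI) (use keys_diff[of "u _" "v _"] in blast)

lemma supported_mono: "supported Q u \<Longrightarrow> (\<And>x I. Q x I \<Longrightarrow> Q' x I) \<Longrightarrow> supported Q' u"
  by (auto simp: supported_def)

text \<open>A condition that each surviving shift both preserves and reflects splits the complex
  into two direct summands.\<close>

lemma filter_kd:
  fixes x :: "nat \<Rightarrow> ('a::cancel_comm_monoid_add \<Rightarrow>\<^sub>0 'b::ab_group_add) \<Rightarrow> _"
  assumes K: "koszul x M" and shift: "\<And>j. j \<in> T \<Longrightarrow> x j = shift (c j) (v j)"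
    and step: "\<And>b I j. I \<subseteq> T \<Longrightarrow> j \<in> T \<Longrightarrow> j \<notin> I \<Longrightarrow> c j b \<Longrightarrow> Q (b + v j) I \<longleftrightarrow> Q b (insert j I)"
  shows "chain_filter Q (koszul.kd x T u) = koszul.kd x T (chain_filter Q u)"
proof -
  interpret koszul x M by fact
  have 1: "supported Q (kd T (chain_filter Q u))"
    by (rule supported_kd[OF K shift _ supported_chain_filter]) (auto simp: step)
  have 2: "supported (\<lambda>x I. \<not> Q x I) (kd T (\<lambda>I. u I - chain_filter Q u I))"
    by (rule supported_kd[OF K shift _ supported_filter_complement]) (auto simp: step)
  have "kd T u = (\<lambda>I. kd T (chain_filter Q u) I + kd T (\<lambda>I. u I - chain_filter Q u I) I)"
    by (subst kd_add[symmetric]) simp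
  then have "chain_filter Q (kd T u) = (\<lambda>I. chain_filter Q (kd T (chain_filter Q u)) I +
      chain_filter Q (kd T (\<lambda>I. u I - chain_filter Q u I)) I)"
    by (simp only: chain_filter_add)
  then show ?thesis by (simp add: chain_filter_id[OF 1] chain_filter_eq_0[OF 2])
qed

context perturbed_cone
begin

text \<open>Coarser than multiplication in the graded ring: a product with a monomial outside the
  cell is set to 0 even when the weights add up.\<close>

definition cell_shift_op :: "nat \<Rightarrow> (nat ^ 'n \<Rightarrow>\<^sub>0 complex) \<Rightarrow> nat ^ 'n \<Rightarrow>\<^sub>0 complex" where
  "cell_shift_op j = shift (\<lambda>b. j \<in> cell b) (vs j)"

definition cell_module :: "nat set \<Rightarrow> (nat ^ 'n \<Rightarrow>\<^sub>0 complex) set" where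
  "cell_module C = {g. \<forall>x\<in>Poly_Mapping.keys g. cell x = C}"

lemma cell_shift_op_add: "cell_shift_op j (g + h) = cell_shift_op j g + cell_shift_op j h"
  by (simp add: cell_shift_op_def shift_add)

lemma cell_shift_op_commute: "cell_shift_op i (cell_shift_op j g) = cell_shift_op j (cell_shift_op i g)"
proof (rule additive_ext[of "\<lambda>g. cell_shift_op i (cell_shift_op j g)"])
  fix b d
  show "cell_shift_op i (cell_shift_op j (Poly_Mapping.single b d)) =
      cell_shift_op j (cell_shift_op i (Poly_Mapping.single b d))"
  proof (cases "i \<in> cell b \<and> j \<in> cell b")
    case True
    then show ?thesis by (simp add: cell_shift_op_def shift_single cell_shift ac_simps)
  next
    case False
    then have "cell_shift_op i (cell_shift_op j (Poly_Mapping.single b d)) = 0"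
        "cell_shift_op j (cell_shift_op i (Poly_Mapping.single b d)) = 0"
      by (auto simp: cell_shift_op_def shift_single cell_shift)
    then show ?thesis by simp
  qed
qed (simp_all add: cell_shift_op_add)

lemma koszul_cells: "koszul cell_shift_op UNIV"
  by unfold_locales (auto simp: cell_shift_op_add cell_shift_op_commute)

lemma cell_shift_op_mem: "g \<in> cell_module C \<Longrightarrow> cell_shift_op j g \<in> cell_module C"
  by (auto simp: cell_module_def cell_shift_op_def cell_shift elim!: keys_shiftE)

lemma koszul_cell: "koszul cell_shift_op (cell_module C)"
proof
  fix a b assume "a \<in> cell_module C" "b \<in> cell_module C"
  then show "a - b \<in> cell_module C" using keys_diff[of a b] by (auto simp: cell_module_def)
qed (auto simp: cell_shift_op_add cell_shift_op_commute cell_shift_op_mem, simp add: cell_module_def)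

text \<open>Compare the coefficient of \<open>i\<close> in the representation of the common sum:
  shifting by \<open>vs j\<close> leaves it unchanged and shifting by \<open>vs i\<close> raises it
  by 1. So it exceeds 1 at \<open>b\<close>, and \<open>rep_unshift\<close> applies.\<close>

lemma cell_division:
  assumes T: "T \<subseteq> C" "j \<in> C" "j \<notin> T" and b: "cell b = C" "cell b' = C" and i: "i \<in> T"
    and eq: "b + vs j = b' + vs i"
  obtains b'' where "b = b'' + vs i" "cell b'' = C"
proof -
  have "rep (b + vs j) i = rep b i" using T b i by (subst rep_shift) auto
  moreover have "rep (b' + vs i) i = rep b' i + 1" using T b i by (subst rep_shift) auto
  moreover have "0 < rep b' i" using T b i by (intro rep_pos) auto
  ultimately have "1 < rep b i" using eq by simp
  then show thesis using rep_unshift[of i b] that T i b by blast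
qed

text \<open>The exponents of one cell carry a free action of the shifts by the generators of that
  cell, so these generators form a regular sequence in any order.\<close>

lemma acyclic_cell_generators:
  assumes "finite T" "T \<subseteq> C"
  shows "p > 0 \<Longrightarrow> koszul.acyclic_at cell_shift_op (cell_module C) T p"
  using assms
proof (induction T arbitrary: p rule: finite_induct)
  interpret koszul cell_shift_op "cell_module C" by (rule koszul_cell)
  case empty
  have "z = (\<lambda>_. 0)" if "chain {} p z" for z
    using chain_eq_0[OF that] empty by (auto simp: fun_eq_iff)
  then show ?case using boundary_zero by (auto simp: acyclic_at_def)
next
  interpret koszul cell_shift_op "cell_module C" by (rule koszul_cell)
  case (insert j T)
  obtain q where q: "p = Suc q" using insert.prems by (cases p) auto
  have "boundary T q z" if z: "chain T q z" "kd T z = (\<lambda>_. 0)" "boundary T q (\<lambda>I. cell_shift_op j (z I))" for z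
  proof (cases "q = 0")
    case False
    then show ?thesis using insert.IH[of q] insert.prems z by (intro acyclic_atD) auto
  next
    \<comment> \<open>In degree 0 the claim is that \<open>cell_shift_op j\<close> is injective
      modulo the ideal of \<open>T\<close>. This ideal is spanned by monomials, so it suffices to
      divide the terms of \<open>z\<close> one by one.\<close>
    case True
    obtain u where u: "chain T (Suc q) u" "kd T u = (\<lambda>I. cell_shift_op j (z I))"
      using z(3) by (rule boundaryE)
    define mono where "mono b c I = (if I = {} then Poly_Mapping.single b c else 0)"
      for b :: "nat ^ 'n" and c :: complex and I :: "nat set"
    have cell_key: "cell b = C" if "b \<in> Poly_Mapping.keys (z {})" for b
      using chain_mem[OF z(1), of "{}"] that by (auto simp: cell_module_def)
    have bd: "boundary T q (mono b (Poly_Mapping.lookup (z {}) b))" if b: "b \<in> Poly_Mapping.keys (z {})" for b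
    proof -
      define c where "c = Poly_Mapping.lookup (z {}) b"
      have cb: "cell b = C" using cell_key b by blast
      have "b + vs j \<in> Poly_Mapping.keys (cell_shift_op j (z {}))"
        using b cb insert.prems by (simp add: cell_shift_op_def in_keys_iff lookup_shift)
      then have "b + vs j \<in> Poly_Mapping.keys (kd T u {})" using u by simp
      then obtain i where i: "i \<in> T" "b + vs j \<in> Poly_Mapping.keys (cell_shift_op i (u {i}))"
        using keys_sum_subset[of "b + vs j" "\<lambda>i. sg i {} (cell_shift_op i (u {i}))" T] by (auto simp: kd_def)
      then obtain b' where b': "b + vs j = b' + vs i" "b' \<in> Poly_Mapping.keys (u {i})"
        unfolding cell_shift_op_def by (auto elim: keys_shiftE)
      have cb': "cell b' = C" using chain_mem[OF u(1), of "{i}"] b' by (auto simp: cell_module_def)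
      obtain b'' where b'': "b = b'' + vs i" "cell b'' = C"
        using cell_division[of T C j b b' i] insert.prems insert.hyps cb cb' i b' by auto
      have "boundary T q (\<lambda>I. cell_shift_op i (mono b'' c I))"
      proof (rule boundary_op[OF insert.hyps(1) i(1)])
        show "chain T q (mono b'' c)"
          using True b'' by (intro chainI) (auto simp: mono_def cell_module_def)
        show "kd T (mono b'' c) = (\<lambda>_. 0)" by (auto simp: kd_def mono_def)
      qed
      moreover have "(\<lambda>I. cell_shift_op i (mono b'' c I)) = mono b c"
        using b'' i insert.prems by (auto simp: fun_eq_iff mono_def cell_shift_op_def shift_single)
      ultimately show ?thesis by (simp add: c_def)
    qed
    have "z = (\<lambda>I. \<Sum>b\<in>Poly_Mapping.keys (z {}). mono b (Poly_Mapping.lookup (z {}) b) I)"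
    proof
      fix I
      show "z I = (\<Sum>b\<in>Poly_Mapping.keys (z {}). mono b (Poly_Mapping.lookup (z {}) b) I)"
      proof (cases "I = {}")
        case I: True
        show ?thesis unfolding I mono_def using poly_mapping_eq_sum_single[of "Poly_Mapping.keys (z {})" "z {}"] by simp
      next
        case False
        have "z I = 0"
        proof (cases "I \<subseteq> T")
          case True
          then show ?thesis
            using False chain_eq_0[OF z(1), of I] \<open>q = 0\<close> finite_subset[OF True insert.hyps(1)] by simp
        qed (use chain_eq_0[OF z(1)] in blast)
        then show ?thesis using False by (simp add: mono_def)
      qed
    qed
    moreover have "boundary T q (\<lambda>I. \<Sum>b\<in>Poly_Mapping.keys (z {}). mono b (Poly_Mapping.lookup (z {}) b) I)"
      by (intro boundary_sum bd)
    ultimately show ?thesis by simp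
  qed
  moreover have "acyclic_at T (Suc q)" using insert by simp
  ultimately show ?case
    unfolding q using insert.hyps by (intro acyclic_at_insertI) auto
qed

text \<open>The n generators of the cell leave no homology in positive degrees, and each of the
  other \<open>N - n\<close> operators raises the bound by at most one.\<close>

lemma acyclic_cell:
  assumes "C = cell x" "p + CARD('n) > N"
  shows "koszul.acyclic_at cell_shift_op (cell_module C) {..<N} p"
proof -
  interpret koszul cell_shift_op "cell_module C" by (rule koszul_cell)
  have C: "C \<subseteq> {..<N}" "card C = CARD('n)" using assms cell_subset card_cell by auto
  then have fin: "finite C" using finite_subset by blast
  have "card ({..<N} - C) = N - CARD('n)" using C fin by (simp add: card_Diff_subset)
  moreover have "CARD('n) \<le> N" using card_mono[OF _ C(1)] C(2) by simp
  ultimately have "acyclic_at (C \<union> ({..<N} - C)) p"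
    using assms(2) acyclic_cell_generators[OF fin subset_refl]
    by (intro acyclic_at_Un[OF fin, of _ 0]) auto
  moreover have "C \<union> ({..<N} - C) = {..<N}" using C by auto
  ultimately show ?thesis by simp
qed

lemma acyclic_all_cells:
  assumes "p + CARD('n) > N"
  shows "koszul.acyclic_at cell_shift_op UNIV {..<N} p"
proof -
  interpret koszul cell_shift_op UNIV by (rule koszul_cells)
  show ?thesis
    unfolding acyclic_at_def
  proof (intro allI impI, elim conjE)
    fix z assume z: "chain {..<N} p z" "kd {..<N} z = (\<lambda>_. 0)"
    \<comment> \<open>The projection onto the summand of one cell; it commutes with the operators
      because their shifts stay inside a cell.\<close>
    define \<phi> where "\<phi> C = (pm_filter (\<lambda>x. cell x = C) :: (nat ^ 'n \<Rightarrow>\<^sub>0 complex) \<Rightarrow> _)" for C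
    have \<phi>_add: "\<phi> C (a + b) = \<phi> C a + \<phi> C b" for C a b by (simp add: \<phi>_def pm_filter_add)
    have \<phi>_op: "\<phi> C (cell_shift_op j a) = cell_shift_op j (\<phi> C a)" for C j a
    proof (rule additive_ext[of "\<lambda>a. \<phi> C (cell_shift_op j a)"])
      fix m c
      show "\<phi> C (cell_shift_op j (Poly_Mapping.single m c)) = cell_shift_op j (\<phi> C (Poly_Mapping.single m c))"
        by (auto simp: \<phi>_def cell_shift_op_def shift_single pm_filter_single cell_shift)
    qed (simp_all add: \<phi>_add cell_shift_op_add)
    have bd: "boundary {..<N} p (\<lambda>I. \<phi> (cell x) (z I))" for x
    proof -
      interpret C: koszul cell_shift_op "cell_module (cell x)" by (rule koszul_cell)
      have "C.chain {..<N} p (\<lambda>I. \<phi> (cell x) (z I))"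
        by (rule C.chainI) (simp_all add: \<phi>_def cell_module_def keys_pm_filter chain_eq_0[OF z(1)])
      moreover have "kd {..<N} (\<lambda>I. \<phi> (cell x) (z I)) = (\<lambda>_. 0)"
        by (simp only: kd_intertwine[of "\<phi> (cell x)" _ "\<phi> (cell x)", OF \<phi>_add \<phi>_op] z(2)) (simp add: \<phi>_def)
      ultimately have "C.boundary {..<N} p (\<lambda>I. \<phi> (cell x) (z I))"
        by (intro C.acyclic_atD[OF acyclic_cell[OF refl assms]])
      then obtain u where u: "C.chain {..<N} (Suc p) u" "kd {..<N} u = (\<lambda>I. \<phi> (cell x) (z I))"
        by (rule C.boundaryE)
      have "chain {..<N} (Suc p) u" by (rule chainI) (simp_all add: C.chain_eq_0[OF u(1)])
      then show ?thesis using u(2) by (rule boundaryI)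
    qed
    have fin: "finite (range cell)"
      by (rule finite_subset[of _ "Pow {..<N}"]) (use cell_subset in auto)
    have "z I = (\<Sum>C\<in>range cell. \<phi> C (z I))" for I
    proof (rule poly_mapping_eqI)
      fix k
      show "Poly_Mapping.lookup (z I) k = Poly_Mapping.lookup (\<Sum>C\<in>range cell. \<phi> C (z I)) k"
        using fin by (simp add: lookup_sum \<phi>_def lookup_pm_filter)
    qed
    then have "z = (\<lambda>I. \<Sum>C\<in>range cell. \<phi> C (z I))" by auto
    moreover have "boundary {..<N} p (\<lambda>I. \<Sum>C\<in>range cell. \<phi> C (z I))"
      using bd by (intro boundary_sum) auto
    ultimately show "boundary {..<N} p z" by simp
  qed
qed

text \<open>The Koszul differential does not increase the grade, for the order \<open>cheaper\<close>, and its part of grade 0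
  is the differential of the operators \<open>cell_shift_op\<close>, which is a direct sum over the cells.\<close>

definition grade :: "nat ^ 'n \<Rightarrow> nat set \<Rightarrow> nat \<Rightarrow> real" where
  "grade x I = (\<lambda>i. rep x i + of_bool (i \<in> I))"

lemma grade_cell: "j \<in> cell b \<Longrightarrow> j \<notin> I \<Longrightarrow> grade (b + vs j) I = grade b (insert j I)"
  by (auto simp: grade_def rep_shift fun_eq_iff)

lemma grade_cheaper:
  assumes "j < N" "j \<notin> cell b" "j \<notin> I"
  shows "cheaper (grade (b + vs j) I) (grade b (insert j I))"
proof -
  have "grade b (insert j I) = (\<lambda>i. (rep b i + of_bool (i = j)) + of_bool (i \<in> I))"
    using assms(3) by (auto simp: grade_def fun_eq_iff)
  then show ?thesis
    using rep_shift_cheaper[OF assms(1,2)] by (simp add: grade_def cheaper_add)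
qed

section \<open>Comparison of the Koszul differential with its part inside the cells\<close>

context
  fixes a :: "nat \<Rightarrow> nat ^ 'n \<Rightarrow>\<^sub>0 complex"
  assumes a: "\<And>j. j < N \<Longrightarrow> a j = Poly_Mapping.single (vs j) 1"
begin

interpretation S: koszul "\<lambda>j. gmul (a j)" UNIV by (rule koszul_gmul)
interpretation S0: koszul cell_shift_op UNIV by (rule koszul_cells)

lemma op_shift: "j \<in> {..<N} \<Longrightarrow> gmul (a j) = shift (\<lambda>b. nu (b + vs j) = nu b + 1) (vs j)"
  by (simp add: fun_eq_iff a gmul_single_one nu_vs)

lemma nu_cell: "j \<in> cell b \<Longrightarrow> nu (b + vs j) = nu b + 1"
  by (simp add: nu_def cell_height)

text \<open>The two differentials differ exactly by the shifts that keep the weight additive but use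
  a monomial outside the cell.\<close>

lemma supported_S_diff:
  assumes "supported Q u"
    and "\<And>b I j. I \<subseteq> {..<N} \<Longrightarrow> j < N \<Longrightarrow> j \<notin> I \<Longrightarrow> j \<notin> cell b \<Longrightarrow> nu (b + vs j) = nu b + 1 \<Longrightarrow>
      Q b (insert j I) \<Longrightarrow> Q' (b + vs j) I"
  shows "supported Q' (\<lambda>I. S.kd {..<N} u I - S0.kd {..<N} u I)"
  unfolding supported_def
proof (intro allI ballI)
  fix I k assume k: "k \<in> Poly_Mapping.keys (S.kd {..<N} u I - S0.kd {..<N} u I)"
  then have IT: "I \<subseteq> {..<N}" by (auto simp: S.kd_def S0.kd_def split: if_splits)
  define c where "c j b \<longleftrightarrow> nu (b + vs j) = nu b + 1 \<and> j \<notin> cell b" for j b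
  have "S.kd {..<N} u I - S0.kd {..<N} u I =
      (\<Sum>j\<in>{..<N} - I. sg j I (shift (c j) (vs j) (u (insert j I))))"
  proof -
    have "gmul (a j) g - cell_shift_op j g = shift (c j) (vs j) g" if "j < N" for j g
      using that unfolding cell_shift_op_def c_def
      by (simp only: op_shift lessThan_iff) (rule shift_diff_cond, rule nu_cell)
    moreover have "sg j I x - sg j I y = sg j I (x - y)" for j and x y :: "nat ^ 'n \<Rightarrow>\<^sub>0 complex"
      by (simp add: sg_def)
    ultimately show ?thesis
      using IT by (simp add: S.kd_def S0.kd_def sum_subtractf[symmetric])
  qed
  with k obtain j where j: "j \<in> {..<N} - I" "k \<in> Poly_Mapping.keys (shift (c j) (vs j) (u (insert j I)))"
    using keys_sum_subset[of k "\<lambda>j. sg j I (shift (c j) (vs j) (u (insert j I)))" "{..<N} - I"] by auto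
  from j(2) obtain b where b: "k = b + vs j" "c j b" "b \<in> Poly_Mapping.keys (u (insert j I))"
    by (rule keys_shiftE)
  have "Q b (insert j I)" using assms(1) b(3) by (auto simp: supported_def)
  then show "Q' k I" using assms(2)[OF IT, of j b] j(1) b by (simp add: c_def)
qed

text \<open>The sum of weight and cardinality is preserved by every surviving shift, since an index
  removed adds 1 to the weight. The bound \<open>L\<close> on it confines the descent to a finite
  set.\<close>

definition low :: "real \<Rightarrow> (nat \<Rightarrow> real) \<Rightarrow> nat ^ 'n \<Rightarrow> nat set \<Rightarrow> bool" where
  "low L e x I \<longleftrightarrow> I \<subseteq> {..<N} \<and> nu x + card I \<le> L \<and> cheaper (grade x I) e"

definition top :: "real \<Rightarrow> (nat \<Rightarrow> real) \<Rightarrow> nat ^ 'n \<Rightarrow> nat set \<Rightarrow> bool" where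
  "top L e x I \<longleftrightarrow> I \<subseteq> {..<N} \<and> nu x + card I \<le> L \<and> grade x I = e"

lemma card_insert_chain: "I \<subseteq> {..<N} \<Longrightarrow> j \<notin> I \<Longrightarrow> card (insert j I) = Suc (card I)"
  using finite_subset[of I "{..<N}"] by simp

lemma supported_low:
  assumes "supported (low L e) u"
  shows "supported (low L e) (S.kd {..<N} u)"
proof (rule supported_kd[OF koszul_gmul op_shift _ assms])
  fix b I j
  assume *: "I \<subseteq> {..<N}" "j \<in> {..<N}" "j \<notin> I" "nu (b + vs j) = nu b + 1" "low L e b (insert j I)"
  have "grade (b + vs j) I = grade b (insert j I) \<or> cheaper (grade (b + vs j) I) (grade b (insert j I))"
    using grade_cell[of j b I] grade_cheaper[of j b I] * by blast
  then show "low L e (b + vs j) I"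
    using * card_insert_chain[OF *(1,3)] cheaper_trans by (auto simp: low_def)
qed

lemma supported_top_diff:
  assumes "supported (top L e) u"
  shows "supported (low L e) (\<lambda>I. S.kd {..<N} u I - S0.kd {..<N} u I)"
proof (rule supported_S_diff[OF assms])
  fix b I j
  assume *: "I \<subseteq> {..<N}" "j < N" "j \<notin> I" "j \<notin> cell b" "nu (b + vs j) = nu b + 1" "top L e b (insert j I)"
  then show "low L e (b + vs j) I"
    using grade_cheaper[of j b I] card_insert_chain[OF *(1,3)] by (auto simp: low_def top_def)
qed

lemma filter_top: "chain_filter (top L e) (S0.kd {..<N} u) = S0.kd {..<N} (chain_filter (top L e) u)"
proof (rule filter_kd[OF koszul_cells])
  show "cell_shift_op j = shift (\<lambda>b. j \<in> cell b) (vs j)" for j by (simp add: cell_shift_op_def)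
  fix b I j assume *: "I \<subseteq> {..<N}" "j \<in> {..<N}" "j \<notin> I" "j \<in> cell b"
  then show "top L e (b + vs j) I = top L e b (insert j I)"
    using grade_cell[of j b I] card_insert_chain[OF *(1,3)] nu_cell[of j b] by (simp add: top_def add.assoc)
qed

lemma low_not_top: "low L e x I \<Longrightarrow> \<not> top L e x I"
  using cheaper_irrefl by (auto simp: low_def top_def)

text \<open>The part of highest grade of a cycle is a cycle for the differential inside cells, hence
  a boundary there; the same chain, with the full differential, cancels it up to lower
  grades.\<close>

lemma reduce_top:
  assumes p: "p + CARD('n) > N" and z: "S.chain {..<N} p z" "S.kd {..<N} z = (\<lambda>_. 0)"
    and supp: "supported (\<lambda>x I. low L e x I \<or> top L e x I) z"
  obtains u where "S.chain {..<N} (Suc p) u" "supported (low L e) (\<lambda>I. z I - S.kd {..<N} u I)"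
proof -
  define t where "t = chain_filter (top L e) z"
  have st: "supported (top L e) t" unfolding t_def by (rule supported_chain_filter)
  have sl: "supported (low L e) (\<lambda>I. z I - t I)"
    unfolding supported_def
  proof (intro allI ballI)
    fix I x assume "x \<in> Poly_Mapping.keys (z I - t I)"
    then have "\<not> top L e x I" "x \<in> Poly_Mapping.keys (z I)"
      by (auto simp: t_def chain_filter_def in_keys_iff lookup_minus lookup_pm_filter split: if_splits)
    then show "low L e x I" using supp by (auto simp: supported_def)
  qed
  have eq1: "S0.kd {..<N} t = chain_filter (top L e) (S0.kd {..<N} t)"
    unfolding t_def filter_top by (simp add: chain_filter_id[OF supported_chain_filter])
  \<comment> \<open>As the boundary of \<open>z\<close> is 0, this expresses the cell boundary of
    \<open>t\<close> by terms of lower grade, while \<open>eq1\<close> says that it has top grade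
    only. So it vanishes.\<close>
  have eq2: "S0.kd {..<N} t = (\<lambda>I. S.kd {..<N} z I -
      (S.kd {..<N} (\<lambda>I. z I - t I) I + (S.kd {..<N} t I - S0.kd {..<N} t I)))"
    by (simp add: S.kd_diff)
  have eq3: "chain_filter (top L e) (\<lambda>I. S.kd {..<N} z I -
      (S.kd {..<N} (\<lambda>I. z I - t I) I + (S.kd {..<N} t I - S0.kd {..<N} t I))) = (\<lambda>_. 0)"
  proof (rule chain_filter_eq_0)
    have "supported (low L e) (\<lambda>I. S.kd {..<N} z I -
      (S.kd {..<N} (\<lambda>I. z I - t I) I + (S.kd {..<N} t I - S0.kd {..<N} t I)))"
      by (intro supported_diff supported_add supported_low[OF sl] supported_top_diff[OF st])
        (simp add: z(2) supported_def)
    then show "supported (\<lambda>x I. \<not> top L e x I) (\<lambda>I. S.kd {..<N} z I -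
      (S.kd {..<N} (\<lambda>I. z I - t I) I + (S.kd {..<N} t I - S0.kd {..<N} t I)))"
      by (rule supported_mono) (rule low_not_top)
  qed
  have cyc: "S0.kd {..<N} t = (\<lambda>_. 0)"
    by (rule trans[OF eq1 trans[OF arg_cong[OF eq2, of "chain_filter (top L e)"] eq3]])
  have "S0.chain {..<N} p t"
    by (rule S0.chainI) (simp_all add: t_def chain_filter_def S.chain_eq_0[OF z(1)])
  then have "S0.boundary {..<N} p t" using cyc by (intro S0.acyclic_atD[OF acyclic_all_cells[OF p]])
  then obtain u0 where u0: "S0.chain {..<N} (Suc p) u0" "S0.kd {..<N} u0 = t" by (rule S0.boundaryE)
  \<comment> \<open>Discarding the other grades of \<open>u0\<close> ensures that the full
    differential of \<open>u\<close> differs from \<open>t\<close> in lower grades only.\<close>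
  define u where "u = chain_filter (top L e) u0"
  have su: "supported (top L e) u" unfolding u_def by (rule supported_chain_filter)
  have ku: "S0.kd {..<N} u = t"
    unfolding u_def filter_top[symmetric] u0(2) by (rule chain_filter_id[OF st])
  have "S.chain {..<N} (Suc p) u"
    by (rule S.chainI) (simp_all add: u_def chain_filter_def S0.chain_eq_0[OF u0(1)])
  moreover have "(\<lambda>I. z I - S.kd {..<N} u I) = (\<lambda>I. (z I - t I) - (S.kd {..<N} u I - S0.kd {..<N} u I))"
    by (simp add: ku)
  then have "supported (low L e) (\<lambda>I. z I - S.kd {..<N} u I)"
    using supported_diff[OF sl supported_top_diff[OF su]] by simp
  ultimately show thesis by (rule that)
qed

lemma acyclic_monomials:
  assumes p: "p + CARD('n) > N"
  shows "S.acyclic_at {..<N} p"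
  unfolding S.acyclic_at_def
proof (intro allI impI, elim conjE)
  fix z assume "S.chain {..<N} p z" "S.kd {..<N} z = (\<lambda>_. 0)"
  define L where "L = Max (insert 0 ((\<lambda>x. nu x + p) ` (\<Union>I\<in>Pow {..<N}. Poly_Mapping.keys (z I))))"
  define \<Omega> where "\<Omega> = {(x, I). I \<subseteq> {..<N} \<and> nu x + card I \<le> L}"
  have "\<Omega> \<subseteq> {x. nu x \<le> L} \<times> Pow {..<N}" by (auto simp: \<Omega>_def)
  then have fin: "finite \<Omega>" using finite_nu_le[of L] finite_subset by blast
  define D where "D = (\<lambda>(x, I). grade x I) ` \<Omega>"
  have finD: "finite D" using fin by (simp add: D_def)
  \<comment> \<open>The induction measure: \<open>E\<close> consists of the grades from \<Omega>
    that do not exceed one occurring in \<open>y\<close>. Cancelling the highest occurring grade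
    removes it from \<open>E\<close> and adds nothing.\<close>
  have "S.boundary {..<N} p y"
    if "S.chain {..<N} p y" "S.kd {..<N} y = (\<lambda>_. 0)" "supported (\<lambda>x I. (x, I) \<in> \<Omega>) y"
      "E = {d\<in>D. \<exists>I. \<exists>x\<in>Poly_Mapping.keys (y I). d = grade x I \<or> cheaper d (grade x I)}" for y E
    using that
  proof (induction "card E" arbitrary: y E rule: less_induct)
    case less
    define G where "G = {grade x I | x I. x \<in> Poly_Mapping.keys (y I)}"
    have GD: "G \<subseteq> D" using less.prems(3) by (fastforce simp: G_def D_def supported_def)
    then have finG: "finite G" using finD finite_subset by blast
    show ?case
    proof (cases "G = {}")
      case True
      then have "y = (\<lambda>_. 0)"
        by (auto simp: G_def fun_eq_iff) (metis all_not_in_conv keys_eq_empty)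
      then show ?thesis using S.boundary_zero by simp
    next
      case False
      have "asymp_on G cheaper"
        by (rule asymp_onI) (use cheaper_trans cheaper_irrefl in blast)
      moreover have "transp_on G cheaper"
        by (rule transp_onI) (use cheaper_trans in blast)
      ultimately obtain e where e: "e \<in> G" "\<And>d. d \<in> G \<Longrightarrow> d \<noteq> e \<Longrightarrow> \<not> cheaper e d"
        using Finite_Set.bex_max_element[OF finG _ _ False, of cheaper] by blast
      have le: "d = e \<or> cheaper d e" if "d \<in> G" for d
        using e(2)[OF that] cheaper_total by blast
      have "supported (\<lambda>x I. low L e x I \<or> top L e x I) y"
        unfolding supported_def
      proof (intro allI ballI)
        fix I x assume x: "x \<in> Poly_Mapping.keys (y I)"
        then have "grade x I \<in> G" by (auto simp: G_def)
        moreover have "(x, I) \<in> \<Omega>" using less.prems(3) x by (auto simp: supported_def)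
        ultimately show "low L e x I \<or> top L e x I" using le by (auto simp: low_def top_def \<Omega>_def)
      qed
      then obtain u where u: "S.chain {..<N} (Suc p) u" "supported (low L e) (\<lambda>I. y I - S.kd {..<N} u I)"
        using reduce_top[OF p less.prems(1,2)] by blast
      define y' where "y' = (\<lambda>I. y I - S.kd {..<N} u I)"
      define E' where "E' = {d\<in>D. \<exists>I. \<exists>x\<in>Poly_Mapping.keys (y' I). d = grade x I \<or> cheaper d (grade x I)}"
      have low: "low L e x I" if "x \<in> Poly_Mapping.keys (y' I)" for x I
        using u(2) that by (auto simp: supported_def y'_def)
      have eE: "e \<in> E" using e(1) GD less.prems(4) by (auto simp: G_def)
      have "E' \<subseteq> E - {e}"
      proof
        fix d assume "d \<in> E'"
        then obtain I x where x: "d \<in> D" "x \<in> Poly_Mapping.keys (y' I)" "d = grade x I \<or> cheaper d (grade x I)"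
          by (auto simp: E'_def)
        then have "cheaper d e" using low[OF x(2)] cheaper_trans by (auto simp: low_def)
        moreover obtain I' x' where "x' \<in> Poly_Mapping.keys (y I')" "e = grade x' I'"
          using e(1) by (auto simp: G_def)
        ultimately show "d \<in> E - {e}" using x(1) less.prems(4) cheaper_irrefl by auto
      qed
      moreover have "finite E" using finD less.prems(4) by simp
      ultimately have "card E' < card E" using eE by (intro psubset_card_mono) auto
      moreover have "S.chain {..<N} p y'"
        unfolding y'_def using less.prems(1) u(1) by (intro S.chain_diff S.chain_kd) auto
      moreover have "S.kd {..<N} y' = (\<lambda>_. 0)"
        by (simp add: y'_def S.kd_diff S.kd_kd less.prems(2))
      moreover have "supported (\<lambda>x I. (x, I) \<in> \<Omega>) y'"
        unfolding supported_def using low by (auto simp: low_def \<Omega>_def)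
      ultimately have "S.boundary {..<N} p y'" using E'_def by (rule less.hyps)
      moreover have "S.boundary {..<N} p (S.kd {..<N} u)" using u(1) by (rule S.boundaryI) simp
      ultimately have "S.boundary {..<N} p (\<lambda>I. y' I + S.kd {..<N} u I)" by (rule S.boundary_add)
      then show ?thesis by (simp add: y'_def)
    qed
  qed
  moreover have "supported (\<lambda>x I. (x, I) \<in> \<Omega>) z"
    unfolding supported_def
  proof (intro allI ballI)
    fix I x assume x: "x \<in> Poly_Mapping.keys (z I)"
    then have "z I \<noteq> 0" by auto
    then have I: "I \<subseteq> {..<N}" "card I = p"
      using S.chain_eq_0[OF \<open>S.chain {..<N} p z\<close>, of I] by auto
    then have "nu x + p \<le> L" unfolding L_def using x by (intro Max_ge) auto
    then show "(x, I) \<in> \<Omega>" using I by (simp add: \<Omega>_def)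
  qed
  ultimately show "S.boundary {..<N} p z"
    using \<open>S.chain {..<N} p z\<close> \<open>S.kd {..<N} z = (\<lambda>_. 0)\<close> by blast
qed

end

end

section \<open>The geometry of the Newton polytope\<close>

locale convenient_poly =
  fixes f :: "'n::finite cpoly"
  assumes conv: "convenient f"
begin

definition P :: "(real ^ 'n) set" where
  "P = newton_polytope f"

definition points :: "(real ^ 'n) set" where
  "points = exp_point ` Poly_Mapping.keys f"

lemma P_eq: "P = convex hull (insert 0 points)"
  by (simp add: P_def newton_polytope_def points_def)

lemma finite_points: "finite points"
  by (simp add: points_def)

lemma polytope_P: "polytope P"
  unfolding P_eq using finite_points by (intro polytope_convex_hull) simp

lemma zero_in_P: "0 \<in> P"
  unfolding P_eq by (rule hull_inc) simp

lemma points_in_P: "z \<in> points \<Longrightarrow> z \<in> P"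
  unfolding P_eq by (rule hull_inc) simp

lemma P_nonneg: "z \<in> P \<Longrightarrow> 0 \<le> z $ i"
proof -
  have "convex {z :: real ^ 'n. 0 \<le> z $ i}"
    using convex_halfspace_ge[of 0 "axis i 1 :: real ^ 'n"] by (simp add: inner_axis')
  then have "P \<subseteq> {z. 0 \<le> z $ i}"
    unfolding P_eq by (intro hull_minimal) (auto simp: points_def exp_point_nonneg)
  then show "z \<in> P \<Longrightarrow> 0 \<le> z $ i" by blast
qed

text \<open>Convenience of \<open>f\<close> enters the geometry through these points on the
  axes.\<close>

lemma axis_in_P: "\<exists>k>0. axis i k \<in> P"
proof -
  obtain k where k: "k \<ge> 1" "Poly_Mapping.lookup f (axis i k) \<noteq> 0"
    using conv by (auto simp: convenient_def)
  then have "exp_point (axis i k) \<in> P"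
    by (intro points_in_P) (auto simp: points_def in_keys_iff)
  moreover have "exp_point (axis i k) = axis i (real k)"
    by (simp add: exp_point_def vec_eq_iff axis_def)
  ultimately show ?thesis using k by (intro exI[of _ "real k"]) auto
qed

lemma span_P: "span P = UNIV"
proof -
  have "axis i 1 \<in> span P" for i :: 'n
  proof -
    obtain k where k: "k > 0" "axis i k \<in> P" using axis_in_P by blast
    then have "(1 / k) *\<^sub>R axis i k \<in> span P" by (intro span_scale span_base)
    moreover have "(1 / k) *\<^sub>R axis i k = (axis i 1 :: real ^ 'n)"
      using k by (simp add: vec_eq_iff axis_def)
    ultimately show ?thesis by simp
  qed
  then have "Basis \<subseteq> span P" by (auto simp: Basis_vec_def)
  then have "span (Basis :: (real ^ 'n) set) \<subseteq> span P" by (rule span_minimal) (rule subspace_span)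
  then show ?thesis unfolding span_Basis by blast
qed

lemma affine_hull_P: "affine hull P = UNIV"
  using affine_hull_span_0[OF hull_inc[OF zero_in_P]] span_P by simp

lemma aff_dim_P: "aff_dim P = int CARD('n)"
  using affine_hull_P aff_dim_affine_hull[of P] by simp

lemma boundary_facets_eq: "boundary_facets P = {F. F facet_of P \<and> 0 \<notin> F}"
  by (auto simp: boundary_facets_def boundary_faces_def facet_of_def aff_dim_P)

lemma finite_boundary_facets: "finite (boundary_facets P)"
  unfolding boundary_facets_eq using finite_polytope_facets[OF polytope_P] by (rule rev_finite_subset) blast

lemma inner_covector_le:
  assumes "F \<in> boundary_facets P"
  obtains u where "F = P \<inter> {z. u \<bullet> z = 1}" "\<And>z. z \<in> P \<Longrightarrow> u \<bullet> z \<le> 1"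
proof -
  have F: "F facet_of P" "0 \<notin> F" using assms by (auto simp: boundary_facets_eq)
  obtain a b where ab: "P \<subseteq> {x. a \<bullet> x \<le> b}" "F = P \<inter> {x. a \<bullet> x = b}"
    using facet_of_polyhedron[OF polytope_imp_polyhedron[OF polytope_P] F(1)] by blast
  have "b \<noteq> 0" using F(2) ab(2) zero_in_P by auto
  moreover have "0 \<le> b" using ab(1) zero_in_P by auto
  ultimately have b: "b > 0" by simp
  show thesis
  proof (rule that[of "(1 / b) *\<^sub>R a"])
    show "F = P \<inter> {z. ((1 / b) *\<^sub>R a) \<bullet> z = 1}" using ab(2) b by auto
    show "((1 / b) *\<^sub>R a) \<bullet> z \<le> 1" if "z \<in> P" for z
      using ab(1) that b by (auto simp: field_simps)
  qed
qed

text \<open>The facet together with the origin has full affine dimension, whereas two different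
  covectors would put both into the hyperplane orthogonal to their difference.\<close>

lemma facet_covector_unique:
  assumes F: "F \<in> boundary_facets P" and uv: "F \<subseteq> {z. u \<bullet> z = 1}" "F \<subseteq> {z. v \<bullet> z = 1}"
  shows "u = v"
proof (rule ccontr)
  assume ne: "u \<noteq> v"
  have "0 \<notin> affine hull F"
  proof
    assume "0 \<in> affine hull F"
    moreover have "affine hull F \<subseteq> {z. u \<bullet> z = 1}"
      using uv(1) affine_hyperplane by (rule hull_minimal)
    ultimately show False by auto
  qed
  then have "aff_dim (insert 0 F) = int CARD('n)"
    using F by (simp add: aff_dim_insert boundary_facets_def)
  moreover have "insert 0 F \<subseteq> {z. (u - v) \<bullet> z = 0}"
    using uv by (fastforce simp: inner_diff_left)
  then have "aff_dim (insert 0 F) \<le> aff_dim {z. (u - v) \<bullet> z = 0}" by (rule aff_dim_subset)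
  moreover have "aff_dim {z. (u - v) \<bullet> z = 0} = int CARD('n) - 1" using ne by simp
  ultimately show False by simp
qed

text \<open>A face of a convex hull is the hull of some of the generating points, and the origin is
  not among these as the facet avoids it.\<close>

lemma boundary_facet_points:
  assumes "F \<in> boundary_facets P"
  shows "F = convex hull (points \<inter> F)"
proof -
  have F: "F face_of P" "0 \<notin> F" using assms by (auto simp: boundary_facets_def boundary_faces_def)
  obtain T where T: "T \<subseteq> insert 0 points" "F = convex hull T"
    using face_of_convex_hull_subset[of "insert 0 points" F] F(1) finite_points
    unfolding P_eq by (auto intro: finite_imp_compact)
  have TF: "T \<subseteq> F" using T(2) by (simp add: hull_subset)
  then have "T \<subseteq> points \<inter> F" using T(1) F(2) by auto
  then have "F \<subseteq> convex hull (points \<inter> F)" using T(2) by (metis hull_mono)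
  moreover have "convex hull (points \<inter> F) \<subseteq> F"
    using T(2) by (intro hull_minimal) (auto simp: convex_convex_hull)
  ultimately show ?thesis by blast
qed

text \<open>The facet contains n linearly independent exponents, so the covector solves a square
  linear system over the integers and Cramer's rule applies.\<close>

lemma rational_covector:
  assumes F: "F \<in> boundary_facets P" and u: "F = P \<inter> {z. u \<bullet> z = 1}"
  shows "u $ k \<in> \<rat>"
proof -
  define T where "T = points \<inter> F"
  have FT: "F = convex hull T" using boundary_facet_points[OF F] by (simp add: T_def)
  have uT: "u \<bullet> z = 1" if "z \<in> T" for z using that u by (auto simp: T_def)
  obtain B where B: "B \<subseteq> T" "independent B" "T \<subseteq> span B"
    using maximal_independent_subset[of T] by blast
  have spB: "span B = UNIV"
  proof (rule ccontr)
    assume "span B \<noteq> UNIV"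
    then obtain a where a: "a \<noteq> 0" "span B \<subseteq> {x. a \<bullet> x = 0}"
      using span_not_UNIV_orthogonal[of B] by auto
    have "F \<subseteq> {z. (u + a) \<bullet> z = 1}"
      unfolding FT using a(2) B(3) uT
      by (intro hull_minimal convex_hyperplane) (auto simp: inner_add_left)
    then have "u = u + a" using u by (intro facet_covector_unique[OF F]) auto
    then show False using a(1) by simp
  qed
  have "card B = CARD('n)"
    using dim_eq_card_independent[OF B(2)] spB dim_span[of B] by (simp add: dim_UNIV)
  moreover have "finite B" using B(1) finite_points by (auto simp: T_def intro: finite_subset)
  ultimately obtain e where e: "bij_betw e (UNIV :: 'n set) B"
    using finite_same_card_bij[of "UNIV :: 'n set" B] by auto
  define A :: "real ^ 'n ^ 'n" where "A = (\<chi> i. e i)"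
  have eB: "e i \<in> B" for i using e by (auto simp: bij_betw_def)
  have Av: "(A *v x) $ i = e i \<bullet> x" for x i
    by (simp add: A_def matrix_vector_mult_def inner_vec_def)
  have "x = 0" if "A *v x = 0" for x
  proof -
    have "e i \<bullet> x = 0" for i using Av[of x i] that by simp
    then have "B \<subseteq> {z. z \<bullet> x = 0}" using e by (auto simp: bij_betw_def)
    moreover have "subspace {z. z \<bullet> x = 0}"
      using subspace_hyperplane[of x] by (simp add: inner_commute)
    ultimately have "span B \<subseteq> {z. z \<bullet> x = 0}" by (rule span_minimal)
    then have "x \<bullet> x = 0" using spB by blast
    then show ?thesis by simp
  qed
  then have "invertible A"
    using matrix_left_invertible_ker[of A] by (auto simp: invertible_left_inverse)
  then have det: "det A \<noteq> 0" by (simp add: invertible_det_nz)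
  have int: "A $ i $ j \<in> \<int>" for i j
    using eB[of i] B(1) by (auto simp: A_def T_def points_def exp_point_def)
  have Au: "(A *v u) $ i = 1" for i
  proof -
    have "e i \<in> T" using eB B(1) by blast
    from uT[OF this] show ?thesis by (simp add: Av inner_commute)
  qed
  have "det ((\<chi> i j. if j = k then (A *v u) $ i else A $ i $ j) :: real ^ 'n ^ 'n) \<in> \<int>"
    unfolding det_def by (intro Ints_sum Ints_mult Ints_prod) (auto simp: Au int)
  then have "u $ k * det A \<in> \<int>" by (simp add: cramer_lemma)
  moreover have "det A \<in> \<int>"
    unfolding det_def by (intro Ints_sum Ints_mult Ints_prod) (auto simp: int)
  ultimately have "(u $ k * det A) / det A \<in> \<rat>"
    by (intro Rats_divide) (auto simp: Ints_def)
  then show ?thesis using det by simp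
qed

definition covec :: "(real ^ 'n) set \<Rightarrow> real ^ 'n" where
  "covec F = (\<chi> i. real_of_rat (facet_covector P F $ i))"

text \<open>Existence of a rational covector makes the choice in \<open>facet_covector\<close>
  meaningful; uniqueness then identifies it with the supporting covector, which gives the
  inequality.\<close>

lemma covec:
  assumes F: "F \<in> boundary_facets P"
  shows "F = P \<inter> {z. covec F \<bullet> z = 1}" "\<And>z. z \<in> P \<Longrightarrow> covec F \<bullet> z \<le> 1"
proof -
  obtain u where u: "F = P \<inter> {z. u \<bullet> z = 1}" "\<And>z. z \<in> P \<Longrightarrow> u \<bullet> z \<le> 1"
    using inner_covector_le[OF F] by blast
  have "\<forall>k. \<exists>q. u $ k = real_of_rat q" using rational_covector[OF F u(1)] by (auto simp: Rats_def)
  then obtain q where q: "\<And>k. u $ k = real_of_rat (q k)" by metis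
  have "F = P \<inter> {x. (\<Sum>i\<in>UNIV. real_of_rat ((\<chi> k. q k) $ i) * x $ i) = 1}"
    using u(1) by (simp add: q inner_vec_def)
  then have "F = P \<inter> {x. (\<Sum>i\<in>UNIV. real_of_rat (facet_covector P F $ i) * x $ i) = 1}"
    unfolding facet_covector_def by (rule someI)
  then show 1: "F = P \<inter> {z. covec F \<bullet> z = 1}" by (simp add: covec_def inner_vec_def)
  have "covec F = u" using u(1) 1 by (intro facet_covector_unique[OF F]) auto
  then show "\<And>z. z \<in> P \<Longrightarrow> covec F \<bullet> z \<le> 1" using u(2) by simp
qed

definition U :: "(real ^ 'n) set" where
  "U = covec ` boundary_facets P"

text \<open>A facet through the origin yields an inequality with right hand side 0. Since
  \<open>P\<close> has points on every positive axis, its coefficients are nonpositive, so it holds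
  on the whole orthant and only the boundary facets remain.\<close>

lemma in_P_iff:
  assumes "\<And>i. 0 \<le> x $ i"
  shows "x \<in> P \<longleftrightarrow> (\<forall>u\<in>U. u \<bullet> x \<le> 1)"
proof
  assume "x \<in> P"
  then show "\<forall>u\<in>U. u \<bullet> x \<le> 1" using covec(2) by (auto simp: U_def)
next
  assume x: "\<forall>u\<in>U. u \<bullet> x \<le> 1"
  obtain H where H: "finite H" "P = affine hull P \<inter> \<Inter>H"
    and hs: "\<And>h. h \<in> H \<Longrightarrow> \<exists>a b. a \<noteq> 0 \<and> h = {x. a \<bullet> x \<le> b}"
    and min: "\<And>F'. F' \<subset> H \<Longrightarrow> P \<subset> affine hull P \<inter> \<Inter>F'"
    using polytope_imp_polyhedron[OF polytope_P] by (simp add: polyhedron_Int_affine_minimal) meson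
  from hs obtain a b where ab: "\<And>h. h \<in> H \<Longrightarrow> a h \<noteq> 0 \<and> h = {x. a h \<bullet> x \<le> b h}" by metis
  have "x \<in> h" if h: "h \<in> H" for h
  proof -
    have Ph: "P \<subseteq> h" using H(2) h by blast
    define G where "G = P \<inter> {x. a h \<bullet> x = b h}"
    have G: "G facet_of P"
      using facet_of_polyhedron_explicit[OF H ab min, of G] h by (auto simp: G_def)
    have hh: "h = {x. a h \<bullet> x \<le> b h}" using ab[OF h] by blast
    have Pab: "a h \<bullet> z \<le> b h" if "z \<in> P" for z using Ph hh that by blast
    have b0: "0 \<le> b h" using Pab[OF zero_in_P] by simp
    have "a h \<bullet> x \<le> b h"
    proof (cases "b h = 0")
      case True
      have "a h $ i \<le> 0" for i
      proof -
        obtain k where k: "k > 0" "axis i k \<in> P" using axis_in_P by blast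
        then show ?thesis using Pab[OF k(2)] True by (simp add: inner_axis mult_le_0_iff)
      qed
      then have "a h \<bullet> x \<le> 0"
        unfolding inner_vec_def using assms by (auto intro!: sum_nonpos mult_nonpos_nonneg)
      then show ?thesis using True by simp
    next
      case False
      then have b: "b h > 0" using b0 by simp
      have "0 \<notin> G" using False by (simp add: G_def)
      then have GF: "G \<in> boundary_facets P" using G by (simp add: boundary_facets_eq)
      have "covec G = (1 / b h) *\<^sub>R a h"
        using covec(1)[OF GF] b by (intro facet_covector_unique[OF GF]) (auto simp: G_def)
      moreover have "covec G \<bullet> x \<le> 1" using x GF by (auto simp: U_def)
      ultimately show ?thesis using b by (simp add: field_simps)
    qed
    then show ?thesis using hh by blast
  qed
  then show "x \<in> P" using H(2) affine_hull_P by blast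
qed

lemma finite_U: "finite U"
  by (simp add: U_def finite_boundary_facets)

text \<open>Otherwise the whole ray through \<open>x\<close> would lie in \<open>P\<close>, which is
  bounded.\<close>

lemma exists_positive:
  assumes "\<And>i. 0 \<le> x $ i" "x \<noteq> 0"
  shows "\<exists>u\<in>U. 0 < u \<bullet> x"
proof (rule ccontr)
  assume "\<not> ?thesis"
  then have neg: "\<forall>u\<in>U. u \<bullet> x \<le> 0" by (simp add: not_less)
  obtain r where r: "\<And>z. z \<in> P \<Longrightarrow> norm z \<le> r"
    using polytope_imp_bounded[OF polytope_P] by (auto simp: bounded_iff)
  \<comment> \<open>This multiple of \<open>x\<close> has norm \<open>\<bar>r\<bar> + 1\<close>,
    beyond the bound \<open>r\<close>.\<close>
  define t where "t = (\<bar>r\<bar> + 1) / norm x"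
  have t: "t > 0" using assms(2) by (simp add: t_def)
  have "u \<bullet> (t *\<^sub>R x) \<le> 1" if "u \<in> U" for u
  proof -
    have "t * (u \<bullet> x) \<le> 0" using neg that t by (intro mult_nonneg_nonpos) auto
    then show ?thesis by simp
  qed
  then have "t *\<^sub>R x \<in> P" using assms t by (subst in_P_iff) auto
  then have "norm (t *\<^sub>R x) \<le> r" by (rule r)
  then show False using assms(2) t by (simp add: t_def)
qed

lemma nonempty_U: "U \<noteq> {}"
  using exists_positive[of "\<chi> i. 1"] by (auto simp: vec_eq_iff)

lemma height_le_1: "z \<in> P \<Longrightarrow> height U z \<le> 1"
  unfolding height_def using finite_U nonempty_U covec(2) by (auto simp: U_def)

lemmas height_U_ge = inner_le_height[OF finite_U]
lemmas height_U_attained = height_attained[OF finite_U nonempty_U]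

text \<open>The exponents of \<open>f\<close> on the Newton boundary.\<close>

definition V :: "(nat ^ 'n) set" where
  "V = {m \<in> Poly_Mapping.keys f. height U (exp_point m) = 1}"

definition N :: nat where
  "N = card V"

definition vs :: "nat \<Rightarrow> nat ^ 'n" where
  "vs = (SOME e. bij_betw e {..<N} V)"

lemma finite_V: "finite V"
  by (simp add: V_def)

lemma bij_vs: "bij_betw vs {..<N} V"
proof -
  have "\<exists>e. bij_betw e {..<N} V"
    using ex_bij_betw_nat_finite[OF finite_V] by (simp add: N_def lessThan_atLeast0)
  then show ?thesis unfolding vs_def by (rule someI_ex)
qed

lemma scaled_in_P:
  assumes "\<And>i. 0 \<le> x $ i" "x \<noteq> 0"
  shows "0 < height U x" "(1 / height U x) *\<^sub>R x \<in> P"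
proof -
  obtain u where "u \<in> U" "0 < u \<bullet> x" using exists_positive[of x] assms by blast
  then show c: "0 < height U x" using height_U_ge[of u x] by simp
  have "u \<bullet> ((1 / height U x) *\<^sub>R x) \<le> 1" if "u \<in> U" for u
    using height_U_ge[OF that, of x] c by simp
  then show "(1 / height U x) *\<^sub>R x \<in> P" using assms c by (subst in_P_iff) auto
qed

text \<open>Scaled to height 1, \<open>x\<close> lands on the facet whose covector attains the
  height, and that facet is the convex hull of exponents in \<open>V\<close>.\<close>

lemma representation_V:
  assumes x: "\<And>i. 0 \<le> x $ i"
  shows "\<exists>l. (\<forall>i. 0 \<le> l i) \<and> (\<forall>i\<ge>N. l i = 0) \<and> x = (\<Sum>i<N. l i *\<^sub>R exp_point (vs i)) \<and>
    (\<Sum>i<N. l i) = height U x"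
proof (cases "x = 0")
  case True
  have "(\<lambda>u. u \<bullet> 0) ` U = {0 :: real}" using nonempty_U by auto
  then have "height U 0 = 0" by (simp add: height_def)
  then show ?thesis using True by (intro exI[of _ "\<lambda>_. 0"]) simp
next
  case False
  define c where "c = height U x"
  have c: "c > 0" "(1 / c) *\<^sub>R x \<in> P" using scaled_in_P[OF x False] by (auto simp: c_def)
  obtain F where F: "F \<in> boundary_facets P" "covec F \<bullet> x = c"
    using height_U_attained[of x] by (auto simp: U_def c_def)
  have "(1 / c) *\<^sub>R x \<in> F"
  proof -
    have "covec F \<bullet> ((1 / c) *\<^sub>R x) = 1" using F(2) c by simp
    then show ?thesis using c(2) covec(1)[OF F(1)] by blast
  qed
  then have "(1 / c) *\<^sub>R x \<in> convex hull (points \<inter> F)" using boundary_facet_points[OF F(1)] by simp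
  then obtain \<mu> where \<mu>: "\<forall>z\<in>points \<inter> F. 0 \<le> \<mu> z" "sum \<mu> (points \<inter> F) = 1"
    "(\<Sum>z\<in>points \<inter> F. \<mu> z *\<^sub>R z) = (1 / c) *\<^sub>R x"
    using convex_hull_finite[of "points \<inter> F"] finite_points by auto
  have sub: "points \<inter> F \<subseteq> exp_point ` V"
  proof
    fix z assume z: "z \<in> points \<inter> F"
    then obtain m where m: "m \<in> Poly_Mapping.keys f" "z = exp_point m" by (auto simp: points_def)
    have "covec F \<bullet> z = 1" using z covec(1)[OF F(1)] by blast
    moreover have "covec F \<in> U" using F(1) by (simp add: U_def)
    ultimately have "1 \<le> height U z" using height_U_ge[of "covec F" z] by simp
    moreover have "height U z \<le> 1" using z points_in_P height_le_1 by blast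
    ultimately show "z \<in> exp_point ` V" using m by (simp add: V_def)
  qed
  have inj: "inj_on exp_point V" by (simp add: inj_on_def exp_point_inj)
  have reindex: "(\<Sum>i<N. h (exp_point (vs i))) = (\<Sum>z\<in>exp_point ` V. h z)" for h :: "_ \<Rightarrow> 'b::comm_monoid_add"
    using sum.reindex_bij_betw[OF bij_vs, of "\<lambda>v. h (exp_point v)"] inj by (simp add: sum.reindex)
  define l where "l i = (if i < N \<and> exp_point (vs i) \<in> points \<inter> F then c * \<mu> (exp_point (vs i)) else 0)" for i
  define l' where "l' z = (if z \<in> points \<inter> F then c * \<mu> z else 0)" for z
  have ll: "l i = l' (exp_point (vs i))" if "i < N" for i using that by (simp add: l_def l'_def)
  have "(\<Sum>i<N. l i *\<^sub>R exp_point (vs i)) = (\<Sum>z\<in>exp_point ` V. l' z *\<^sub>R z)"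
    using reindex[of "\<lambda>z. l' z *\<^sub>R z"] ll by simp
  also have "\<dots> = (\<Sum>z\<in>points \<inter> F. (c * \<mu> z) *\<^sub>R z)"
    using sub finite_V by (intro sum.mono_neutral_cong_right) (auto simp: l'_def)
  also have "\<dots> = c *\<^sub>R (\<Sum>z\<in>points \<inter> F. \<mu> z *\<^sub>R z)" by (simp add: scaleR_sum_right)
  also have "\<dots> = x" using \<mu>(3) c by simp
  finally have 1: "x = (\<Sum>i<N. l i *\<^sub>R exp_point (vs i))" by simp
  have "(\<Sum>i<N. l i) = (\<Sum>z\<in>exp_point ` V. l' z)"
    using reindex[of l'] ll by simp
  also have "\<dots> = (\<Sum>z\<in>points \<inter> F. c * \<mu> z)"
    using sub finite_V by (intro sum.mono_neutral_cong_right) (auto simp: l'_def)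
  also have "\<dots> = c" using \<mu>(2) by (simp add: sum_distrib_left[symmetric])
  finally have 2: "(\<Sum>i<N. l i) = height U x" by (simp add: c_def)
  have "0 \<le> l i" for i using \<mu>(1) c by (auto simp: l_def)
  moreover have "l i = 0" if "i \<ge> N" for i using that by (simp add: l_def)
  ultimately show ?thesis using 1 2 by blast
qed

sublocale newton_cone U vs N
proof
  show "height U (exp_point (vs j)) = 1" if "j < N" for j
    using bij_vs that by (auto simp: bij_betw_def V_def)
qed (use finite_U nonempty_U representation_V in auto)

lemma nu_keys_le: "m \<in> Poly_Mapping.keys f \<Longrightarrow> nu m \<le> 1"
  unfolding nu_def by (rule height_le_1, rule points_in_P) (simp add: points_def)

lemma newton_function_eq: "real_of_rat (newton_function P a) = nu a"
proof -
  define h where "h F = (\<Sum>i\<in>UNIV. facet_covector P F $ i * of_nat (a $ i))" for F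
  have "real_of_rat (h F) = covec F \<bullet> exp_point a" for F
    by (simp add: h_def covec_def inner_vec_def exp_point_def of_rat_sum of_rat_mult)
  then have "real_of_rat ` h ` boundary_facets P = (\<lambda>u. u \<bullet> exp_point a) ` U"
    by (auto simp: U_def image_iff)
  moreover have "real_of_rat (Max (h ` boundary_facets P)) = Max (real_of_rat ` h ` boundary_facets P)"
    using finite_boundary_facets nonempty_U
    by (intro mono_Max_commute) (auto simp: mono_def of_rat_less_eq U_def)
  ultimately show ?thesis by (simp add: newton_function_def h_def nu_def height_def)
qed

text \<open>The face over which \<open>x\<close> lies in the relative interior of the cone, intersected with the coordinate
  subspaces that contain \<open>x\<close>.\<close>

definition carrier_face :: "real ^ 'n \<Rightarrow> (real ^ 'n) set" where
  "carrier_face x = {z\<in>P. (\<forall>u\<in>U. u \<bullet> x = height U x \<longrightarrow> u \<bullet> z = 1) \<and> (\<forall>i. x $ i = 0 \<longrightarrow> z $ i = 0)}"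

text \<open>It is an intersection of faces cut out by supporting hyperplanes, and \<open>x\<close>
  scaled to height 1 shows that it is not empty.\<close>

lemma carrier_face_boundary:
  assumes x: "\<And>i. 0 \<le> x $ i" "x \<noteq> 0"
  shows "carrier_face x \<in> boundary_faces P"
proof -
  define A where "A = (\<lambda>u. P \<inter> {z. u \<bullet> z = 1}) ` {u\<in>U. u \<bullet> x = height U x}"
  define Z where "Z = (\<lambda>i. P \<inter> {z. axis i 1 \<bullet> z = 0}) ` {i. x $ i = 0}"
  have convP: "convex P" by (simp add: P_eq)
  have "A \<noteq> {}" using height_U_attained[of x] by (auto simp: A_def)
  moreover have "T face_of P" if "T \<in> A" for T
    using that covec(2) by (auto simp: A_def U_def intro!: face_of_Int_supporting_hyperplane_le[OF convP])
  moreover have "T face_of P" if TZ: "T \<in> Z" for T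
  proof -
    obtain i where T: "T = P \<inter> {z. axis i 1 \<bullet> z = 0}" using TZ by (auto simp: Z_def)
    show ?thesis
      unfolding T by (rule face_of_Int_supporting_hyperplane_ge[OF convP]) (simp add: inner_axis' P_nonneg)
  qed
  ultimately have "\<Inter>(A \<union> Z) face_of P" by (intro face_of_Inter) auto
  moreover have "\<Inter>(A \<union> Z) = carrier_face x"
    using \<open>A \<noteq> {}\<close> by (auto simp: A_def Z_def carrier_face_def inner_axis')
  moreover have "(1 / height U x) *\<^sub>R x \<in> carrier_face x"
    using scaled_in_P[OF x] by (auto simp: carrier_face_def)
  moreover have "0 \<notin> carrier_face x"
    using height_U_attained[of x] by (auto simp: carrier_face_def)
  ultimately show ?thesis by (auto simp: boundary_faces_def)
qed

end

section \<open>The Nullstellensatz on the torus\<close>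

text \<open>Gaussian elimination: the coordinate \<open>k\<close> is cleared with a pivot
  \<open>b0\<close>, which leaves one vector and one coordinate fewer.\<close>

lemma linear_dependence:
  fixes f :: "'b \<Rightarrow> 'k \<Rightarrow> 'a::field"
  assumes "finite K" "finite B" "card K < card B"
  shows "\<exists>l. (\<exists>b\<in>B. l b \<noteq> 0) \<and> (\<forall>k\<in>K. (\<Sum>b\<in>B. l b * f b k) = 0)"
  using assms
proof (induction K arbitrary: B f rule: finite_induct)
  case empty
  then obtain b where "b \<in> B" by (metis card.empty equals0I less_irrefl)
  then show ?case by (intro exI[of _ "\<lambda>_. 1"]) auto
next
  case (insert k K)
  show ?case
  proof (cases "\<forall>b\<in>B. f b k = 0")
    case True
    obtain l where l: "\<exists>b\<in>B. l b \<noteq> 0" "\<forall>k\<in>K. (\<Sum>b\<in>B. l b * f b k) = 0"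
      using insert.IH[of B f] insert.prems insert.hyps by auto
    then show ?thesis using True by (intro exI[of _ l]) auto
  next
    case False
    then obtain b0 where b0: "b0 \<in> B" "f b0 k \<noteq> 0" by blast
    define B' where "B' = B - {b0}"
    define f' where "f' b j = f b j - f b k / f b0 k * f b0 j" for b j
    have B: "B = insert b0 B'" "b0 \<notin> B'" "finite B'" using b0 insert.prems by (auto simp: B'_def)
    then have "card K < card B'" using insert.prems insert.hyps by simp
    then obtain l where l: "\<exists>b\<in>B'. l b \<noteq> 0" "\<forall>k\<in>K. (\<Sum>b\<in>B'. l b * f' b k) = 0"
      using insert.IH[of B' f'] B by auto
    define m where "m b = (if b = b0 then - (\<Sum>b\<in>B'. l b * f b k) / f b0 k else l b)" for b
    have sum_m: "(\<Sum>b\<in>B. m b * f b j) = - (\<Sum>b\<in>B'. l b * f b k) / f b0 k * f b0 j + (\<Sum>b\<in>B'. l b * f b j)" for j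
    proof -
      have "(\<Sum>b\<in>B'. m b * f b j) = (\<Sum>b\<in>B'. l b * f b j)"
        using B by (intro sum.cong) (auto simp: m_def)
      then show ?thesis using B by (simp add: m_def)
    qed
    have "(\<Sum>b\<in>B. m b * f b j) = (\<Sum>b\<in>B'. l b * f' b j)" for j
      unfolding sum_m f'_def
      by (simp add: right_diff_distrib sum_subtractf sum_distrib_right sum_divide_distrib mult.assoc)
    then have "\<forall>j\<in>K. (\<Sum>b\<in>B. m b * f b j) = 0" using l by simp
    moreover have "(\<Sum>b\<in>B. m b * f b k) = 0" unfolding sum_m using b0 by simp
    moreover have "\<exists>b\<in>B. m b \<noteq> 0" using l B by (auto simp: m_def)
    ultimately show ?thesis by (intro exI[of _ m]) auto
  qed
qed

lemma monoid_hom_prod: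
  fixes \<psi> :: "nat ^ 'n::finite \<Rightarrow> 'a::comm_monoid_mult"
  assumes add: "\<And>a b. \<psi> (a + b) = \<psi> a * \<psi> b" and zero: "\<psi> 0 = 1"
  shows "\<psi> m = (\<Prod>i\<in>UNIV. \<psi> (axis i 1) ^ (m $ i))"
proof -
  have sum: "\<psi> (sum h X) = (\<Prod>i\<in>X. \<psi> (h i))" for h :: "'n \<Rightarrow> _" and X
    by (induction X rule: infinite_finite_induct) (simp_all add: add zero)
  have ax: "axis i (Suc k) = axis i 1 + (axis i k :: nat ^ 'n)" for i :: 'n and k
    by (simp add: vec_eq_iff axis_def)
  have ax0: "axis i 0 = (0 :: nat ^ 'n)" for i by (simp add: vec_eq_iff axis_def)
  have pow: "\<psi> (axis i k) = \<psi> (axis i 1) ^ k" for i k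
  proof (induction k)
    case (Suc k)
    then show ?case by (simp only: ax add power_Suc)
  qed (simp add: ax0 zero)
  have "m = (\<Sum>i\<in>UNIV. axis i (m $ i))"
    by (simp add: vec_eq_iff axis_def if_distrib[of "\<lambda>f. f _"] cong: if_cong)
  then have "\<psi> m = \<psi> (\<Sum>i\<in>UNIV. axis i (m $ i))" by (rule arg_cong)
  also have "\<dots> = (\<Prod>i\<in>UNIV. \<psi> (axis i (m $ i)))" by (rule sum)
  also have "\<dots> = (\<Prod>i\<in>UNIV. \<psi> (axis i 1) ^ (m $ i))" by (rule prod.cong[OF refl pow])
  finally show ?thesis .
qed

type_synonym 'n laurent = "(int ^ 'n) \<Rightarrow>\<^sub>0 complex"

abbreviation const :: "complex \<Rightarrow> 'n::finite laurent" where
  "const c \<equiv> Poly_Mapping.single 0 c"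

definition ideal_set :: "'a::comm_ring_1 set \<Rightarrow> bool" where
  "ideal_set M \<longleftrightarrow> 0 \<in> M \<and> (\<forall>a\<in>M. \<forall>b\<in>M. a + b \<in> M) \<and> (\<forall>a\<in>M. \<forall>r. r * a \<in> M)"

lemma ideal_set_diff: "ideal_set M \<Longrightarrow> a \<in> M \<Longrightarrow> b \<in> M \<Longrightarrow> a - b \<in> M"
  unfolding ideal_set_def by (metis add_uminus_conv_diff mult_minus1)

lemma ideal_set_sum: "ideal_set M \<Longrightarrow> (\<And>i. i \<in> X \<Longrightarrow> h i \<in> M) \<Longrightarrow> sum h X \<in> M"
  by (induction X rule: infinite_finite_induct) (auto simp: ideal_set_def)

text \<open>Zorn's lemma. The last property says that the quotient by \<open>M\<close> is a field,
  without forming the quotient.\<close>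

lemma maximal_ideal_exists:
  fixes J :: "'a::comm_ring_1 set"
  assumes "ideal_set J" "1 \<notin> J"
  obtains M where "ideal_set M" "J \<subseteq> M" "1 \<notin> M" "\<And>t. t \<notin> M \<Longrightarrow> \<exists>s. s * t - 1 \<in> M"
proof -
  define \<A> where "\<A> = {M. ideal_set M \<and> J \<subseteq> M \<and> 1 \<notin> M}"
  have "\<exists>M\<in>\<A>. \<forall>X\<in>\<A>. M \<subseteq> X \<longrightarrow> X = M"
  proof (rule subset_Zorn_nonempty)
    show "\<A> \<noteq> {}" using assms by (auto simp: \<A>_def)
    fix \<C> assume C: "\<C> \<noteq> {}" "subset.chain \<A> \<C>"
    then have CA: "X \<in> \<C> \<Longrightarrow> X \<in> \<A>" for X by (auto simp: subset.chain_def)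
    have "a + b \<in> \<Union>\<C>" if ab: "a \<in> \<Union>\<C>" "b \<in> \<Union>\<C>" for a b
    proof -
      obtain X Y where XY: "X \<in> \<C>" "Y \<in> \<C>" "a \<in> X" "b \<in> Y" using ab by blast
      then have "X \<subseteq> Y \<or> Y \<subseteq> X" using C(2) by (auto simp: subset.chain_def)
      then obtain Z where "Z \<in> \<C>" "a \<in> Z" "b \<in> Z" using XY by blast
      then show ?thesis using CA[of Z] by (auto simp: \<A>_def ideal_set_def)
    qed
    moreover obtain X where "X \<in> \<C>" using C(1) by blast
    moreover have "0 \<in> X" "J \<subseteq> X" if "X \<in> \<C>" for X
      using CA[OF that] by (simp_all add: \<A>_def ideal_set_def)
    moreover have "1 \<notin> X" "\<forall>a\<in>X. \<forall>r. r * a \<in> X" if "X \<in> \<C>" for X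
      using CA[OF that] by (simp_all add: \<A>_def ideal_set_def)
    ultimately have "0 \<in> \<Union>\<C>" "J \<subseteq> \<Union>\<C>" "1 \<notin> \<Union>\<C>" "\<forall>a\<in>\<Union>\<C>. \<forall>r. r * a \<in> \<Union>\<C>"
        "\<forall>a\<in>\<Union>\<C>. \<forall>b\<in>\<Union>\<C>. a + b \<in> \<Union>\<C>"
      by blast+
    then show "\<Union>\<C> \<in> \<A>" by (simp add: \<A>_def ideal_set_def)
  qed
  then obtain M where M: "ideal_set M" "J \<subseteq> M" "1 \<notin> M"
    and max: "\<And>X. ideal_set X \<Longrightarrow> J \<subseteq> X \<Longrightarrow> 1 \<notin> X \<Longrightarrow> M \<subseteq> X \<Longrightarrow> X = M"
    by (auto simp: \<A>_def)
  have "\<exists>s. s * t - 1 \<in> M" if t: "t \<notin> M" for t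
  proof -
    define X where "X = {m + r * t | m r. m \<in> M}"
    have "ideal_set X"
      unfolding ideal_set_def
    proof (intro conjI ballI allI)
      have "0 = 0 + 0 * t" "0 \<in> M" using M(1) by (auto simp: ideal_set_def)
      then show "0 \<in> X" unfolding X_def by blast
      fix a assume "a \<in> X"
      then obtain m r where a: "a = m + r * t" "m \<in> M" by (auto simp: X_def)
      show "s * a \<in> X" for s
      proof -
        have "s * a = s * m + (s * r) * t" "s * m \<in> M"
          using a M(1) by (auto simp: ideal_set_def algebra_simps)
        then show ?thesis unfolding X_def by blast
      qed
      fix b assume "b \<in> X"
      then obtain m' r' where b: "b = m' + r' * t" "m' \<in> M" by (auto simp: X_def)
      have "a + b = (m + m') + (r + r') * t" "m + m' \<in> M"
        using a b M(1) by (auto simp: ideal_set_def algebra_simps)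
      then show "a + b \<in> X" unfolding X_def by blast
    qed
    moreover have MX: "M \<subseteq> X"
    proof
      fix m assume "m \<in> M"
      moreover have "m = m + 0 * t" by simp
      ultimately show "m \<in> X" unfolding X_def by blast
    qed
    moreover have "t \<in> X"
    proof -
      have "t = 0 + 1 * t" "0 \<in> M" using M(1) by (auto simp: ideal_set_def)
      then show ?thesis unfolding X_def by blast
    qed
    ultimately have "1 \<in> X" using max[of X] M(2) t by blast
    then obtain m r where mr: "1 = m + r * t" "m \<in> M" by (auto simp: X_def)
    then have "r * t - 1 = - 1 * m" by (simp add: algebra_simps)
    then have "r * t - 1 \<in> M" using mr(2) M(1) by (metis ideal_set_def)
    then show ?thesis ..
  qed
  then show thesis using that M by blast
qed

definition poly_at :: "'n::finite laurent \<Rightarrow> complex poly \<Rightarrow> 'n laurent" where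
  "poly_at t p = poly (map_poly const p) t"

lemma poly_at_0 [simp]: "poly_at t 0 = 0"
  by (simp add: poly_at_def)

lemma poly_at_pCons [simp]: "poly_at t (pCons a p) = const a + t * poly_at t p"
  by (simp add: poly_at_def map_poly_pCons)

lemma poly_at_1 [simp]: "poly_at t 1 = 1"
  by (simp add: one_pCons)

lemma poly_at_add: "poly_at t (p + q) = poly_at t p + poly_at t q"
  by (induction p q rule: poly_induct2) (simp_all add: single_add algebra_simps)

lemma poly_at_smult: "poly_at t (Polynomial.smult c p) = const c * poly_at t p"
  by (induction p) (simp_all add: mult_single algebra_simps)

lemma poly_at_mult: "poly_at t (p * q) = poly_at t p * poly_at t q"
  by (induction p) (simp_all add: poly_at_add poly_at_smult algebra_simps)

lemma poly_at_sum: "poly_at t (sum h X) = (\<Sum>i\<in>X. poly_at t (h i))"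
  by (induction X rule: infinite_finite_induct) (simp_all add: poly_at_add)

lemma poly_at_prod: "poly_at t (prod h X) = (\<Prod>i\<in>X. poly_at t (h i))"
  by (induction X rule: infinite_finite_induct) (simp_all add: poly_at_mult)

context
  fixes M :: "'n::finite laurent set"
  assumes M: "ideal_set M" "1 \<notin> M" and inv: "\<And>t. t \<notin> M \<Longrightarrow> \<exists>s. s * t - 1 \<in> M"
begin

lemma mem_add: "a \<in> M \<Longrightarrow> b \<in> M \<Longrightarrow> a + b \<in> M"
  using M by (simp add: ideal_set_def)

lemma mem_mult: "a \<in> M \<Longrightarrow> r * a \<in> M"
  using M by (simp add: ideal_set_def)

lemma const_mem: "const c \<in> M \<Longrightarrow> c = 0"
proof (rule ccontr)
  assume "const c \<in> M" "c \<noteq> 0"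
  then have "const (1 / c) * const c \<in> M" by (intro mem_mult)
  then show False using \<open>c \<noteq> 0\<close> M(2) by (simp add: mult_single)
qed

text \<open>The polynomial splits into linear factors over the complex numbers; as \<open>M\<close>
  behaves like a prime ideal, one of the factors evaluated at \<open>t\<close> lies in
  \<open>M\<close>.\<close>

lemma root_in_ideal:
  assumes "poly_at t q \<in> M" "q \<noteq> 0"
  shows "\<exists>c. t - const c \<in> M"
  using assms
proof (induction "degree q" arbitrary: q rule: less_induct)
  case less
  show ?case
  proof (cases "degree q = 0")
    case True
    then obtain a where "q = [:a:]" by (metis degree_eq_zeroE)
    then show ?thesis using less.prems const_mem[of a] by simp
  next
    case False
    then obtain z where "poly q z = 0"
      using fundamental_theorem_of_algebra[of q] by (auto simp: constant_degree)
    then obtain q' where q': "q = [:- z, 1:] * q'" by (auto simp: poly_eq_0_iff_dvd)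
    then have "q' \<noteq> 0" using less.prems by auto
    then have "degree q' < degree q" unfolding q' by (subst degree_mult_eq) auto
    have e: "poly_at t q = (t - const z) * poly_at t q'"
      unfolding q' poly_at_mult by (simp add: single_uminus algebra_simps)
    show ?thesis
    proof (cases "t - const z \<in> M")
      case False
      then obtain s where s: "s * (t - const z) - 1 \<in> M" using inv by blast
      have "s * poly_at t q - poly_at t q' * (s * (t - const z) - 1) \<in> M"
        by (rule ideal_set_diff[OF M(1) mem_mult[OF less.prems(1)] mem_mult[OF s]])
      then have "poly_at t q' \<in> M" by (simp add: e algebra_simps)
      then show ?thesis using less.hyps \<open>degree q' < degree q\<close> \<open>q' \<noteq> 0\<close> by blast
    qed blast
  qed
qed

text \<open>The residue field is \<open>\<complex>\<close>: as the ring has countable dimension, the inverses of \<open>t - c\<close> for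
  uncountably many \<open>c\<close> satisfy a linear relation, so \<open>t\<close> is algebraic modulo \<open>M\<close>.\<close>

lemma residue: "\<exists>c. t - const c \<in> M"
proof (rule ccontr)
  assume "\<nexists>c. t - const c \<in> M"
  then have "\<exists>s. s * (t - const c) - 1 \<in> M" for c using inv by blast
  then obtain s where s: "\<And>c. s c * (t - const c) - 1 \<in> M" by metis
  \<comment> \<open>There are uncountably many real parameters but only countably many finite sets
    of exponents, so infinitely many of the inverses have the same support \<open>K\<close>.\<close>
  have "\<exists>K. finite K \<and> infinite {r :: real. Poly_Mapping.keys (s (of_real r)) = K}"
  proof (rule ccontr)
    assume "\<not> ?thesis"
    then have "countable (\<Union>K\<in>Collect finite. {r :: real. Poly_Mapping.keys (s (of_real r)) = K})"
      by (intro countable_UN countable_Collect_finite) (auto intro: countable_finite)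
    moreover have "UNIV \<subseteq> (\<Union>K\<in>Collect finite. {r :: real. Poly_Mapping.keys (s (of_real r)) = K})"
    proof
      fix r :: real
      show "r \<in> (\<Union>K\<in>Collect finite. {r :: real. Poly_Mapping.keys (s (of_real r)) = K})"
        by (rule UN_I[of "Poly_Mapping.keys (s (of_real r))"]) simp_all
    qed
    ultimately show False using uncountable_UNIV_real countable_subset by blast
  qed
  then obtain K where K: "finite K" "infinite {r :: real. Poly_Mapping.keys (s (of_real r)) = K}" by blast
  obtain B0 where B0: "finite B0" "card B0 = Suc (card K)" "B0 \<subseteq> {r :: real. Poly_Mapping.keys (s (of_real r)) = K}"
    using infinite_arbitrarily_large[OF K(2)] by blast
  define B where "B = complex_of_real ` B0"
  have B: "finite B" "card B = Suc (card K)" using B0 by (auto simp: B_def card_image inj_on_def)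
  have BK: "Poly_Mapping.keys (s b) = K" if "b \<in> B" for b using that B0(3) by (auto simp: B_def)
  obtain l where l: "\<exists>b\<in>B. l b \<noteq> 0" "\<forall>k\<in>K. (\<Sum>b\<in>B. l b * Poly_Mapping.lookup (s b) k) = 0"
    using linear_dependence[OF K(1) B(1), of "\<lambda>b. Poly_Mapping.lookup (s b)"] B(2) by auto
  have look: "Poly_Mapping.lookup (const c * g) k = c * Poly_Mapping.lookup g k" for c k and g :: "'n laurent"
    by (simp add: mult_map_scale_conv_mult[symmetric] Poly_Mapping.map.rep_eq when_def)
  have rel: "(\<Sum>b\<in>B. const (l b) * s b) = 0"
  proof (rule poly_mapping_eqI)
    fix k
    show "Poly_Mapping.lookup (\<Sum>b\<in>B. const (l b) * s b) k = Poly_Mapping.lookup 0 k"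
    proof (cases "k \<in> K")
      case False
      then have "Poly_Mapping.lookup (s b) k = 0" if "b \<in> B" for b
        using BK[OF that] by (auto simp: in_keys_iff)
      then show ?thesis by (simp add: lookup_sum look)
    qed (use l in \<open>simp add: lookup_sum look\<close>)
  qed
  \<comment> \<open>Clearing denominators: multiplication by \<open>W\<close>, the product of all
    \<open>t - const c\<close>, turns \<open>s b\<close> into \<open>poly_at t (R b)\<close> modulo
    \<open>M\<close>, so the linear relation becomes a polynomial equation for
    \<open>t\<close>.\<close>
  define R where "R b = (\<Prod>c\<in>B - {b}. [:- c, 1:])" for b
  define q where "q = (\<Sum>b\<in>B. Polynomial.smult (l b) (R b))"
  obtain b0 where b0: "b0 \<in> B" "l b0 \<noteq> 0" using l by blast
  \<comment> \<open>As in Lagrange interpolation, only the summand of \<open>b0\<close> survives at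
    \<open>b0\<close>, which shows that \<open>q\<close> is not the zero polynomial.\<close>
  have van: "poly (Polynomial.smult (l b) (R b)) b0 = 0" if "b \<in> B" "b \<noteq> b0" for b
    using b0 B that by (auto simp: R_def poly_prod)
  then have "poly q b0 = l b0 * poly (R b0) b0"
    unfolding q_def poly_sum using b0 B
    by (subst sum.remove[of _ b0]) (auto intro!: sum.neutral simp del: poly_smult simp: van, simp)
  moreover have "poly (R b0) b0 \<noteq> 0" using B by (auto simp: R_def poly_prod)
  ultimately have "q \<noteq> 0" using b0 by auto
  define W where "W = (\<Prod>c\<in>B. t - const c)"
  have RW: "s b * W - poly_at t (R b) \<in> M" if "b \<in> B" for b
  proof -
    have "poly_at t (R b) = (\<Prod>c\<in>B - {b}. t - const c)"
      by (simp add: R_def poly_at_prod single_uminus)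
    then have "W = (t - const b) * poly_at t (R b)"
      using that B by (simp add: W_def prod.remove)
    then have "s b * W - poly_at t (R b) = poly_at t (R b) * (s b * (t - const b) - 1)"
      by (simp only:) (simp add: algebra_simps)
    then show ?thesis using s mem_mult by simp
  qed
  have "(\<Sum>b\<in>B. const (l b) * (s b * W - poly_at t (R b))) \<in> M"
    by (intro ideal_set_sum[OF M(1)] mem_mult RW)
  also have "(\<Sum>b\<in>B. const (l b) * (s b * W - poly_at t (R b))) = (\<Sum>b\<in>B. const (l b) * s b) * W - poly_at t q"
    by (simp add: q_def poly_at_sum poly_at_smult right_diff_distrib sum_subtractf sum_distrib_right mult.assoc)
  finally have "- poly_at t q \<in> M" using rel by simp
  then have "poly_at t q \<in> M" using mem_mult[of "- poly_at t q" "- 1"] by simp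
  from root_in_ideal[OF this \<open>q \<noteq> 0\<close>] show False using \<open>\<nexists>c. t - const c \<in> M\<close> by blast
qed

end

definition laurent_exp :: "nat ^ 'n \<Rightarrow> int ^ 'n" where
  "laurent_exp m = (\<chi> i. int (m $ i))"

definition laurent_of :: "'n::finite cpoly \<Rightarrow> 'n laurent" where
  "laurent_of g = (\<Sum>m\<in>Poly_Mapping.keys g. Poly_Mapping.single (laurent_exp m) (Poly_Mapping.lookup g m))"

text \<open>If the ideal were proper, reduction modulo a maximal ideal above it would be a ring
  homomorphism to the complex numbers, that is, evaluation at a point. Its coordinates are nonzero
  because the variables are units in the Laurent ring.\<close>

theorem torus_nullstellensatz:
  fixes G :: "'i \<Rightarrow> 'n::finite cpoly"
  assumes A: "finite A" and no_zero: "\<nexists>x. (\<forall>i. x $ i \<noteq> 0) \<and> (\<forall>k\<in>A. eval_cpoly (G k) x = 0)"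
  shows "\<exists>h. (\<Sum>k\<in>A. laurent_of (G k) * h k) = 1"
proof (rule ccontr)
  assume no: "\<nexists>h. (\<Sum>k\<in>A. laurent_of (G k) * h k) = 1"
  define J where "J = range (\<lambda>h. \<Sum>k\<in>A. laurent_of (G k) * h k)"
  have JI: "(\<Sum>k\<in>A. laurent_of (G k) * h k) \<in> J" for h by (simp add: J_def)
  have "ideal_set J"
    unfolding ideal_set_def
  proof (intro conjI ballI allI)
    show "0 \<in> J" using JI[of "\<lambda>_. 0"] by simp
    fix a assume "a \<in> J"
    then obtain h where a: "a = (\<Sum>k\<in>A. laurent_of (G k) * h k)" by (auto simp: J_def)
    show "r * a \<in> J" for r
    proof -
      have "r * a = (\<Sum>k\<in>A. laurent_of (G k) * (r * h k))" unfolding a by (simp add: sum_distrib_left ac_simps)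
      then show ?thesis using JI[of "\<lambda>k. r * h k"] by simp
    qed
    fix b assume "b \<in> J"
    then obtain h' where b: "b = (\<Sum>k\<in>A. laurent_of (G k) * h' k)" by (auto simp: J_def)
    have "a + b = (\<Sum>k\<in>A. laurent_of (G k) * (h k + h' k))" unfolding a b by (simp add: distrib_left sum.distrib)
    then show "a + b \<in> J" using JI[of "\<lambda>k. h k + h' k"] by simp
  qed
  moreover have "1 \<notin> J" using no by (auto simp: J_def)
  ultimately obtain M where M: "ideal_set M" "J \<subseteq> M" "1 \<notin> M" "\<And>t. t \<notin> M \<Longrightarrow> \<exists>s. s * t - 1 \<in> M"
    using maximal_ideal_exists by blast
  obtain \<phi> where \<phi>: "\<And>t. t - const (\<phi> t) \<in> M" using residue[OF M(1,3,4)] by metis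
  have \<phi>_eq: "\<phi> t = c" if "t - const c \<in> M" for t c
  proof -
    have "(t - const c) - (t - const (\<phi> t)) \<in> M" using that \<phi> by (rule ideal_set_diff[OF M(1)])
    then have "const (\<phi> t - c) \<in> M" by (simp add: single_diff)
    then show ?thesis using const_mem[OF M(1,3,4)] by fastforce
  qed
  have \<phi>_mult: "\<phi> (a * b) = \<phi> a * \<phi> b" for a b
  proof (rule \<phi>_eq)
    have "b * (a - const (\<phi> a)) + const (\<phi> a) * (b - const (\<phi> b)) \<in> M"
      by (intro mem_add[OF M(1,3,4)] mem_mult[OF M(1,3,4)] \<phi>)
    then show "a * b - const (\<phi> a * \<phi> b) \<in> M" by (simp add: algebra_simps mult_single)
  qed
  have \<phi>_add: "\<phi> (a + b) = \<phi> a + \<phi> b" for a b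
  proof (rule \<phi>_eq)
    have "(a - const (\<phi> a)) + (b - const (\<phi> b)) \<in> M" by (intro mem_add[OF M(1,3,4)] \<phi>)
    then show "a + b - const (\<phi> a + \<phi> b) \<in> M" by (simp add: algebra_simps single_add)
  qed
  have zM: "0 \<in> M" using M(1) by (simp add: ideal_set_def)
  have \<phi>_const: "\<phi> (const c) = c" for c by (rule \<phi>_eq) (simp add: zM)
  have \<phi>_0: "\<phi> 0 = 0" and \<phi>_1: "\<phi> 1 = 1" using \<phi>_const[of 0] \<phi>_const[of 1] by simp_all
  have \<phi>_sum: "\<phi> (sum h X) = (\<Sum>i\<in>X. \<phi> (h i))" for h :: "nat ^ 'n \<Rightarrow> _" and X
    by (induction X rule: infinite_finite_induct) (simp_all add: \<phi>_add \<phi>_0)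
  define \<psi> where "\<psi> m = \<phi> (Poly_Mapping.single (laurent_exp m) 1)" for m :: "nat ^ 'n"
  have exp_add: "laurent_exp (a + b) = laurent_exp a + laurent_exp b" for a b :: "nat ^ 'n"
    by (simp add: laurent_exp_def vec_eq_iff)
  have exp_0: "laurent_exp (0 :: nat ^ 'n) = 0" by (simp add: laurent_exp_def vec_eq_iff)
  have \<psi>_add: "\<psi> (a + b) = \<psi> a * \<psi> b" for a b
    by (simp add: \<psi>_def exp_add \<phi>_mult[symmetric] mult_single)
  have \<psi>_0: "\<psi> 0 = 1" by (simp add: \<psi>_def exp_0 \<phi>_1)
  define x :: "complex ^ 'n" where "x = (\<chi> i. \<psi> (axis i 1))"
  have "x $ i \<noteq> 0" for i
  proof
    assume "x $ i = 0"
    moreover have "Poly_Mapping.single (laurent_exp (axis i 1)) 1 * Poly_Mapping.single (- laurent_exp (axis i 1)) 1 = (1 :: 'n laurent)"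
      by (simp add: mult_single)
    from arg_cong[OF this, of \<phi>] have "x $ i * \<phi> (Poly_Mapping.single (- laurent_exp (axis i 1)) 1) = 1"
      by (simp add: \<phi>_mult \<phi>_1 x_def \<psi>_def)
    ultimately show False by simp
  qed
  moreover have "eval_cpoly (G k) x = 0" if k: "k \<in> A" for k
  proof -
    have single: "\<phi> (Poly_Mapping.single (laurent_exp m) c) = c * (\<Prod>i\<in>UNIV. (x $ i) ^ (m $ i))" for m c
    proof -
      have "Poly_Mapping.single (laurent_exp m) c = const c * Poly_Mapping.single (laurent_exp m) 1"
        by (simp add: mult_single)
      then have "\<phi> (Poly_Mapping.single (laurent_exp m) c) = c * \<psi> m"
        by (simp only: \<phi>_mult \<phi>_const \<psi>_def)
      then show ?thesis using monoid_hom_prod[of \<psi> m, OF \<psi>_add \<psi>_0] by (simp add: x_def)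
    qed
    have "\<phi> (laurent_of (G k)) = eval_cpoly (G k) x"
      by (simp add: laurent_of_def \<phi>_sum single eval_cpoly_def)
    moreover have "(\<Sum>j\<in>A. laurent_of (G j) * of_bool (j = k)) = laurent_of (G k)"
      using k A by (simp add: of_bool_def if_distrib cong: if_cong)
    then have "laurent_of (G k) \<in> J"
      using JI[of "\<lambda>j. of_bool (j = k)"] by simp
    then have "laurent_of (G k) \<in> M" using M(2) by blast
    then have "\<phi> (laurent_of (G k)) = 0" by (intro \<phi>_eq) simp
    ultimately show ?thesis by simp
  qed
  ultimately show False using no_zero by blast
qed

section \<open>Acyclicity of the leading forms\<close>

lemma log_partial_eq:
  "log_partial i f = (\<Sum>m\<in>Poly_Mapping.keys f. Poly_Mapping.single m (of_nat (m $ i) * Poly_Mapping.lookup f m))"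
proof -
  have "Poly_Mapping.single (axis i 1) 1 * Poly_Mapping.single (m - axis i 1) (of_nat (m $ i) * Poly_Mapping.lookup f m) =
      Poly_Mapping.single m (of_nat (m $ i) * Poly_Mapping.lookup f m)" for m
  proof (cases "m $ i = 0")
    case False
    then have "axis i 1 + (m - axis i 1) = m" by (simp add: vec_eq_iff axis_def)
    then show ?thesis by (simp add: mult_single)
  qed simp
  then show ?thesis by (simp add: log_partial_def partial_def var_def sum_distrib_left)
qed

lemma lookup_log_partial: "Poly_Mapping.lookup (log_partial i f) m = of_nat (m $ i) * Poly_Mapping.lookup f m"
proof -
  have "Poly_Mapping.lookup (log_partial i f) m =
      (\<Sum>k\<in>Poly_Mapping.keys f. if k = m then of_nat (m $ i) * Poly_Mapping.lookup f m else 0)"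
    unfolding log_partial_eq lookup_sum by (intro sum.cong) (auto simp: lookup_single when_def)
  then show ?thesis by (auto simp: in_keys_iff)
qed

lemma keys_log_partial: "Poly_Mapping.keys (log_partial i f) \<subseteq> Poly_Mapping.keys f"
  by (auto simp: in_keys_iff lookup_log_partial)

lemma restrict_to_eq: "restrict_to D g = pm_filter (\<lambda>m. exp_point m \<in> D) g"
  by (simp add: restrict_to_def pm_filter_def)

section \<open>Ideals and nilpotency in the graded ring\<close>

context subadditive
begin

definition gideal :: "'i set \<Rightarrow> ('i \<Rightarrow> 'a \<Rightarrow>\<^sub>0 complex) \<Rightarrow> ('a \<Rightarrow>\<^sub>0 complex) set" where
  "gideal X G = range (\<lambda>h. \<Sum>i\<in>X. gmul (G i) (h i))"

lemma gidealI: "g = (\<Sum>i\<in>X. gmul (G i) (h i)) \<Longrightarrow> g \<in> gideal X G"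
  by (simp add: gideal_def)

lemma gideal_add:
  assumes "g \<in> gideal X G" "g' \<in> gideal X G"
  shows "g + g' \<in> gideal X G"
proof -
  obtain h h' where "g = (\<Sum>i\<in>X. gmul (G i) (h i))" "g' = (\<Sum>i\<in>X. gmul (G i) (h' i))"
    using assms by (auto simp: gideal_def)
  then show ?thesis by (intro gidealI[where h = "\<lambda>i. h i + h' i"]) (simp add: gmul_add_right sum.distrib)
qed

lemma gideal_gmul:
  assumes "g \<in> gideal X G"
  shows "gmul a g \<in> gideal X G"
proof -
  obtain h where "g = (\<Sum>i\<in>X. gmul (G i) (h i))" using assms by (auto simp: gideal_def)
  then show ?thesis
    by (intro gidealI[where h = "\<lambda>i. gmul a (h i)"]) (simp add: gmul_sum_right gmul_left_commute)
qed

lemma gideal_funpow: "g \<in> gideal X G \<Longrightarrow> (gmul a ^^ k) g \<in> gideal X G"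
  by (induction k) (simp_all add: gideal_gmul)

lemma funpow_gmul_commute: "(gmul a ^^ k) (gmul b h) = gmul b ((gmul a ^^ k) h)"
  by (induction k) (simp_all add: gmul_left_commute)

lemma funpow_gmul_one: "(gmul a ^^ k) h = gmul ((gmul a ^^ k) (Poly_Mapping.single 0 1)) h"
proof (induction k)
  case 0
  then show ?case by (simp add: gmul_one del: single_one)
next
  case (Suc k)
  then show ?case by (simp add: gmul_assoc del: single_one)
qed

text \<open>Nilpotency modulo an ideal. Since \<open>gmul\<close> is not the multiplication of the
  type, powers are iterates of an operator, as in \<open>acyclic_at_transfer\<close>.\<close>

definition gnilpotent :: "'i set \<Rightarrow> ('i \<Rightarrow> 'a \<Rightarrow>\<^sub>0 complex) \<Rightarrow> ('a \<Rightarrow>\<^sub>0 complex) \<Rightarrow> bool" where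
  "gnilpotent X G g \<longleftrightarrow> (\<exists>n. \<forall>h. (gmul g ^^ n) h \<in> gideal X G)"

lemma gnilpotent_ideal:
  assumes "g \<in> gideal X G"
  shows "gnilpotent X G g"
  unfolding gnilpotent_def
  using gideal_gmul[OF assms] by (intro exI[of _ 1]) (simp add: gmul_commute[of g])

lemma gnilpotent_gmul:
  assumes "gnilpotent X G g"
  shows "gnilpotent X G (gmul a g)"
proof -
  have "(gmul (gmul a g) ^^ n) h = (gmul g ^^ n) ((gmul a ^^ n) h)" for n h
  proof (induction n)
    case (Suc n)
    then show ?case by (simp add: gmul_assoc gmul_left_commute[of a g] funpow_gmul_commute)
  qed simp
  note eq = this
  obtain n where "\<And>h. (gmul g ^^ n) h \<in> gideal X G" using assms by (auto simp: gnilpotent_def)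
  then show ?thesis unfolding gnilpotent_def by (intro exI[of _ n]) (simp add: eq)
qed

text \<open>The binomial expansion without its coefficients: factors \<open>g + g'\<close> are
  distributed one at a time, and once \<open>n + n'\<close> of them are used up one of the two
  exponents is large enough.\<close>

lemma gnilpotent_add:
  assumes "gnilpotent X G g" "gnilpotent X G g'"
  shows "gnilpotent X G (g + g')"
proof -
  obtain n n' where n: "\<And>h. (gmul g ^^ n) h \<in> gideal X G" "\<And>h. (gmul g' ^^ n') h \<in> gideal X G"
    using assms by (auto simp: gnilpotent_def)
  have "(gmul g ^^ a) ((gmul g' ^^ b) ((gmul (g + g') ^^ c) h)) \<in> gideal X G" if "n + n' \<le> a + b + c" for a b c h
    using that
  proof (induction c arbitrary: a b)
    case 0
    then consider "n \<le> a" | "n' \<le> b" by linarith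
    then show ?case
    proof cases
      case 1
      then have "gmul g ^^ a = gmul g ^^ n \<circ> gmul g ^^ (a - n)"
        using funpow_add[of n "a - n" "gmul g"] by simp
      then show ?thesis using n(1) by simp
    next
      case 2
      then have "gmul g' ^^ b = gmul g' ^^ n' \<circ> gmul g' ^^ (b - n')"
        using funpow_add[of n' "b - n'" "gmul g'"] by simp
      then show ?thesis using n(2) by (simp add: gideal_funpow)
    qed
  next
    case (Suc c)
    define Y where "Y = (gmul (g + g') ^^ c) h"
    have "(gmul g ^^ a) ((gmul g' ^^ b) ((gmul (g + g') ^^ Suc c) h)) =
        (gmul g ^^ Suc a) ((gmul g' ^^ b) Y) + (gmul g ^^ a) ((gmul g' ^^ Suc b) Y)"
    proof -
      have add: "(gmul u ^^ k) (v + v') = (gmul u ^^ k) v + (gmul u ^^ k) v'" for u k v v'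
        by (induction k) (simp_all add: gmul_add_right)
      show ?thesis by (simp add: Y_def gmul_add_left add funpow_gmul_commute)
    qed
    moreover have "(gmul g ^^ Suc a) ((gmul g' ^^ b) Y) \<in> gideal X G"
        "(gmul g ^^ a) ((gmul g' ^^ Suc b) Y) \<in> gideal X G"
      using Suc.IH[of "Suc a" b] Suc.IH[of a "Suc b"] Suc.prems by (simp_all add: Y_def)
    ultimately show ?case by (simp add: gideal_add)
  qed
  from this[of 0 0 "n + n'"] show ?thesis by (auto simp: gnilpotent_def)
qed

lemma gnilpotent_sum:
  assumes "\<And>i. i \<in> Y \<Longrightarrow> gnilpotent X G (g i)"
  shows "gnilpotent X G (sum g Y)"
  using assms
proof (induction Y rule: infinite_finite_induct)
  case (infinite Y)
  have "0 \<in> gideal X G" by (rule gidealI[where h = "\<lambda>_. 0"]) simp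
  then show ?case using infinite by (simp add: gnilpotent_ideal)
next
  case empty
  have "0 \<in> gideal X G" by (rule gidealI[where h = "\<lambda>_. 0"]) simp
  then show ?case by (simp add: gnilpotent_ideal)
qed (simp add: gnilpotent_add)

lemma gnilpotent_funpow:
  assumes "gnilpotent X G ((gmul g ^^ k) (Poly_Mapping.single 0 1))"
  shows "gnilpotent X G g"
proof -
  have eq: "gmul ((gmul g ^^ k) (Poly_Mapping.single 0 1)) = gmul g ^^ k"
    by (rule ext) (rule funpow_gmul_one[symmetric])
  obtain n where n: "\<And>h. (gmul ((gmul g ^^ k) (Poly_Mapping.single 0 1)) ^^ n) h \<in> gideal X G"
    using assms unfolding gnilpotent_def by blast
  have "(gmul g ^^ (k * n)) h \<in> gideal X G" for h
    using n[of h] unfolding eq funpow_mult by (simp only: mult.commute)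
  then show ?thesis unfolding gnilpotent_def by blast
qed

end

section \<open>Leading forms and Laurent relations on a face\<close>

context convenient_poly
begin

definition lead :: "'n \<Rightarrow> 'n cpoly" where
  "lead i = pm_filter (\<lambda>m. nu m = 1) (log_partial i f)"

lemma lead_eq: "lead i = (\<Sum>m\<in>V. Poly_Mapping.single m (of_nat (m $ i) * Poly_Mapping.lookup f m))"
proof -
  have "lead i = (\<Sum>m\<in>V. Poly_Mapping.single m (Poly_Mapping.lookup (lead i) m))"
    using keys_log_partial[of i f]
    by (intro poly_mapping_eq_sum_single finite_V) (auto simp: lead_def keys_pm_filter V_def nu_def)
  also have "\<dots> = (\<Sum>m\<in>V. Poly_Mapping.single m (of_nat (m $ i) * Poly_Mapping.lookup f m))"
    by (intro sum.cong) (auto simp: lead_def lookup_pm_filter lookup_log_partial V_def nu_def)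
  finally show ?thesis .
qed

lemma nu_V: "m \<in> V \<Longrightarrow> nu m = 1"
  by (simp add: V_def nu_def)

lemma nu_lead: "a \<in> Poly_Mapping.keys (lead i) \<Longrightarrow> nu a = 1"
  by (simp add: lead_def keys_pm_filter)

definition scale :: "nat \<Rightarrow> nat ^ 'n \<Rightarrow> nat ^ 'n" where
  "scale k x = (\<chi> i. k * x $ i)"

lemma exp_point_scale: "exp_point (scale k x) = real k *\<^sub>R exp_point x"
  by (simp add: scale_def exp_point_def vec_eq_iff)

lemma nu_scale: "nu (scale k x) = real k * nu x"
  by (simp add: nu_def exp_point_scale height_scale)

text \<open>Powers of a monomial never vanish in the graded ring, because \<open>nu\<close> is
  homogeneous along a ray.\<close>

lemma funpow_single: "(gmul (Poly_Mapping.single x 1) ^^ k) (Poly_Mapping.single 0 1) = Poly_Mapping.single (scale k x) 1"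
proof (induction k)
  case 0
  have "scale 0 x = 0" by (simp add: scale_def vec_eq_iff)
  then show ?case by simp
next
  case (Suc k)
  have s: "x + scale k x = scale (Suc k) x" by (simp add: scale_def vec_eq_iff)
  then have "nu (x + scale k x) = nu x + nu (scale k x)"
    by (simp add: s nu_scale algebra_simps)
  then show ?case using Suc s by (simp add: gmul_single del: single_one)
qed

text \<open>Together with \<open>vanishing\<close>, this records the face of the fan and the
  coordinate face in whose relative interior \<open>x\<close> lies; the sum of the two cardinalities
  drops when passing to the interior of larger ones.\<close>

definition active :: "nat ^ 'n \<Rightarrow> (real ^ 'n) set" where
  "active x = {u\<in>U. u \<bullet> exp_point x = nu x}"

definition vanishing :: "nat ^ 'n \<Rightarrow> 'n set" where
  "vanishing x = {i. x $ i = 0}"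

text \<open>Each functional is bounded by \<open>nu\<close> on both summands, so it can attain the
  sum only by attaining both.\<close>

lemma active_add:
  assumes "nu (x + z) = nu x + nu z"
  shows "active (x + z) = active x \<inter> active z"
proof -
  have "u \<bullet> exp_point x \<le> nu x" "u \<bullet> exp_point z \<le> nu z" if "u \<in> U" for u
    using height_U_ge[OF that] by (auto simp: nu_def)
  note le = this
  show ?thesis
  proof (intro equalityI subsetI)
    fix u assume "u \<in> active (x + z)"
    then have u: "u \<in> U" "u \<bullet> exp_point x + u \<bullet> exp_point z = nu x + nu z"
      by (simp_all add: active_def assms exp_point_add inner_add_right)
    then show "u \<in> active x \<inter> active z"
      using le[OF u(1)] by (simp add: active_def)
  next
    fix u assume "u \<in> active x \<inter> active z"
    then show "u \<in> active (x + z)"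
      by (simp add: active_def assms exp_point_add inner_add_right)
  qed
qed

lemma eventually_large: "c > 0 \<Longrightarrow> eventually (\<lambda>k. d < real k * c) sequentially"
proof -
  assume c: "c > 0"
  have "eventually (\<lambda>k. d / c < real k) sequentially"
    using filterlim_real_sequentially by (simp add: filterlim_at_top_dense)
  then show ?thesis by eventually_elim (use c in \<open>simp add: field_simps\<close>)
qed

text \<open>The directions in which a large multiple of \<open>x\<close> can be moved without leaving the relative interior
  of its cone.\<close>

definition face_lattice :: "nat ^ 'n \<Rightarrow> int ^ 'n \<Rightarrow> bool" where
  "face_lattice x b \<longleftrightarrow> (\<forall>u\<in>active x. \<forall>u'\<in>active x. u \<bullet> (\<chi> i. real_of_int (b $ i)) = u' \<bullet> (\<chi> i. real_of_int (b $ i))) \<and>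
     (\<forall>i\<in>vanishing x. b $ i = 0)"

text \<open>The conversion to natural numbers cuts off negative coordinates; for the large
  \<open>k\<close> used later there are none.\<close>

definition translate :: "nat \<Rightarrow> nat ^ 'n \<Rightarrow> int ^ 'n \<Rightarrow> nat ^ 'n" where
  "translate k x b = (\<chi> i. nat (int (k * x $ i) + b $ i))"

text \<open>The inequalities that are strict at \<open>x\<close> hold for a large multiple of
  \<open>x\<close> with any fixed perturbation, and membership in the face lattice preserves the
  equalities.\<close>

lemma translate_eventually:
  assumes b: "face_lattice x b"
  shows "eventually (\<lambda>k. (\<forall>i. 0 \<le> int (k * x $ i) + b $ i) \<and> active (translate k x b) = active x \<and>
    vanishing (translate k x b) = vanishing x) sequentially"
proof -
  define bb :: "real ^ 'n" where "bb = (\<chi> i. real_of_int (b $ i))"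
  obtain u0 where u0: "u0 \<in> active x" using height_U_attained[of "exp_point x"] by (auto simp: active_def nu_def)
  have 1: "eventually (\<lambda>k. \<forall>i\<in>- vanishing x. - real_of_int (b $ i) < real k * real (x $ i)) sequentially"
    by (intro eventually_ball_finite ballI eventually_large) (auto simp: vanishing_def)
  have 2: "eventually (\<lambda>k. \<forall>u\<in>U - active x. u \<bullet> bb - u0 \<bullet> bb < real k * (nu x - u \<bullet> exp_point x)) sequentially"
  proof (intro eventually_ball_finite ballI eventually_large)
    fix u assume "u \<in> U - active x"
    then show "0 < nu x - u \<bullet> exp_point x"
      using height_U_ge[of u "exp_point x"] by (auto simp: active_def nu_def)
  qed (use finite_U in simp)
  from 1 2 show ?thesis
  proof eventually_elim
    case (elim k)
    have pos: "0 < int (k * x $ i) + b $ i" if "i \<notin> vanishing x" for i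
    proof -
      have "- real_of_int (b $ i) < real k * real (x $ i)" using elim(1) that by blast
      then have "0 < real_of_int (int (k * x $ i) + b $ i)" by simp
      then show ?thesis by linarith
    qed
    have van: "int (k * x $ i) + b $ i = 0" if "i \<in> vanishing x" for i
      using b that by (auto simp: face_lattice_def vanishing_def)
    have nn: "0 \<le> int (k * x $ i) + b $ i" for i
      using pos[of i] van[of i] by (cases "i \<in> vanishing x") auto
    define t where "t = translate k x b"
    have et: "exp_point t = real k *\<^sub>R exp_point x + bb"
      using nn by (simp add: t_def translate_def exp_point_def vec_eq_iff bb_def)
    have ua: "u \<bullet> exp_point t = real k * nu x + u0 \<bullet> bb" if "u \<in> active x" for u
    proof -
      have "u \<bullet> bb = u0 \<bullet> bb" using b that u0 unfolding face_lattice_def bb_def by blast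
      moreover have "u \<bullet> exp_point x = nu x" using that by (simp add: active_def)
      ultimately show ?thesis unfolding et by (simp add: inner_add_right)
    qed
    have un: "u \<bullet> exp_point t < real k * nu x + u0 \<bullet> bb" if "u \<in> U - active x" for u
      using elim(2) that unfolding et by (auto simp: inner_add_right algebra_simps)
    have nt: "nu t = real k * nu x + u0 \<bullet> bb"
    proof (rule antisym)
      show "nu t \<le> real k * nu x + u0 \<bullet> bb"
        unfolding nu_def[of t]
      proof (rule height_leI)
        fix u assume "u \<in> U"
        then show "u \<bullet> exp_point t \<le> real k * nu x + u0 \<bullet> bb"
          using ua[of u] un[of u] by (cases "u \<in> active x") auto
      qed
      show "real k * nu x + u0 \<bullet> bb \<le> nu t"
        using ua[OF u0] height_U_ge[of u0 "exp_point t"] u0 by (simp add: active_def nu_def)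
    qed
    have "active t = active x"
    proof
      show "active t \<subseteq> active x"
        using un nt by (fastforce simp: active_def[of t])
      show "active x \<subseteq> active t"
        using ua nt by (auto simp: active_def)
    qed
    moreover have "vanishing t = vanishing x"
    proof -
      have "t $ i = 0 \<longleftrightarrow> i \<in> vanishing x" for i
        using pos[of i] van[of i] by (cases "i \<in> vanishing x") (auto simp: t_def translate_def)
      then show ?thesis by (simp add: vanishing_def)
    qed
    ultimately show ?case using nn by (simp add: t_def)
  qed
qed

lemma face_lattice_vanishing: "face_lattice x b \<Longrightarrow> i \<in> vanishing x \<Longrightarrow> b $ i = 0"
  unfolding face_lattice_def by blast

lemma face_lattice_zero: "face_lattice x 0"
  by (simp add: face_lattice_def inner_vec_def)

lemma face_lattice_minus:
  assumes "face_lattice x b" "face_lattice x c"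
  shows "face_lattice x (b - c)"
proof -
  have e: "(\<chi> i. real_of_int ((b - c) $ i)) = (\<chi> i. real_of_int (b $ i)) - (\<chi> i. real_of_int (c $ i))"
    by (simp add: vec_eq_iff)
  have "(\<forall>u\<in>active x. \<forall>u'\<in>active x. u \<bullet> (\<chi> i. real_of_int ((b - c) $ i)) = u' \<bullet> (\<chi> i. real_of_int ((b - c) $ i)))"
  proof (intro ballI)
    fix u u' assume uu: "u \<in> active x" "u' \<in> active x"
    have "u \<bullet> (\<chi> i. real_of_int (b $ i)) = u' \<bullet> (\<chi> i. real_of_int (b $ i))"
        "u \<bullet> (\<chi> i. real_of_int (c $ i)) = u' \<bullet> (\<chi> i. real_of_int (c $ i))"
      using assms uu unfolding face_lattice_def by blast+
    then show "u \<bullet> (\<chi> i. real_of_int ((b - c) $ i)) = u' \<bullet> (\<chi> i. real_of_int ((b - c) $ i))"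
      unfolding e inner_diff_right by simp
  qed
  moreover have "\<forall>i\<in>vanishing x. (b - c) $ i = 0"
    using face_lattice_vanishing assms by simp
  ultimately show ?thesis unfolding face_lattice_def by blast
qed

lemma face_lattice_add_iff:
  assumes "face_lattice x a"
  shows "face_lattice x (a + b) \<longleftrightarrow> face_lattice x b"
proof
  assume "face_lattice x (a + b)"
  from face_lattice_minus[OF this assms] show "face_lattice x b" by simp
next
  assume "face_lattice x b"
  from face_lattice_minus[OF assms face_lattice_minus[OF face_lattice_zero this]]
  show "face_lattice x (a + b)" by simp
qed

lemma face_lattice_V:
  assumes "m \<in> Poly_Mapping.keys f" "exp_point m \<in> carrier_face (exp_point x)"
  shows "face_lattice x (laurent_exp m)"
proof -
  have e: "(\<chi> i. real_of_int (laurent_exp m $ i)) = exp_point m"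
    by (simp add: laurent_exp_def exp_point_def)
  have "u \<bullet> exp_point m = 1" if "u \<in> active x" for u
  proof -
    have "u \<in> U" "u \<bullet> exp_point x = height U (exp_point x)" using that by (simp_all add: active_def nu_def)
    then show ?thesis using assms(2) unfolding carrier_face_def by blast
  qed
  moreover have "m $ i = 0" if "x $ i = 0" for i
  proof -
    have "exp_point m $ i = 0" using assms(2) that by (simp add: carrier_face_def exp_point_def[of x])
    then show ?thesis by (simp add: exp_point_def)
  qed
  ultimately have "(\<forall>u\<in>active x. \<forall>u'\<in>active x. u \<bullet> exp_point m = u' \<bullet> exp_point m) \<and>
      (\<forall>i\<in>vanishing x. laurent_exp m $ i = 0)"
    by (simp add: vanishing_def laurent_exp_def)
  then show ?thesis unfolding face_lattice_def e .
qed

end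

lemma mult_single_sum:
  "(\<Sum>m\<in>M. Poly_Mapping.single (e m) (c m)) * h =
    (\<Sum>m\<in>M. \<Sum>b\<in>Poly_Mapping.keys h. Poly_Mapping.single (e m + b) (c m * Poly_Mapping.lookup h b))"
  for h :: "'a::comm_monoid_add \<Rightarrow>\<^sub>0 complex"
proof -
  have "h = (\<Sum>b\<in>Poly_Mapping.keys h. Poly_Mapping.single b (Poly_Mapping.lookup h b))"
    by (rule poly_mapping_eq_sum_single) auto
  then have "(\<Sum>m\<in>M. Poly_Mapping.single (e m) (c m)) * h =
      (\<Sum>m\<in>M. Poly_Mapping.single (e m) (c m)) * (\<Sum>b\<in>Poly_Mapping.keys h. Poly_Mapping.single b (Poly_Mapping.lookup h b))"
    by (rule arg_cong)
  then show ?thesis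
    by (simp only: sum_distrib_left sum_distrib_right mult_single sum.swap[of _ "Poly_Mapping.keys h"])
qed

lemma pm_filter_mult_subgroup:
  fixes g h :: "'a::cancel_comm_monoid_add \<Rightarrow>\<^sub>0 complex"
  assumes "\<And>a b. a \<in> Poly_Mapping.keys g \<Longrightarrow> Q (a + b) \<longleftrightarrow> Q b"
  shows "pm_filter Q (g * h) = g * pm_filter Q h"
proof -
  have 1: "pm_filter Q (Poly_Mapping.single a c * h) = Poly_Mapping.single a c * pm_filter Q h"
    if "\<And>b. Q (a + b) \<longleftrightarrow> Q b" for a c
    by (rule additive_ext[of "\<lambda>h. pm_filter Q (Poly_Mapping.single a c * h)"])
      (simp_all add: pm_filter_add distrib_left mult_single pm_filter_single that)
  define G where "G a = Poly_Mapping.single a (Poly_Mapping.lookup g a)" for a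
  have g: "g = (\<Sum>a\<in>Poly_Mapping.keys g. G a)"
    unfolding G_def by (rule poly_mapping_eq_sum_single) auto
  have "pm_filter Q (g * h) = pm_filter Q (\<Sum>a\<in>Poly_Mapping.keys g. G a * h)"
    by (subst g) (simp only: sum_distrib_right)
  also have "\<dots> = (\<Sum>a\<in>Poly_Mapping.keys g. pm_filter Q (G a * h))"
    by (rule additive_sum) (rule pm_filter_add)
  also have "\<dots> = (\<Sum>a\<in>Poly_Mapping.keys g. G a * pm_filter Q h)"
    unfolding G_def by (intro sum.cong refl 1 assms)
  also have "\<dots> = g * pm_filter Q h" by (simp only: sum_distrib_right[symmetric] g[symmetric])
  finally show ?thesis .
qed

context convenient_poly
begin

definition on_face :: "nat ^ 'n \<Rightarrow> (nat ^ 'n) set" where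
  "on_face x = {m\<in>Poly_Mapping.keys f. exp_point m \<in> carrier_face (exp_point x)}"

lemma on_face_V: "m \<in> on_face x \<Longrightarrow> m \<in> V"
proof -
  assume m: "m \<in> on_face x"
  obtain u where u: "u \<in> U" "u \<bullet> exp_point x = height U (exp_point x)"
    using height_U_attained by blast
  then have "u \<bullet> exp_point m = 1" using m by (auto simp: on_face_def carrier_face_def)
  then have "1 \<le> nu m" using height_U_ge[OF u(1), of "exp_point m"] by (simp add: nu_def)
  then show "m \<in> V" using m nu_keys_le[of m] by (auto simp: on_face_def V_def nu_def)
qed

text \<open>The Nullstellensatz is applied to the carrier face of \<open>x\<close>. The restricted
  forms and the constant 1 are supported in the subgroup \<open>face_lattice x\<close>, so
  projecting the cofactors to that subgroup keeps the relation.\<close>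

lemma laurent_relation:
  assumes nd: "nondegenerate f" and x: "x \<noteq> 0"
  obtains h where
    "(\<Sum>i\<in>UNIV. (\<Sum>m\<in>on_face x. Poly_Mapping.single (laurent_exp m) (of_nat (m $ i) * Poly_Mapping.lookup f m)) * h i) = 1"
    "\<And>i b. b \<in> Poly_Mapping.keys (h i) \<Longrightarrow> face_lattice x b"
proof -
  define D where "D = carrier_face (exp_point x)"
  define G where "G i = restrict_to D (log_partial i f)" for i
  have "exp_point x \<noteq> 0" using x by (auto simp: exp_point_def vec_eq_iff)
  then have "D \<in> boundary_faces P"
    unfolding D_def by (intro carrier_face_boundary exp_point_nonneg)
  then have "\<nexists>x. (\<forall>i. x $ i \<noteq> 0) \<and> (\<forall>k\<in>UNIV. eval_cpoly (G k) x = 0)"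
    using nd by (simp add: nondegenerate_def P_def G_def)
  from torus_nullstellensatz[OF finite this] obtain h where h: "(\<Sum>i\<in>UNIV. laurent_of (G i) * h i) = 1" by blast
  define L where "L i = (\<Sum>m\<in>on_face x. Poly_Mapping.single (laurent_exp m) (of_nat (m $ i) * Poly_Mapping.lookup f m))" for i
  have keysG: "Poly_Mapping.keys (G i) \<subseteq> on_face x" for i
    using keys_log_partial[of i f] by (auto simp: G_def restrict_to_eq keys_pm_filter D_def on_face_def)
  have GL: "laurent_of (G i) = L i" for i
  proof -
    have "laurent_of (G i) = (\<Sum>m\<in>on_face x. Poly_Mapping.single (laurent_exp m) (Poly_Mapping.lookup (G i) m))"
      unfolding laurent_of_def using keysG[of i]
      by (intro sum.mono_neutral_left) (auto simp: on_face_def in_keys_iff)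
    also have "\<dots> = L i"
      unfolding L_def
      by (intro sum.cong refl)
        (simp add: on_face_def D_def G_def restrict_to_eq lookup_pm_filter lookup_log_partial)
    finally show ?thesis .
  qed
  have "pm_filter (face_lattice x) (laurent_of (G i) * h i) = L i * pm_filter (face_lattice x) (h i)" for i
    unfolding GL
  proof (rule pm_filter_mult_subgroup)
    fix a b assume "a \<in> Poly_Mapping.keys (L i)"
    then obtain m where "m \<in> on_face x" "a = laurent_exp m"
      using keys_sum_subset[of a "\<lambda>m. Poly_Mapping.single (laurent_exp m) (of_nat (m $ i) * Poly_Mapping.lookup f m)" "on_face x"]
      by (auto simp: L_def split: if_splits)
    then have "face_lattice x a" using face_lattice_V by (simp add: on_face_def)
    then show "face_lattice x (a + b) \<longleftrightarrow> face_lattice x b" by (rule face_lattice_add_iff)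
  qed
  then have "(\<Sum>i\<in>UNIV. L i * pm_filter (face_lattice x) (h i)) =
      (\<Sum>i\<in>UNIV. pm_filter (face_lattice x) (laurent_of (G i) * h i))" by simp
  also have "\<dots> = pm_filter (face_lattice x) (\<Sum>i\<in>UNIV. laurent_of (G i) * h i)"
    by (rule additive_sum[symmetric]) (rule pm_filter_add)
  also have "\<dots> = pm_filter (face_lattice x) 1" by (simp only: h)
  also have "\<dots> = 1"
    using pm_filter_single[of "face_lattice x" 0 "1 :: complex"] face_lattice_zero[of x] by simp
  finally show thesis
    by (intro that[of "\<lambda>i. pm_filter (face_lattice x) (h i)"]) (simp_all add: L_def keys_pm_filter)
qed

lemma translate_add:
  assumes "\<forall>i. 0 \<le> int (k * x $ i) + b $ i"
  shows "translate k x (laurent_exp m + b) = m + translate k x b"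
proof -
  have "nat (int (k * x $ i) + (int (m $ i) + b $ i)) = m $ i + nat (int (k * x $ i) + b $ i)" for i
  proof -
    have "0 \<le> int (k * x $ i) + b $ i" using assms by blast
    then show ?thesis by linarith
  qed
  then show ?thesis by (simp add: translate_def laurent_exp_def vec_eq_iff)
qed

lemma nu_add_on_face:
  assumes "m \<in> on_face x" "active y = active x"
  shows "nu (m + y) = 1 + nu y"
proof (rule antisym)
  show "nu (m + y) \<le> 1 + nu y" using nu_add[of m y] nu_V[OF on_face_V[OF assms(1)]] by simp
  obtain u where u: "u \<in> U" "u \<bullet> exp_point y = nu y" using height_U_attained by (metis nu_def)
  then have "u \<in> active x" using assms(2) by (auto simp: active_def)
  then have "u \<bullet> exp_point m = 1" using assms(1) by (auto simp: on_face_def carrier_face_def active_def nu_def)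
  then show "1 + nu y \<le> nu (m + y)"
    using height_U_ge[OF u(1), of "exp_point (m + y)"] u(2) by (simp add: nu_def exp_point_add inner_add_right)
qed

text \<open>A boundary exponent off the carrier face either misses a functional active at
  \<open>x\<close> or has a nonzero coordinate where \<open>x\<close> has 0, so adding it shrinks
  one of the two sets.\<close>

lemma off_face_smaller:
  assumes m: "m \<in> V" "m \<notin> on_face x" and y: "active y = active x" "vanishing y = vanishing x"
    and add: "nu (m + y) = 1 + nu y"
  shows "card (active (m + y)) + card (vanishing (m + y)) < card (active x) + card (vanishing x)"
proof -
  have a: "active (m + y) = active m \<inter> active x"
    using active_add[of m y] add nu_V[OF m(1)] y by simp
  have v: "vanishing (m + y) = vanishing m \<inter> vanishing x"
    unfolding y(2)[symmetric] by (auto simp: vanishing_def)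
  have fin: "finite (active x)" "finite (vanishing x)" using finite_U by (auto simp: active_def)
  have "\<not> (active x \<subseteq> active m \<and> vanishing x \<subseteq> vanishing m)"
  proof
    assume s: "active x \<subseteq> active m \<and> vanishing x \<subseteq> vanishing m"
    have "m \<in> Poly_Mapping.keys f" using m(1) by (simp add: V_def)
    then have "exp_point m \<in> P" by (intro points_in_P) (simp add: points_def)
    moreover have "u \<bullet> exp_point m = 1" if "u \<in> U" "u \<bullet> exp_point x = height U (exp_point x)" for u
    proof -
      have "u \<in> active m" using s that by (auto simp: active_def nu_def)
      then show ?thesis using nu_V[OF m(1)] by (simp add: active_def)
    qed
    moreover have "exp_point m $ i = 0" if "exp_point x $ i = 0" for i
    proof -
      have "i \<in> vanishing m" using s that by (auto simp: vanishing_def exp_point_def)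
      then show ?thesis by (simp add: vanishing_def exp_point_def)
    qed
    ultimately have "m \<in> on_face x"
      using \<open>m \<in> Poly_Mapping.keys f\<close> unfolding on_face_def carrier_face_def by blast
    then show False using m(2) by blast
  qed
  then have "active m \<inter> active x \<subset> active x \<or> vanishing m \<inter> vanishing x \<subset> vanishing x" by blast
  then show ?thesis
  proof
    assume "active m \<inter> active x \<subset> active x"
    then have "card (active m \<inter> active x) < card (active x)" using fin by (intro psubset_card_mono)
    moreover have "card (vanishing m \<inter> vanishing x) \<le> card (vanishing x)" using fin by (intro card_mono) auto
    ultimately show ?thesis by (simp add: a v)
  next
    assume "vanishing m \<inter> vanishing x \<subset> vanishing x"
    then have "card (vanishing m \<inter> vanishing x) < card (vanishing x)" using fin by (intro psubset_card_mono)
    moreover have "card (active m \<inter> active x) \<le> card (active x)" using fin by (intro card_mono) auto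
    ultimately show ?thesis by (simp add: a v)
  qed
qed

text \<open>The relation on the torus of a face, translated by a large multiple of a point \<open>x\<close> in the
  relative interior of its cone, holds in the graded ring up to monomials in the interior of larger
  cones or of larger coordinate faces.\<close>

theorem monomial_nilpotent:
  assumes nd: "nondegenerate f"
  shows "x \<noteq> 0 \<Longrightarrow> gnilpotent UNIV lead (Poly_Mapping.single x 1)"
proof (induction "card (active x) + card (vanishing x)" arbitrary: x rule: less_induct)
  case less
  obtain h where rel: "(\<Sum>i\<in>UNIV. (\<Sum>m\<in>on_face x. Poly_Mapping.single (laurent_exp m)
      (of_nat (m $ i) * Poly_Mapping.lookup f m)) * h i) = 1"
    and hL: "\<And>i b. b \<in> Poly_Mapping.keys (h i) \<Longrightarrow> face_lattice x b"
    using laurent_relation[OF nd less.prems] by blast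
  \<comment> \<open>One \<open>k\<close> serves all the finitely many exponents of the
    cofactors.\<close>
  have "eventually (\<lambda>k. \<forall>b\<in>(\<Union>i. Poly_Mapping.keys (h i)). (\<forall>i. 0 \<le> int (k * x $ i) + b $ i) \<and>
      active (translate k x b) = active x \<and> vanishing (translate k x b) = vanishing x) sequentially"
    by (rule eventually_ball_finite) (use hL translate_eventually in auto)
  from eventually_happens'[OF sequentially_bot this] obtain k where k: "\<And>b i. b \<in> Poly_Mapping.keys (h i) \<Longrightarrow> (\<forall>i. 0 \<le> int (k * x $ i) + b $ i) \<and>
      active (translate k x b) = active x \<and> vanishing (translate k x b) = vanishing x"
    by blast
  define t where "t b = translate k x b" for b
  define c where "c i m b = of_nat (m $ i) * Poly_Mapping.lookup f m * Poly_Mapping.lookup (h i) b" for i :: 'n and m b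
  \<comment> \<open>Carries the Laurent relation into the polynomial ring by translating exponents
    with \<open>k\<close> times \<open>x\<close>; the constant 1 becomes the monomial with exponent
    \<open>scale k x\<close>.\<close>
  define T :: "'n laurent \<Rightarrow> 'n cpoly" where
    "T g = (\<Sum>b\<in>Poly_Mapping.keys g. Poly_Mapping.single (t b) (Poly_Mapping.lookup g b))" for g
  have T_expand: "T g = (\<Sum>b\<in>A. Poly_Mapping.single (t b) (Poly_Mapping.lookup g b))"
    if "finite A" "Poly_Mapping.keys g \<subseteq> A" for g A
    unfolding T_def using that by (intro sum.mono_neutral_left) (auto simp: in_keys_iff)
  have T_add: "T (g + g') = T g + T g'" for g g'
    using keys_add[of g g']
    by (simp add: T_expand[of "Poly_Mapping.keys g \<union> Poly_Mapping.keys g'"] lookup_add single_add sum.distrib)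
  have T_single: "T (Poly_Mapping.single b d) = Poly_Mapping.single (t b) d" for b d
    by (subst T_expand[of "{b}"]) auto
  have "Poly_Mapping.single (scale k x) 1 = T 1"
  proof -
    have "t 0 = scale k x" by (simp add: t_def translate_def scale_def vec_eq_iff nat_mult_distrib)
    then show ?thesis using T_single[of 0 1] by simp
  qed
  also have "\<dots> = T (\<Sum>i\<in>UNIV. \<Sum>m\<in>on_face x. \<Sum>b\<in>Poly_Mapping.keys (h i). Poly_Mapping.single (laurent_exp m + b) (c i m b))"
    unfolding rel[symmetric] mult_single_sum c_def ..
  also have "\<dots> = (\<Sum>i\<in>UNIV. \<Sum>m\<in>on_face x. \<Sum>b\<in>Poly_Mapping.keys (h i). Poly_Mapping.single (t (laurent_exp m + b)) (c i m b))"
    by (simp only: additive_sum[of T, OF T_add] T_single)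
  also have "\<dots> = (\<Sum>i\<in>UNIV. \<Sum>m\<in>on_face x. \<Sum>b\<in>Poly_Mapping.keys (h i). Poly_Mapping.single (m + t b) (c i m b))"
    using k unfolding t_def by (intro sum.cong refl) (simp add: translate_add)
  finally have mono: "Poly_Mapping.single (scale k x) 1 =
    (\<Sum>i\<in>UNIV. \<Sum>m\<in>on_face x. \<Sum>b\<in>Poly_Mapping.keys (h i). Poly_Mapping.single (m + t b) (c i m b))" .
  define H where "H i = (\<Sum>b\<in>Poly_Mapping.keys (h i). Poly_Mapping.single (t b) (Poly_Mapping.lookup (h i) b))" for i
  \<comment> \<open>The terms of the products of \<open>lead i\<close> and \<open>H i\<close> in the
    graded ring: those with \<open>m\<close> on the face reproduce the translated relation, the
    others are the error terms.\<close>
  define R where "R i m b = (if nu (m + t b) = nu m + nu (t b) then Poly_Mapping.single (m + t b) (c i m b) else 0)" for i m b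
  have "(\<Sum>i\<in>UNIV. gmul (lead i) (H i)) = (\<Sum>i\<in>UNIV. \<Sum>m\<in>V. \<Sum>b\<in>Poly_Mapping.keys (h i). R i m b)"
    unfolding lead_eq H_def gmul_sum_left unfolding gmul_sum_right gmul_single R_def c_def ..
  also have "\<dots> = (\<Sum>i\<in>UNIV. \<Sum>m\<in>on_face x. \<Sum>b\<in>Poly_Mapping.keys (h i). R i m b) +
      (\<Sum>i\<in>UNIV. \<Sum>m\<in>V - on_face x. \<Sum>b\<in>Poly_Mapping.keys (h i). R i m b)"
  proof -
    have "on_face x \<subseteq> V" using on_face_V by blast
    from sum.subset_diff[OF this finite_V]
    have "(\<Sum>m\<in>V. g m) = (\<Sum>m\<in>on_face x. g m) + (\<Sum>m\<in>V - on_face x. g m)" for g :: "nat ^ 'n \<Rightarrow> 'n cpoly"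
      by (simp add: add.commute)
    then show ?thesis by (simp add: sum.distrib)
  qed
  also have "(\<Sum>i\<in>UNIV. \<Sum>m\<in>on_face x. \<Sum>b\<in>Poly_Mapping.keys (h i). R i m b) = Poly_Mapping.single (scale k x) 1"
    unfolding mono
  proof (intro sum.cong refl)
    fix i m b assume m: "m \<in> on_face x" and b: "b \<in> Poly_Mapping.keys (h i)"
    have "nu (m + t b) = nu m + nu (t b)"
      using nu_add_on_face[OF m, of "t b"] k[OF b] nu_V[OF on_face_V[OF m]] by (simp add: t_def)
    then show "R i m b = Poly_Mapping.single (m + t b) (c i m b)" by (simp add: R_def)
  qed
  \<comment> \<open>The error terms carry their sign inside the sum, so that
    \<open>gnilpotent_sum\<close> applies to them.\<close>
  finally have eq: "Poly_Mapping.single (scale k x) 1 = (\<Sum>i\<in>UNIV. gmul (lead i) (H i)) +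
      (\<Sum>i\<in>UNIV. \<Sum>m\<in>V - on_face x. \<Sum>b\<in>Poly_Mapping.keys (h i). Poly_Mapping.single 0 (- 1) * R i m b)"
    by (simp add: single_uminus sum_negf)
  have nilR: "gnilpotent UNIV lead (R i m b)" if m: "m \<in> V - on_face x" and b: "b \<in> Poly_Mapping.keys (h i)" for i m b
  proof (cases "nu (m + t b) = nu m + nu (t b)")
    case True
    have kb: "active (t b) = active x" "vanishing (t b) = vanishing x" using k[OF b] by (simp_all add: t_def)
    have "card (active (m + t b)) + card (vanishing (m + t b)) < card (active x) + card (vanishing x)"
      using m True nu_V[of m] kb by (intro off_face_smaller) auto
    moreover have "m + t b \<noteq> 0"
    proof
      assume "m + t b = 0"
      then have "m = 0" by (simp add: vec_eq_iff)
      then show False using m nu_V[of m] nu_zero by simp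
    qed
    ultimately have "gnilpotent UNIV lead (Poly_Mapping.single (m + t b) 1)" by (intro less.hyps)
    then have "gnilpotent UNIV lead (gmul (Poly_Mapping.single 0 (c i m b)) (Poly_Mapping.single (m + t b) 1))"
      by (rule gnilpotent_gmul)
    then show ?thesis using True by (simp add: gmul_single nu_zero R_def)
  next
    case False
    have "0 \<in> gideal UNIV lead" by (rule gidealI[where h = "\<lambda>_. 0"]) simp
    then show ?thesis using False by (simp add: R_def gnilpotent_ideal)
  qed
  have nil': "gnilpotent UNIV lead (Poly_Mapping.single 0 (- 1) * R i m b)"
    if m: "m \<in> V - on_face x" and b: "b \<in> Poly_Mapping.keys (h i)" for i m b
  proof -
    have "gmul (Poly_Mapping.single 0 (- 1)) (R i m b) = Poly_Mapping.single 0 (- 1) * R i m b"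
      by (auto simp: R_def gmul_single nu_zero mult_single)
    then show ?thesis using gnilpotent_gmul[OF nilR[OF m b], of "Poly_Mapping.single 0 (- 1)"] by simp
  qed
  have nilI: "gnilpotent UNIV lead (\<Sum>i\<in>UNIV. gmul (lead i) (H i))"
    by (rule gnilpotent_ideal, rule gidealI) (rule refl)
  have "gnilpotent UNIV lead (Poly_Mapping.single (scale k x) 1)"
    unfolding eq by (rule gnilpotent_add[OF nilI]) (intro gnilpotent_sum nil')
  then show ?case
    unfolding funpow_single[symmetric] by (rule gnilpotent_funpow)
qed

definition idx :: "nat \<Rightarrow> 'n" where
  "idx = (SOME e. bij_betw e {N..<N + CARD('n)} UNIV)"

lemma bij_idx: "bij_betw idx {N..<N + CARD('n)} UNIV"
proof -
  have "\<exists>e. bij_betw e {N..<N + CARD('n)} (UNIV :: 'n set)"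
    by (rule finite_same_card_bij) auto
  then show ?thesis unfolding idx_def by (rule someI_ex)
qed

text \<open>The monomials take the indices below \<open>N\<close> and the leading forms the next n,
  so both families act in one Koszul complex.\<close>

definition gens :: "nat \<Rightarrow> 'n cpoly" where
  "gens j = (if j < N then Poly_Mapping.single (vs j) 1 else lead (idx j))"

lemma card_le_N: "CARD('n) \<le> N"
proof -
  obtain y where "perturbation y" using perturbation_exists by blast
  then interpret perturbed_cone U vs N y by unfold_locales
  have "card (cell 0) \<le> N" using card_mono[OF _ cell_subset[of 0]] by simp
  then show ?thesis by (simp add: card_cell)
qed

sublocale gr: koszul "\<lambda>j. gmul (gens j)" UNIV
  by (rule koszul_gmul)

theorem acyclic_lead:
  assumes nd: "nondegenerate f" and "p > 0"
  shows "gr.acyclic_at {N..<N + CARD('n)} p"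
proof (rule gr.acyclic_at_transfer[where Z = "{..<N}"])
  obtain y where "perturbation y" using perturbation_exists by blast
  then interpret perturbed_cone U vs N y by unfold_locales
  have mono: "gr.acyclic_at {..<N} p" if "p + CARD('n) > N" for p
    using that by (intro acyclic_monomials) (simp_all add: gens_def)
  show "gr.acyclic_at ({N..<N + CARD('n)} \<union> {..<N}) p" if "p > card {..<N}" for p
    unfolding Un_commute[of "{N..<N + CARD('n)}"]
    using that card_le_N by (intro gr.acyclic_at_Un[of _ _ "N - CARD('n)"] mono) auto
  fix j assume j: "j \<in> {..<N}"
  have "vs j \<noteq> 0" using nu_vs[of j] j nu_zero by auto
  from monomial_nilpotent[OF nd this] obtain n where
    "\<And>h. (gmul (Poly_Mapping.single (vs j) 1) ^^ n) h \<in> gideal UNIV lead" by (auto simp: gnilpotent_def)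
  from this[of "Poly_Mapping.single 0 1"] obtain h where
    h: "(gmul (Poly_Mapping.single (vs j) 1) ^^ n) (Poly_Mapping.single 0 1) = (\<Sum>i\<in>UNIV. gmul (lead i) (h i))"
    by (auto simp: gideal_def)
  \<comment> \<open>Applying the nilpotency relation to 1 once and multiplying by \<open>m\<close>
    makes the cofactors multiplication operators, hence additive and commuting with the
    generators.\<close>
  have "(gmul (gens j) ^^ n) m = (\<Sum>i\<in>{N..<N + CARD('n)}. gmul (gens i) (gmul (h (idx i)) m))" for m
  proof -
    have "(gmul (gens j) ^^ n) m = gmul ((gmul (gens j) ^^ n) (Poly_Mapping.single 0 1)) m"
      by (rule funpow_gmul_one)
    also have "(gmul (gens j) ^^ n) (Poly_Mapping.single 0 1) = (\<Sum>i\<in>UNIV. gmul (lead i) (h i))"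
      using h j by (simp add: gens_def)
    also have "gmul \<dots> m = (\<Sum>i\<in>UNIV. gmul (lead i) (gmul (h i) m))"
      by (simp add: gmul_sum_left gmul_assoc)
    also have "\<dots> = (\<Sum>i\<in>{N..<N + CARD('n)}. gmul (lead (idx i)) (gmul (h (idx i)) m))"
      by (rule sum.reindex_bij_betw[OF bij_idx, symmetric])
    also have "\<dots> = (\<Sum>i\<in>{N..<N + CARD('n)}. gmul (gens i) (gmul (h (idx i)) m))"
      by (intro sum.cong) (auto simp: gens_def)
    finally show ?thesis .
  qed
  then show "\<exists>k b. (\<forall>m. (gmul (gens j) ^^ k) m = (\<Sum>i\<in>{N..<N + CARD('n)}. gmul (gens i) (b i m))) \<and>
      (\<forall>i m m'. b i (m + m') = b i m + b i m') \<and> (\<forall>i k m. b i (gmul (gens k) m) = gmul (gens k) (b i m)) \<and>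
      (\<forall>i. \<forall>m\<in>UNIV. b i m \<in> UNIV)"
    by (intro exI[of _ n] exI[of _ "\<lambda>i. gmul (h (idx i))"]) (simp add: gmul_add_right gmul_left_commute)
qed (use assms in auto)

end

section \<open>The Hilbert function of the ideal of leading forms\<close>

locale quotient_space = vector_space scale
  for scale :: "'a::field \<Rightarrow> 'b::ab_group_add \<Rightarrow> 'b"
begin

text \<open>Representatives in \<open>X\<close> of a basis of \<open>X / K\<close>.\<close>

definition complement_basis :: "'b set \<Rightarrow> 'b set \<Rightarrow> 'b set \<Rightarrow> bool" where
  "complement_basis X K C \<longleftrightarrow> finite C \<and> C \<subseteq> X \<and> (\<forall>u\<in>X. \<exists>c. u - (\<Sum>b\<in>C. scale (c b) b) \<in> K) \<and>
     (\<forall>c. (\<Sum>b\<in>C. scale (c b) b) \<in> K \<longrightarrow> (\<forall>b\<in>C. c b = 0))"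

lemma complement_basis_ind:
  assumes "complement_basis X K C" "(\<Sum>b\<in>C. scale (c b) b) \<in> K" "b \<in> C"
  shows "c b = 0"
  using assms(1)[unfolded complement_basis_def, THEN conjunct2, THEN conjunct2, THEN conjunct2,
      THEN spec, THEN mp, OF assms(2)] assms(3) by (rule bspec)

lemma complement_basis_gen:
  assumes "complement_basis X K C" "u \<in> X"
  obtains c where "u - (\<Sum>b\<in>C. scale (c b) b) \<in> K"
proof -
  have "\<exists>c. u - (\<Sum>b\<in>C. scale (c b) b) \<in> K"
    using assms(1)[unfolded complement_basis_def, THEN conjunct2, THEN conjunct2, THEN conjunct1] assms(2)
    by (rule bspec)
  then show thesis using that by (elim exE)
qed

lemma complement_basis_finite: "complement_basis X K C \<Longrightarrow> finite C"
  by (simp add: complement_basis_def)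

lemma complement_basis_subset: "complement_basis X K C \<Longrightarrow> C \<subseteq> X"
  by (simp add: complement_basis_def)

lemma complement_basis_exists:
  assumes "finite S" "X \<subseteq> span S" "subspace K" "K \<subseteq> X" "subspace X"
  shows "\<exists>C. complement_basis X K C"
proof -
  obtain BK where BK: "BK \<subseteq> K" "independent BK" "K \<subseteq> span BK"
    using maximal_independent_subset[of K] by blast
  have spK: "span BK = K" using BK span_minimal[OF BK(1) assms(3)] by blast
  have "BK \<subseteq> X" using BK assms by blast
  then obtain B where B: "BK \<subseteq> B" "B \<subseteq> X" "independent B" "X \<subseteq> span B"
    using maximal_independent_subset_extend[OF _ BK(2), of X] by blast
  have finB: "finite B"
    using independent_span_bound[OF assms(1) B(3)] B(2) assms(2) by blast
  define C where "C = B - BK"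
  have "complement_basis X K C"
    unfolding complement_basis_def
  proof (intro conjI ballI allI impI)
    show "finite C" using finB by (simp add: C_def)
    show "C \<subseteq> X" using B by (auto simp: C_def)
    fix u assume "u \<in> X"
    then have "u \<in> span B" using B by blast
    then obtain r where r: "u = (\<Sum>b\<in>B. scale (r b) b)" by (auto simp: span_finite[OF finB])
    have "u - (\<Sum>b\<in>C. scale (r b) b) = (\<Sum>b\<in>BK. scale (r b) b)"
      unfolding r C_def using B(1) finB by (simp add: sum.subset_diff[of BK B])
    also have "\<dots> \<in> span BK" by (intro span_sum span_scale span_base)
    finally show "\<exists>c. u - (\<Sum>b\<in>C. scale (c b) b) \<in> K" using spK by blast
  next
    fix c b assume c: "(\<Sum>b\<in>C. scale (c b) b) \<in> K" and b: "b \<in> C"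
    have finK: "finite BK" using finB B(1) finite_subset by blast
    from c obtain r where r: "(\<Sum>b\<in>C. scale (c b) b) = (\<Sum>b\<in>BK. scale (r b) b)"
      unfolding spK[symmetric] by (auto simp: span_finite[OF finK])
    define s where "s b = (if b \<in> BK then - r b else c b)" for b
    have "(\<Sum>b\<in>B. scale (s b) b) = (\<Sum>b\<in>C. scale (s b) b) + (\<Sum>b\<in>BK. scale (s b) b)"
      unfolding C_def using B(1) finB by (intro sum.subset_diff)
    also have "(\<Sum>b\<in>C. scale (s b) b) = (\<Sum>b\<in>C. scale (c b) b)"
      by (intro sum.cong) (auto simp: s_def C_def)
    also have "(\<Sum>b\<in>BK. scale (s b) b) = - (\<Sum>b\<in>BK. scale (r b) b)"
      unfolding sum_negf[symmetric] by (intro sum.cong) (auto simp: s_def)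
    finally have "(\<Sum>b\<in>B. scale (s b) b) = 0" using r by simp
    then have "s b = 0"
      using B(3) finB b by (auto simp: independent_explicit_module C_def)
    then show "c b = 0" using b by (auto simp: s_def C_def)
  qed
  then show ?thesis ..
qed

lemma complement_basis_dim:
  assumes C: "complement_basis X K C" and "finite S" "X \<subseteq> span S" "subspace K" "K \<subseteq> X" "subspace X"
  shows "dim X = dim K + card C"
proof -
  obtain BK where BK: "BK \<subseteq> K" "independent BK" "K \<subseteq> span BK"
    using maximal_independent_subset[of K] by blast
  have spK: "span BK = K" using BK span_minimal[OF BK(1) assms(4)] by blast
  have finC: "finite C" and CX: "C \<subseteq> X"
    using complement_basis_finite[OF C] complement_basis_subset[OF C] by simp_all
  note ind = complement_basis_ind[OF C]
  have finK: "finite BK"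
    using independent_span_bound[OF assms(2) BK(2)] BK(1) assms(3,5) by blast
  have step: "independent (BK \<union> D) \<and> BK \<inter> D = {}" if "finite D" "D \<subseteq> C" for D
    using that
  proof (induction D rule: finite_induct)
    case (insert b D)
    have bn: "b \<notin> span (BK \<union> D)"
    proof
      assume "b \<in> span (BK \<union> D)"
      then obtain k d where kd: "b = k + d" "k \<in> K" "d \<in> span D"
        unfolding span_Un spK by auto
      then obtain r where r: "d = (\<Sum>a\<in>D. scale (r a) a)" by (auto simp: span_finite[OF insert.hyps(1)])
      define c :: "'b \<Rightarrow> 'a" where "c a = (if a = b then 1 else if a \<in> D then - r a else 0)" for a
      have "(\<Sum>a\<in>C. scale (c a) a) = (\<Sum>a\<in>insert b D. scale (c a) a)"
        using insert.prems finC by (intro sum.mono_neutral_right) (auto simp: c_def)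
      also have "\<dots> = b + (\<Sum>a\<in>D. scale (c a) a)"
        using insert.hyps by (simp add: c_def)
      also have "(\<Sum>a\<in>D. scale (c a) a) = - d"
        unfolding r sum_negf[symmetric] using insert.hyps by (intro sum.cong) (auto simp: c_def)
      finally have "(\<Sum>a\<in>C. scale (c a) a) \<in> K" using kd by simp
      then have "c b = 0" using insert.prems by (intro ind) auto
      then show False by (simp add: c_def)
    qed
    then have "independent (insert b (BK \<union> D))"
      using insert by (intro independent_insertI) auto
    moreover have "b \<notin> BK" using bn span_base by blast
    ultimately show ?case using insert by simp
  qed (use BK in simp)
  have BKC: "independent (BK \<union> C)" "BK \<inter> C = {}" using step[OF finC subset_refl] by auto
  have "X \<subseteq> span (BK \<union> C)"
  proof
    fix u assume "u \<in> X"
    from complement_basis_gen[OF C this] obtain c where c: "u - (\<Sum>b\<in>C. scale (c b) b) \<in> K" .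
    have "(\<Sum>b\<in>C. scale (c b) b) \<in> span (BK \<union> C)" by (intro span_sum span_scale span_base) simp
    moreover have "u - (\<Sum>b\<in>C. scale (c b) b) \<in> span (BK \<union> C)"
      using c spK span_mono[of BK "BK \<union> C"] by blast
    ultimately have "(u - (\<Sum>b\<in>C. scale (c b) b)) + (\<Sum>b\<in>C. scale (c b) b) \<in> span (BK \<union> C)"
      by (intro span_add)
    then show "u \<in> span (BK \<union> C)" by simp
  qed
  moreover have "BK \<union> C \<subseteq> X" using BK(1) CX assms(5) by blast
  ultimately have "dim X = card (BK \<union> C)" using BKC(1) by (intro dim_unique[of "BK \<union> C"]) auto
  also have "\<dots> = card BK + card C" using finK finC BKC(2) by (rule card_Un_disjoint)
  also have "card BK = dim K" using BK by (intro dim_unique[symmetric, of BK]) auto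
  finally show ?thesis .
qed

text \<open>By \<open>ker\<close> and \<open>Zeq\<close> the map induces an isomorphism from X/K
  onto Z/W; the equation is arranged to avoid subtraction of natural numbers.\<close>

lemma dim_image_sum:
  assumes add: "\<And>a b. \<phi> (a + b) = \<phi> a + \<phi> b" and sc: "\<And>c a. \<phi> (scale c a) = scale c (\<phi> a)"
    and X: "finite S" "X \<subseteq> span S" "subspace X" and K: "subspace K" "K \<subseteq> X"
    and Z: "finite S'" "Z \<subseteq> span S'" "subspace Z" and W: "subspace W" "W \<subseteq> Z"
    and ker: "\<And>u. u \<in> X \<Longrightarrow> \<phi> u \<in> W \<longleftrightarrow> u \<in> K"
    and Zeq: "Z = {\<phi> u + v | u v. u \<in> X \<and> v \<in> W}"
  shows "dim Z + dim K = dim W + dim X"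
proof -
  obtain C where C: "complement_basis X K C" using complement_basis_exists[OF X(1,2) K X(3)] by blast
  have finC: "finite C" and CX: "C \<subseteq> X"
    using complement_basis_finite[OF C] complement_basis_subset[OF C] by simp_all
  note ind = complement_basis_ind[OF C]
  have phi_sum: "\<phi> (\<Sum>b\<in>D. scale (c b) b) = (\<Sum>b\<in>D. scale (c b) (\<phi> b))" for c D
    by (subst additive_sum[of \<phi>, OF add]) (simp add: sc)
  have combX: "(\<Sum>b\<in>C. scale (c b) b) \<in> X" for c
    using CX X(3) by (intro subspace_sum subspace_scale) auto
  have inj: "inj_on \<phi> C"
  proof (rule inj_onI, rule ccontr)
    fix a b assume ab: "a \<in> C" "b \<in> C" "\<phi> a = \<phi> b" "a \<noteq> b"
    define c :: "'b \<Rightarrow> 'a" where "c e = (if e = a then 1 else if e = b then - 1 else 0)" for e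
    have "(\<Sum>e\<in>C. scale (c e) e) = (\<Sum>e\<in>{a, b}. scale (c e) e)"
      using ab finC by (intro sum.mono_neutral_right) (auto simp: c_def)
    also have "\<dots> = a - b" using ab by (simp add: c_def)
    finally have s: "(\<Sum>e\<in>C. scale (c e) e) = a - b" .
    have "\<phi> (a - b) + \<phi> b = \<phi> a" using add[of "a - b" b] by simp
    then have "\<phi> (a - b) = 0" using ab(3) by simp
    then have "a - b \<in> K" using ker[of "a - b"] combX[of c] s W(1) subspace_0 by simp
    then have "c a = 0" using ab s by (intro ind) auto
    then show False by (simp add: c_def)
  qed
  have "complement_basis Z W (\<phi> ` C)"
    unfolding complement_basis_def
  proof (intro conjI ballI allI impI)
    show "finite (\<phi> ` C)" using finC by simp
    show "\<phi> ` C \<subseteq> Z"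
    proof
      fix z assume "z \<in> \<phi> ` C"
      then obtain b where "b \<in> C" "z = \<phi> b + 0" by auto
      then show "z \<in> Z" unfolding Zeq using CX subspace_0[OF W(1)] by blast
    qed
    fix z assume "z \<in> Z"
    then obtain u v where uv: "z = \<phi> u + v" "u \<in> X" "v \<in> W" unfolding Zeq by blast
    from complement_basis_gen[OF C uv(2)] obtain c where c: "u - (\<Sum>b\<in>C. scale (c b) b) \<in> K" .
    have "\<phi> (u - (\<Sum>b\<in>C. scale (c b) b)) \<in> W" using c ker K(2) by blast
    moreover have "\<phi> (u - (\<Sum>b\<in>C. scale (c b) b)) + \<phi> (\<Sum>b\<in>C. scale (c b) b) = \<phi> u"
      using add[of "u - (\<Sum>b\<in>C. scale (c b) b)" "\<Sum>b\<in>C. scale (c b) b"] by simp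
    then have e: "\<phi> u - (\<Sum>b\<in>C. scale (c b) (\<phi> b)) = \<phi> (u - (\<Sum>b\<in>C. scale (c b) b))"
      unfolding phi_sum by (simp add: algebra_simps)
    ultimately have "(\<phi> u - (\<Sum>b\<in>C. scale (c b) (\<phi> b))) + v \<in> W"
      using uv(3) W(1) by (simp add: subspace_add)
    moreover have "(\<Sum>b\<in>\<phi> ` C. scale (c (inv_into C \<phi> b)) b) = (\<Sum>b\<in>C. scale (c b) (\<phi> b))"
      using inj by (simp add: sum.reindex)
    ultimately have "z - (\<Sum>b\<in>\<phi> ` C. scale (c (inv_into C \<phi> b)) b) \<in> W"
      by (simp add: uv(1) algebra_simps)
    then show "\<exists>c. z - (\<Sum>b\<in>\<phi> ` C. scale (c b) b) \<in> W" by (rule exI[of _ "\<lambda>b. c (inv_into C \<phi> b)"])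
  next
    fix c z assume c: "(\<Sum>b\<in>\<phi> ` C. scale (c b) b) \<in> W" and "z \<in> \<phi> ` C"
    then obtain b where b: "b \<in> C" "z = \<phi> b" by blast
    have "(\<Sum>b\<in>\<phi> ` C. scale (c b) b) = \<phi> (\<Sum>b\<in>C. scale (c (\<phi> b)) b)"
      using inj by (simp add: sum.reindex phi_sum)
    then have "(\<Sum>b\<in>C. scale (c (\<phi> b)) b) \<in> K" using c ker[OF combX] by simp
    then show "c z = 0" using b ind[of "\<lambda>b. c (\<phi> b)" b] by simp
  qed
  from complement_basis_dim[OF this Z(1,2) W Z(3)] have "dim Z = dim W + card (\<phi> ` C)" .
  moreover have "dim X = dim K + card C" by (rule complement_basis_dim[OF C X(1,2) K X(3)])
  ultimately show ?thesis using inj by (simp add: card_image)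
qed

end

definition cscale :: "complex \<Rightarrow> ('a::comm_monoid_add \<Rightarrow>\<^sub>0 complex) \<Rightarrow> 'a \<Rightarrow>\<^sub>0 complex" where
  "cscale c g = Poly_Mapping.single 0 c * g"

lemma lookup_cscale: "Poly_Mapping.lookup (cscale c g) k = c * Poly_Mapping.lookup g k"
  by (simp add: cscale_def mult_map_scale_conv_mult[symmetric] Poly_Mapping.map.rep_eq when_def)

interpretation cpm: quotient_space cscale
proof
  fix a b :: complex and x y :: "'a::comm_monoid_add \<Rightarrow>\<^sub>0 complex"
  show "cscale a (x + y) = cscale a x + cscale a y" by (simp add: cscale_def distrib_left)
  show "cscale (a + b) x = cscale a x + cscale b x" by (simp add: cscale_def single_add distrib_right)
  show "cscale a (cscale b x) = cscale (a * b) x"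
    by (rule poly_mapping_eqI) (simp add: lookup_cscale)
  show "cscale 1 x = x" by (simp add: cscale_def)
qed

lemma cscale_single: "cscale c (Poly_Mapping.single m d) = Poly_Mapping.single m (c * d)"
  by (simp add: cscale_def mult_single)

lemma keys_cscale: "Poly_Mapping.keys (cscale c g) \<subseteq> Poly_Mapping.keys g"
  by (auto simp: in_keys_iff lookup_cscale)

lemma (in subadditive) gmul_cscale: "gmul g (cscale c h) = cscale c (gmul g h)"
proof -
  have "cscale c k = gmul (Poly_Mapping.single 0 c) k" for k
    by (rule additive_ext[of "cscale c"])
      (simp_all add: cscale_def distrib_left gmul_add_right gmul_single nu_zero mult_single)
  then show ?thesis by (simp add: gmul_left_commute)
qed

context convenient_poly
begin

definition J :: "nat set" where
  "J = {N..<N + CARD('n)}"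

lemma finite_J: "finite J"
  by (simp add: J_def)

lemma nu_gens: "j \<in> J \<Longrightarrow> a \<in> Poly_Mapping.keys (gens j) \<Longrightarrow> nu a = 1"
  by (auto simp: J_def gens_def nu_lead)

lemma filter_gens:
  "j \<in> J \<Longrightarrow> pm_filter (\<lambda>x. Q (nu x)) (gmul (gens j) h) = gmul (gens j) (pm_filter (\<lambda>x. Q (1 + nu x)) h)"
  by (rule pm_filter_gmul) (rule nu_gens)

lemma gr_filter:
  assumes "T \<subseteq> J"
  shows "gr.kd T (\<lambda>I. pm_filter (\<lambda>x. Q (1 + nu x)) (z I)) = (\<lambda>I. pm_filter (\<lambda>x. Q (nu x)) (gr.kd T z I))"
  using assms by (intro gr.kd_intertwine) (auto simp: pm_filter_add filter_gens)

text \<open>Nakayama's argument: a cycle is a boundary up to a multiple of \<open>gens j\<close>, and the cycle that is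
  multiplied has smaller weight.\<close>

lemma acyclic_remove:
  assumes "insert j T \<subseteq> J" "j \<notin> T" "gr.acyclic_at (insert j T) (Suc p)"
  shows "gr.acyclic_at T (Suc p)"
  unfolding gr.acyclic_at_def
proof (intro allI impI, elim conjE)
  have TJ: "T \<subseteq> J" and jJ: "j \<in> J" using assms(1) by auto
  have fin: "finite T" by (rule finite_subset[OF TJ finite_J])
  fix z assume z: "gr.chain T (Suc p) z" "gr.kd T z = (\<lambda>_. 0)"
  have main: "gr.boundary T (Suc p) z"
    if "gr.chain T (Suc p) z" "gr.kd T z = (\<lambda>_. 0)" "\<And>I x. x \<in> Poly_Mapping.keys (z I) \<Longrightarrow> nu x < real K" for K z
    using that
  proof (induction K arbitrary: z)
    case 0
    have "z I = 0" for I
    proof (rule ccontr)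
      assume "z I \<noteq> 0"
      then obtain x where "x \<in> Poly_Mapping.keys (z I)" by (metis all_not_in_conv keys_eq_empty)
      then show False using 0(3)[of x I] nu_nonneg[of x] by simp
    qed
    then have "z = (\<lambda>_. 0)" by auto
    then show ?case using gr.boundary_zero by simp
  next
    case (Suc K)
    obtain a b where ab: "gr.chain T (Suc (Suc p)) a" "gr.chain T (Suc p) b" "gr.kd T b = (\<lambda>_. 0)"
      "z = (\<lambda>I. gr.kd T a I + gmul (gens j) (b I))"
      using gr.cycle_eq_boundary_plus_op[OF fin assms(2,3) Suc.prems(1,2)] by blast
    \<comment> \<open>The operators are homogeneous of weight 1, so truncating \<open>a\<close> and
      \<open>b\<close> keeps the equation for \<open>z\<close>, and the weights of \<open>b'\<close>
      drop below \<open>K\<close>.\<close>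
    define a' where "a' = (\<lambda>I. pm_filter (\<lambda>x. 1 + nu x < Suc K) (a I))"
    define b' where "b' = (\<lambda>I. pm_filter (\<lambda>x. 1 + nu x < Suc K) (b I))"
    have "z = (\<lambda>I. pm_filter (\<lambda>x. nu x < Suc K) (z I))"
      using pm_filter_id[of "z _" "\<lambda>x. nu x < Suc K"] Suc.prems(3) by auto
    also have "\<dots> = (\<lambda>I. pm_filter (\<lambda>x. nu x < Suc K) (gr.kd T a I + gmul (gens j) (b I)))"
      by (simp add: ab(4))
    also have "\<dots> = (\<lambda>I. gr.kd T a' I + gmul (gens j) (b' I))"
      unfolding a'_def b'_def gr_filter[OF TJ, of "\<lambda>r. r < Suc K"]
      by (simp only: pm_filter_add filter_gens[OF jJ, of "\<lambda>r. r < Suc K"])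
    finally have ze: "z = (\<lambda>I. gr.kd T a' I + gmul (gens j) (b' I))" .
    have a': "gr.chain T (Suc (Suc p)) a'"
      by (rule gr.chainI) (simp_all add: a'_def gr.chain_eq_0[OF ab(1)])
    have b': "gr.chain T (Suc p) b'"
      by (rule gr.chainI) (simp_all add: b'_def gr.chain_eq_0[OF ab(2)])
    have kb: "gr.kd T b' = (\<lambda>_. 0)"
      unfolding b'_def gr_filter[OF TJ, of "\<lambda>r. r < Suc K"] ab(3) by simp
    have "gr.boundary T (Suc p) b'"
      by (rule Suc.IH[OF b' kb]) (simp add: b'_def keys_pm_filter)
    then obtain u where u: "gr.chain T (Suc (Suc p)) u" "gr.kd T u = b'" by (rule gr.boundaryE)
    have "gr.kd T (\<lambda>I. a' I + gmul (gens j) (u I)) = z"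
      unfolding gr.kd_add gr.kd_op[of T j u] u(2) ze ..
    then show ?case
      by (intro gr.boundaryI[of T "Suc p" "\<lambda>I. a' I + gmul (gens j) (u I)"] gr.chain_add gr.chain_op a' u(1))
  qed
  have finI: "finite {I. z I \<noteq> 0}"
    by (rule finite_subset[of _ "Pow T"]) (use gr.chain_eq_0[OF z(1)] fin in auto)
  obtain K where K: "\<And>I x. x \<in> Poly_Mapping.keys (z I) \<Longrightarrow> nu x < real K"
  proof -
    define S where "S = (\<Union>I\<in>{I. z I \<noteq> 0}. Poly_Mapping.keys (z I))"
    have finS: "finite S" using finI by (simp add: S_def)
    obtain K where K: "Max (insert 0 (nu ` S)) < real K" using reals_Archimedean2 by blast
    have "nu x < real K" if "x \<in> Poly_Mapping.keys (z I)" for x I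
    proof -
      have "z I \<noteq> 0" using that by auto
      then have "x \<in> S" unfolding S_def using that by blast
      then have "nu x \<le> Max (insert 0 (nu ` S))" using finS by (intro Max_ge) auto
      then show ?thesis using K by simp
    qed
    then show thesis by (rule that)
  qed
  then show "gr.boundary T (Suc p) z" by (rule main[OF z])
qed

lemma acyclic_subset:
  assumes nd: "nondegenerate f" and "T \<subseteq> J"
  shows "gr.acyclic_at T (Suc 0)"
proof -
  have "gr.acyclic_at T' (Suc 0)" if "finite Z" "T' \<inter> Z = {}" "T' \<union> Z = J" for Z T'
    using that
  proof (induction Z arbitrary: T' rule: finite_induct)
    case empty
    then show ?case using acyclic_lead[OF nd, of "Suc 0"] by (simp add: J_def)
  next
    case (insert j Z)
    have "gr.acyclic_at (insert j T') (Suc 0)" by (rule insert.IH) (use insert in auto)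
    moreover have "insert j T' \<subseteq> J" "j \<notin> T'" using insert.prems by auto
    ultimately show ?case using acyclic_remove by blast
  qed
  from this[of "J - T" T] show ?thesis using assms finite_J by auto
qed

text \<open>The form is a nonzerodivisor modulo the others: the degree 0 case of
  \<open>boundary_of_op_boundary\<close>, with ideals read as boundaries.\<close>

lemma gens_injective:
  assumes nd: "nondegenerate f" and T: "T \<subseteq> J" "j \<in> J - T" and m: "gmul (gens j) m \<in> gideal T gens"
  shows "m \<in> gideal T gens"
proof -
  have fin: "finite T" by (rule finite_subset[OF T(1) finite_J])
  have iff: "gr.boundary T 0 (gr.degree0 g) \<longleftrightarrow> g \<in> gideal T gens" for g
    using gr.boundary_degree0[OF fin, of g] by (auto simp: gideal_def)
  have "(\<lambda>I. gmul (gens j) (gr.degree0 m I)) = gr.degree0 (gmul (gens j) m)"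
    by (auto simp: gr.degree0_def)
  then have "gr.boundary T 0 (\<lambda>I. gmul (gens j) (gr.degree0 m I))" using m iff by simp
  moreover have "gr.acyclic_at (insert j T) (Suc 0)" using T by (intro acyclic_subset[OF nd]) auto
  ultimately have "gr.boundary T 0 (gr.degree0 m)"
    using T by (intro gr.boundary_of_op_boundary[OF fin _ _ gr.chain_degree0 gr.kd_degree0]) auto
  then show ?thesis using iff by simp
qed

definition gpiece :: "real \<Rightarrow> 'n cpoly set" where
  "gpiece \<alpha> = {g. \<forall>x\<in>Poly_Mapping.keys g. nu x = \<alpha>}"

definition gpart :: "real \<Rightarrow> 'n cpoly \<Rightarrow> 'n cpoly" where
  "gpart \<alpha> = pm_filter (\<lambda>x. nu x = \<alpha>)"

definition W :: "nat set \<Rightarrow> real \<Rightarrow> 'n cpoly set" where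
  "W T \<alpha> = gpiece \<alpha> \<inter> gideal T gens"

lemma gpart_mem: "gpart \<alpha> g \<in> gpiece \<alpha>"
  by (auto simp: gpart_def gpiece_def keys_pm_filter)

lemma gpart_id: "g \<in> gpiece \<alpha> \<Longrightarrow> gpart \<alpha> g = g"
  unfolding gpart_def gpiece_def by (intro pm_filter_id) blast

lemma gpart_add: "gpart \<alpha> (g + h) = gpart \<alpha> g + gpart \<alpha> h"
  by (simp add: gpart_def pm_filter_add)

lemma gpart_gmul: "j \<in> J \<Longrightarrow> gpart \<alpha> (gmul (gens j) h) = gmul (gens j) (gpart (\<alpha> - 1) h)"
proof -
  assume j: "j \<in> J"
  have "(\<lambda>x. 1 + nu x = \<alpha>) = (\<lambda>x. nu x = \<alpha> - 1)" by auto
  then show ?thesis using filter_gens[OF j, of "\<lambda>r. r = \<alpha>" h] by (simp add: gpart_def)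
qed

lemma subspace_gpiece: "cpm.subspace (gpiece \<alpha>)"
  unfolding cpm.subspace_def
proof (intro conjI ballI allI)
  show "0 \<in> gpiece \<alpha>" by (simp add: gpiece_def)
  show "g + h \<in> gpiece \<alpha>" if "g \<in> gpiece \<alpha>" "h \<in> gpiece \<alpha>" for g h
    using that keys_add[of g h] by (auto simp: gpiece_def)
  show "cscale c g \<in> gpiece \<alpha>" if "g \<in> gpiece \<alpha>" for c g
    using that keys_cscale[of c g] by (auto simp: gpiece_def)
qed

lemma subspace_gideal: "cpm.subspace (gideal T gens)"
  unfolding cpm.subspace_def
proof (intro conjI ballI allI)
  show "0 \<in> gideal T gens" by (rule gidealI[where h = "\<lambda>_. 0"]) simp
  show "cscale c g \<in> gideal T gens" if g: "g \<in> gideal T gens" for c g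
  proof -
    obtain h where "g = (\<Sum>i\<in>T. gmul (gens i) (h i))" using g by (auto simp: gideal_def)
    then show ?thesis
      by (intro gidealI[where h = "\<lambda>i. cscale c (h i)"]) (simp add: cpm.scale_sum_right gmul_cscale)
  qed
qed (rule gideal_add)

lemma subspace_W: "cpm.subspace (W T \<alpha>)"
  unfolding W_def by (rule cpm.subspace_inter[OF subspace_gpiece subspace_gideal])

definition gmonos :: "real \<Rightarrow> 'n cpoly set" where
  "gmonos \<alpha> = (\<lambda>x. Poly_Mapping.single x 1) ` {x. nu x = \<alpha>}"

lemma finite_nu_eq: "finite {x. nu x = \<alpha>}"
  by (rule finite_subset[OF _ finite_nu_le[of \<alpha>]]) auto

lemma finite_gmonos: "finite (gmonos \<alpha>)"
  by (simp add: gmonos_def finite_nu_eq)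

lemma span_monomials:
  assumes "\<And>x. x \<in> Poly_Mapping.keys g \<Longrightarrow> Poly_Mapping.single x 1 \<in> B"
  shows "g \<in> cpm.span B"
proof -
  have "g = (\<Sum>x\<in>Poly_Mapping.keys g. cscale (Poly_Mapping.lookup g x) (Poly_Mapping.single x 1))"
    using poly_mapping_eq_sum_single[of "Poly_Mapping.keys g" g] by (simp add: cscale_single)
  also have "\<dots> \<in> cpm.span B"
    using assms by (intro cpm.span_sum cpm.span_scale cpm.span_base)
  finally show ?thesis .
qed

lemma gpiece_span: "gpiece \<alpha> \<subseteq> cpm.span (gmonos \<alpha>)"
  by (auto simp: gpiece_def gmonos_def intro!: span_monomials)

lemma dim_gpiece: "cpm.dim (gpiece \<alpha>) = card {x. nu x = \<alpha>}"
proof (rule cpm.dim_unique)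
  show "gmonos \<alpha> \<subseteq> gpiece \<alpha>" by (auto simp: gmonos_def gpiece_def)
  show "gpiece \<alpha> \<subseteq> cpm.span (gmonos \<alpha>)" by (rule gpiece_span)
  have inj: "inj_on (\<lambda>x. Poly_Mapping.single x (1 :: complex)) {x. nu x = \<alpha>}"
    by (rule inj_onI) (metis keys_single singleton_iff zero_neq_one)
  then show "card (gmonos \<alpha>) = card {x. nu x = \<alpha>}" unfolding gmonos_def by (rule card_image)
  show "cpm.independent (gmonos \<alpha>)"
    unfolding cpm.independent_explicit_module
  proof (intro allI impI)
    fix t u v assume t: "finite t" "t \<subseteq> gmonos \<alpha>" and s: "(\<Sum>v\<in>t. cscale (u v) v) = 0" and v: "v \<in> t"
    obtain x where x: "v = Poly_Mapping.single x 1" "nu x = \<alpha>" using t(2) v by (auto simp: gmonos_def)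
    have "Poly_Mapping.lookup (cscale (u v') v') x = (if v' = v then u v else 0)" if "v' \<in> t" for v'
    proof -
      obtain x' where x': "v' = Poly_Mapping.single x' 1" using t(2) \<open>v' \<in> t\<close> by (auto simp: gmonos_def)
      show ?thesis
      proof (cases "x' = x")
        case False
        then have "v' \<noteq> v" unfolding x(1) x' by (metis keys_single singleton_iff zero_neq_one)
        then show ?thesis using False by (simp add: lookup_cscale x' lookup_single when_def)
      qed (simp add: x x' lookup_cscale lookup_single)
    qed
    then have "Poly_Mapping.lookup (\<Sum>v'\<in>t. cscale (u v') v') x = u v"
      using t(1) v by (simp add: lookup_sum)
    then show "u v = 0" using s by simp
  qed
qed

text \<open>As the forms are homogeneous of weight 1, all cofactors may be replaced by their
  components of weight \<alpha> - 1, and the term of \<open>j\<close> splits off.\<close>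

lemma W_insert:
  assumes "insert j T \<subseteq> J" "j \<notin> T"
  shows "W (insert j T) \<alpha> = {gmul (gens j) u + v | u v. u \<in> gpiece (\<alpha> - 1) \<and> v \<in> W T \<alpha>}"
proof (intro equalityI subsetI)
  have fin: "finite T" by (rule finite_subset[OF _ finite_J]) (use assms(1) in blast)
  fix g assume g: "g \<in> W (insert j T) \<alpha>"
  then obtain h where h: "g = (\<Sum>i\<in>insert j T. gmul (gens i) (h i))" by (auto simp: W_def gideal_def)
  have "g = gpart \<alpha> g" using g gpart_id by (simp add: W_def)
  also have "\<dots> = gpart \<alpha> (gmul (gens j) (h j) + (\<Sum>i\<in>T. gmul (gens i) (h i)))"
    unfolding h using fin assms(2) by simp
  also have "\<dots> = gmul (gens j) (gpart (\<alpha> - 1) (h j)) + gpart \<alpha> (\<Sum>i\<in>T. gmul (gens i) (h i))"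
    using assms(1) by (simp add: gpart_add gpart_gmul)
  finally have e: "g = gmul (gens j) (gpart (\<alpha> - 1) (h j)) + gpart \<alpha> (\<Sum>i\<in>T. gmul (gens i) (h i))" .
  have "gpart \<alpha> (\<Sum>i\<in>T. gmul (gens i) (h i)) = (\<Sum>i\<in>T. gpart \<alpha> (gmul (gens i) (h i)))"
    by (rule additive_sum) (rule gpart_add)
  also have "\<dots> = (\<Sum>i\<in>T. gmul (gens i) (gpart (\<alpha> - 1) (h i)))"
    using assms(1) by (intro sum.cong refl gpart_gmul) auto
  finally have "gpart \<alpha> (\<Sum>i\<in>T. gmul (gens i) (h i)) \<in> gideal T gens" by (rule gidealI)
  then have "gpart \<alpha> (\<Sum>i\<in>T. gmul (gens i) (h i)) \<in> W T \<alpha>" using gpart_mem by (simp add: W_def)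
  then show "g \<in> {gmul (gens j) u + v | u v. u \<in> gpiece (\<alpha> - 1) \<and> v \<in> W T \<alpha>}"
    using gpart_mem[of "\<alpha> - 1" "h j"] by (subst e) blast
next
  have fin: "finite T" by (rule finite_subset[OF _ finite_J]) (use assms(1) in blast)
  fix g assume "g \<in> {gmul (gens j) u + v | u v. u \<in> gpiece (\<alpha> - 1) \<and> v \<in> W T \<alpha>}"
  then obtain u v where uv: "g = gmul (gens j) u + v" "u \<in> gpiece (\<alpha> - 1)" "v \<in> W T \<alpha>" by blast
  obtain h where h: "v = (\<Sum>i\<in>T. gmul (gens i) (h i))" using uv(3) by (auto simp: W_def gideal_def)
  have "gmul (gens j) u = gpart \<alpha> (gmul (gens j) u)"
    using assms(1) uv(2) by (simp add: gpart_gmul gpart_id)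
  then have "gmul (gens j) u \<in> gpiece \<alpha>" using gpart_mem by metis
  then have "g \<in> gpiece \<alpha>"
    using uv cpm.subspace_add[OF subspace_gpiece] by (simp add: W_def)
  moreover have "(\<Sum>i\<in>T. gmul (gens i) (h i)) = (\<Sum>i\<in>T. gmul (gens i) ((h(j := u)) i))"
    using assms(2) by (intro sum.cong) auto
  then have "g = (\<Sum>i\<in>insert j T. gmul (gens i) ((h(j := u)) i))"
    using fin assms(2) uv(1) h by simp
  then have "g \<in> gideal (insert j T) gens" by (rule gidealI)
  ultimately show "g \<in> W (insert j T) \<alpha>" by (simp add: W_def)
qed

text \<open>Multiplication by \<open>gens j\<close> from weight \<alpha> - 1 to weight \<alpha>,
  taken modulo the ideal of \<open>T\<close>, is injective by \<open>gens_injective\<close>.\<close>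

lemma dim_W_insert:
  assumes nd: "nondegenerate f" and T: "insert j T \<subseteq> J" "j \<notin> T"
  shows "cpm.dim (W (insert j T) \<alpha>) + cpm.dim (W T (\<alpha> - 1)) = cpm.dim (W T \<alpha>) + cpm.dim (gpiece (\<alpha> - 1))"
proof (rule cpm.dim_image_sum[of "gmul (gens j)" "gmonos (\<alpha> - 1)" _ _ "gmonos \<alpha>"])
  have jJ: "j \<in> J" using T by simp
  show "W (insert j T) \<alpha> \<subseteq> cpm.span (gmonos \<alpha>)" using gpiece_span by (auto simp: W_def)
  show "W T \<alpha> \<subseteq> W (insert j T) \<alpha>"
  proof
    fix v assume "v \<in> W T \<alpha>"
    moreover have "v = gmul (gens j) 0 + v" "0 \<in> gpiece (\<alpha> - 1)" by (simp_all add: gpiece_def)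
    ultimately show "v \<in> W (insert j T) \<alpha>" unfolding W_insert[OF T] by blast
  qed
  show "W (insert j T) \<alpha> = {gmul (gens j) u + v | u v. u \<in> gpiece (\<alpha> - 1) \<and> v \<in> W T \<alpha>}"
    by (rule W_insert[OF T])
  fix u assume u: "u \<in> gpiece (\<alpha> - 1)"
  have "gmul (gens j) u = gpart \<alpha> (gmul (gens j) u)" using u by (simp add: gpart_gmul[OF jJ] gpart_id)
  then have "gmul (gens j) u \<in> gpiece \<alpha>" using gpart_mem by metis
  then show "gmul (gens j) u \<in> W T \<alpha> \<longleftrightarrow> u \<in> W T (\<alpha> - 1)"
    using u gens_injective[OF nd _ _, of T j u] gideal_gmul[of u T gens "gens j"] T by (auto simp: W_def)
qed (auto simp: gmul_add_right gmul_cscale finite_gmonos gpiece_span subspace_gpiece subspace_W, auto simp: W_def)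

text \<open>The Hilbert function of the graded ring modulo the forms indexed by \<open>T\<close>;
  each new form multiplies its generating series by 1 - z.\<close>

definition hilb :: "nat set \<Rightarrow> real \<Rightarrow> int" where
  "hilb T \<alpha> = int (cpm.dim (gpiece \<alpha>)) - int (cpm.dim (W T \<alpha>))"

lemma hilb_insert:
  assumes "nondegenerate f" "insert j T \<subseteq> J" "j \<notin> T"
  shows "hilb (insert j T) \<alpha> = hilb T \<alpha> - hilb T (\<alpha> - 1)"
  using dim_W_insert[OF assms, of \<alpha>] by (simp add: hilb_def)

lemma hilb_empty: "hilb {} \<alpha> = int (card {x. nu x = \<alpha>})"
proof -
  have "W {} \<alpha> = {0}" by (auto simp: W_def gideal_def gpiece_def)
  moreover have "cpm.dim {0 :: 'n cpoly} = 0"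
    by (rule cpm.dim_unique[of "{}"]) (auto simp: cpm.independent_empty)
  ultimately show ?thesis by (simp add: hilb_def dim_gpiece)
qed

section \<open>Strictness of the Newton filtration\<close>

text \<open>The inhomogeneous counterpart of \<open>gens\<close>, with the same indices so that the
  two complexes can be compared termwise.\<close>

definition full :: "nat \<Rightarrow> 'n cpoly" where
  "full j = log_partial (idx j) f"

lemma koszul_full: "koszul (\<lambda>j g. full j * g) UNIV"
  by unfold_locales (auto simp: algebra_simps)

interpretation fl: koszul "\<lambda>j g. full j * g" UNIV
  by (rule koszul_full)

definition below :: "real \<Rightarrow> 'n cpoly \<Rightarrow> bool" where
  "below \<beta> g \<longleftrightarrow> (\<forall>x\<in>Poly_Mapping.keys g. nu x \<le> \<beta>)"

lemma below_zero: "below \<beta> 0"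
  by (simp add: below_def)

lemma below_add: "below \<beta> g \<Longrightarrow> below \<beta> h \<Longrightarrow> below \<beta> (g + h)"
  using keys_add[of g h] by (auto simp: below_def)

lemma below_diff: "below \<beta> g \<Longrightarrow> below \<beta> h \<Longrightarrow> below \<beta> (g - h)"
  using keys_diff[of g h] by (auto simp: below_def)

lemma below_sum: "(\<And>i. i \<in> X \<Longrightarrow> below \<beta> (h i)) \<Longrightarrow> below \<beta> (sum h X)"
  by (induction X rule: infinite_finite_induct) (auto simp: below_zero below_add)

lemma below_gpiece: "g \<in> gpiece \<beta> \<Longrightarrow> below \<beta> g"
  by (auto simp: gpiece_def below_def)

lemma nu_full: "a \<in> Poly_Mapping.keys (full j) \<Longrightarrow> nu a \<le> 1"
  using keys_log_partial[of "idx j" f] nu_keys_le by (auto simp: full_def)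

lemma gpart_full: "j \<in> J \<Longrightarrow> pm_filter (\<lambda>x. nu x = 1) (full j) = gens j"
  by (simp add: full_def gens_def J_def lead_def)

lemma below_full: "below \<beta> g \<Longrightarrow> below (\<beta> + 1) (full j * g)"
  unfolding below_def
proof (intro ballI)
  fix x assume g: "\<forall>x\<in>Poly_Mapping.keys g. nu x \<le> \<beta>" and "x \<in> Poly_Mapping.keys (full j * g)"
  then obtain a b where "x = a + b" "a \<in> Poly_Mapping.keys (full j)" "b \<in> Poly_Mapping.keys g"
    using keys_mult[of "full j" g] by blast
  then show "nu x \<le> \<beta> + 1" using nu_add[of a b] nu_full[of a j] g by fastforce
qed

text \<open>A product of two terms reaches the maximal weight only if both terms have maximal weight
  and the weights add up, which is the rule defining \<open>gmul\<close>.\<close>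

lemma gpart_full_mult:
  assumes j: "j \<in> J" and g: "below \<beta> g"
  shows "gpart (\<beta> + 1) (full j * g) = gmul (gens j) (gpart \<beta> g)"
proof -
  define a where "a = Poly_Mapping.lookup (full j)"
  define b where "b = Poly_Mapping.lookup g"
  have f: "full j = (\<Sum>m\<in>Poly_Mapping.keys (full j). Poly_Mapping.single m (a m))"
    unfolding a_def by (rule poly_mapping_eq_sum_single) auto
  have g': "g = (\<Sum>m\<in>Poly_Mapping.keys g. Poly_Mapping.single m (b m))"
    unfolding b_def by (rule poly_mapping_eq_sum_single) auto
  have "full j * g = (\<Sum>m\<in>Poly_Mapping.keys (full j). \<Sum>k\<in>Poly_Mapping.keys g. Poly_Mapping.single (m + k) (a m * b k))"
    using mult_single_sum[of "\<lambda>m. m" a "Poly_Mapping.keys (full j)" g] f by (simp add: b_def)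
  then have "gpart (\<beta> + 1) (full j * g) = (\<Sum>m\<in>Poly_Mapping.keys (full j). \<Sum>k\<in>Poly_Mapping.keys g.
      gpart (\<beta> + 1) (Poly_Mapping.single (m + k) (a m * b k)))"
    by (simp only: additive_sum[of "gpart (\<beta> + 1)", OF gpart_add])
  also have "\<dots> = (\<Sum>m\<in>Poly_Mapping.keys (full j). \<Sum>k\<in>Poly_Mapping.keys g.
      Poly_Mapping.single (m + k) (Poly_Mapping.lookup (gens j) m * Poly_Mapping.lookup (gpart \<beta> g) k
        when nu (m + k) = nu m + nu k))"
  proof (intro sum.cong refl)
    fix m k assume m: "m \<in> Poly_Mapping.keys (full j)" and k: "k \<in> Poly_Mapping.keys g"
    have "nu m \<le> 1" "nu k \<le> \<beta>" using nu_full[OF m] g k by (auto simp: below_def)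
    then have "nu (m + k) = \<beta> + 1 \<longleftrightarrow> nu m = 1 \<and> nu k = \<beta> \<and> nu (m + k) = nu m + nu k"
      using nu_add[of m k] by linarith
    then show "gpart (\<beta> + 1) (Poly_Mapping.single (m + k) (a m * b k)) =
      Poly_Mapping.single (m + k) (Poly_Mapping.lookup (gens j) m * Poly_Mapping.lookup (gpart \<beta> g) k
        when nu (m + k) = nu m + nu k)"
      unfolding gpart_full[OF j, symmetric]
      by (auto simp: gpart_def pm_filter_single lookup_pm_filter a_def b_def when_def)
  qed
  also have "\<dots> = gmul (gens j) (gpart \<beta> g)"
    unfolding gpart_full[OF j, symmetric] gpart_def
    by (rule gmul_expand[symmetric]) (auto simp: keys_pm_filter)
  finally show ?thesis .
qed

lemma gpart_zero: "gpart \<beta> 0 = 0"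
  by (simp add: gpart_def)

lemma gpart_kd:
  assumes "\<And>I. below \<beta> (z I)"
  shows "gpart (\<beta> + 1) (fl.kd J z I) = gr.kd J (\<lambda>I. gpart \<beta> (z I)) I"
proof (cases "I \<subseteq> J")
  case True
  have sgp: "gpart b (sg j I u) = sg j I (gpart b u)" for b j u
    using gpart_add[of b u "- u"] by (simp add: sg_def gpart_zero eq_neg_iff_add_eq_0 add.commute)
  have "gpart (\<beta> + 1) (fl.kd J z I) = (\<Sum>j\<in>J - I. gpart (\<beta> + 1) (sg j I (full j * z (insert j I))))"
    using True by (simp add: fl.kd_def additive_sum[of "gpart (\<beta> + 1)", OF gpart_add])
  also have "\<dots> = (\<Sum>j\<in>J - I. sg j I (gmul (gens j) (gpart \<beta> (z (insert j I)))))"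
    by (intro sum.cong refl) (simp add: sgp gpart_full_mult assms)
  finally show ?thesis using True by (simp add: gr.kd_def)
qed (simp add: fl.kd_def gr.kd_def gpart_zero)

lemma below_sg: "below \<beta> g \<Longrightarrow> below \<beta> (sg j I g)"
  by (simp add: below_def)

lemma below_kd:
  assumes "\<And>I. below \<beta> (z I)"
  shows "below (\<beta> + 1) (fl.kd J z I)"
  unfolding fl.kd_def using assms
  by (auto intro!: below_sum below_sg below_full below_zero)

text \<open>The leading part of a chain of too high weight is a cycle for the leading forms, hence a boundary;
  subtracting the corresponding boundary lowers the weight.\<close>

lemma strict_chain:
  assumes nd: "nondegenerate f"
  shows "fl.chain J (Suc 0) z \<Longrightarrow> below \<alpha> (fl.kd J z {}) \<Longrightarrow>
    \<exists>z'. fl.chain J (Suc 0) z' \<and> fl.kd J z' = fl.kd J z \<and> (\<forall>I. below (\<alpha> - 1) (z' I))"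
proof (induction "card {x. \<alpha> - 1 < nu x \<and> (\<exists>I. \<exists>y\<in>Poly_Mapping.keys (z I). nu x \<le> nu y)}"
    arbitrary: z rule: less_induct)
  case less
  \<comment> \<open>The weights are real, so the induction runs on a finite set of exponents
    instead: those above the allowed weight but not above some weight that occurs.\<close>
  define S where "S z = {x. \<alpha> - 1 < nu x \<and> (\<exists>I. \<exists>y\<in>Poly_Mapping.keys (z I). nu x \<le> nu y)}"
    for z :: "nat set \<Rightarrow> 'n cpoly"
  define Y where "Y = (\<Union>I\<in>Pow J. Poly_Mapping.keys (z I))"
  have finY: "finite Y" unfolding Y_def using finite_J by (intro finite_UN_I) auto
  have inY: "y \<in> Y" if "y \<in> Poly_Mapping.keys (z I)" for y I
  proof -
    have "z I \<noteq> 0" using that by auto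
    then have "I \<subseteq> J" using fl.chain_eq_0[OF less.prems(1), of I] by blast
    then show ?thesis using that by (auto simp: Y_def)
  qed
  show ?case
  proof (cases "\<forall>I. below (\<alpha> - 1) (z I)")
    case True
    then show ?thesis using less.prems(1) by (intro exI[of _ z]) simp
  next
    case False
    then obtain I0 y0 where y0: "y0 \<in> Poly_Mapping.keys (z I0)" "\<alpha> - 1 < nu y0"
      by (auto simp: below_def not_le)
    define \<beta> where "\<beta> = Max (nu ` Y)"
    have ne: "Y \<noteq> {}" using inY[OF y0(1)] by blast
    have le\<beta>: "nu y \<le> \<beta>" if "y \<in> Poly_Mapping.keys (z I)" for y I
      unfolding \<beta>_def using finY inY[OF that] by (intro Max_ge) auto
    have "\<beta> \<in> nu ` Y" unfolding \<beta>_def using finY ne by (intro Max_in) auto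
    then obtain I1 y1 where y1: "y1 \<in> Poly_Mapping.keys (z I1)" "nu y1 = \<beta>" by (auto simp: Y_def)
    have \<beta>: "\<alpha> - 1 < \<beta>" using y0(2) le\<beta>[OF y0(1)] by simp
    have bz: "below \<beta> (z I)" for I using le\<beta> by (auto simp: below_def)
    define t where "t = (\<lambda>I. gpart \<beta> (z I))"
    have ct: "gr.chain J (Suc 0) t"
      by (rule gr.chainI) (simp_all add: t_def fl.chain_eq_0[OF less.prems(1)] gpart_zero)
    have "gr.kd J t = (\<lambda>_. 0)"
    proof
      fix I
      have e: "gr.kd J t I = gpart (\<beta> + 1) (fl.kd J z I)" unfolding t_def using gpart_kd[OF bz] by simp
      show "gr.kd J t I = 0"
      proof (cases "I = {}")
        case True
        have "gpart (\<beta> + 1) (fl.kd J z {}) = 0"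
          unfolding gpart_def using less.prems(2) \<beta> by (intro pm_filter_eq_0) (auto simp: below_def)
        then show ?thesis using e True by simp
      next
        case False
        have "fl.kd J z I = 0"
        proof (rule fl.chain_eq_0[OF fl.chain_kd[OF finite_J less.prems(1)]])
          show "\<not> (I \<subseteq> J \<and> card I = 0)" using False finite_subset[OF _ finite_J, of I] by auto
        qed
        then show ?thesis using e by (simp add: gpart_zero)
      qed
    qed
    then have "gr.boundary J (Suc 0) t"
      by (rule gr.acyclic_atD[OF acyclic_subset[OF nd subset_refl] ct])
    then obtain v where v: "gr.chain J (Suc (Suc 0)) v" "gr.kd J v = t" by (rule gr.boundaryE)
    \<comment> \<open>Only the component of weight \<beta> - 1 contributes to \<open>t\<close>;
      dropping the rest keeps the correction at weight at most \<beta>.\<close>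
    define v' where "v' = (\<lambda>I. gpart (\<beta> - 1) (v I))"
    have cv: "fl.chain J (Suc (Suc 0)) v'"
      by (rule fl.chainI) (simp_all add: v'_def gr.chain_eq_0[OF v(1)] gpart_zero)
    have bv: "below (\<beta> - 1) (v' I)" for I unfolding v'_def by (rule below_gpiece[OF gpart_mem])
    have gv: "(\<lambda>I. gpart (\<beta> - 1) (v' I)) = v'" unfolding v'_def by (simp add: gpart_id gpart_mem)
    have "gr.kd J v' = (\<lambda>I. gpart \<beta> (gr.kd J v I))"
    proof -
      have "(\<lambda>x. 1 + nu x = \<beta>) = (\<lambda>x. nu x = \<beta> - 1)" by auto
      then show ?thesis
        using gr_filter[OF subset_refl, of "\<lambda>r. r = \<beta>" v] by (simp add: v'_def gpart_def)
    qed
    also have "\<dots> = t" unfolding v(2) t_def by (simp add: gpart_id gpart_mem)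
    finally have kv: "gr.kd J v' = t" .
    define z' where "z' = (\<lambda>I. z I - fl.kd J v' I)"
    have cz': "fl.chain J (Suc 0) z'"
      unfolding z'_def by (intro fl.chain_diff less.prems(1) fl.chain_kd finite_J cv)
    have kz': "fl.kd J z' = fl.kd J z"
      unfolding z'_def fl.kd_diff fl.kd_kd[OF finite_J] by simp
    have bz': "below \<beta> (z' I)" for I
      unfolding z'_def using below_kd[where I = I, OF bv] bz by (intro below_diff) simp_all
    have "gpart \<beta> (z' I) = 0" for I
    proof -
      have "gpart \<beta> (fl.kd J v' I) = t I"
        using gpart_kd[where I = I, OF bv] by (simp add: gv kv)
      then show ?thesis unfolding z'_def by (simp add: gpart_def pm_filter_diff t_def)
    qed
    then have lt: "nu y < \<beta>" if "y \<in> Poly_Mapping.keys (z' I)" for y I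
    proof -
      have "nu y \<noteq> \<beta>"
      proof
        assume "nu y = \<beta>"
        then have "y \<in> Poly_Mapping.keys (gpart \<beta> (z' I))" using that by (simp add: gpart_def keys_pm_filter)
        then show False using \<open>\<And>I. gpart \<beta> (z' I) = 0\<close> by simp
      qed
      then show ?thesis using bz'[of I] that by (fastforce simp: below_def)
    qed
    have "S z' \<subset> S z"
    proof
      show "S z' \<subseteq> S z"
      proof
        fix x assume "x \<in> S z'"
        then obtain I y where x: "\<alpha> - 1 < nu x" "y \<in> Poly_Mapping.keys (z' I)" "nu x \<le> nu y" by (auto simp: S_def)
        then have "nu x \<le> nu y1" using lt[OF x(2)] y1(2) by simp
        then show "x \<in> S z" using x(1) y1(1) by (auto simp: S_def)
      qed
      have "y1 \<in> S z" using y1 \<beta> by (auto simp: S_def)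
      moreover have "y1 \<notin> S z'" using lt y1(2) by (fastforce simp: S_def)
      ultimately show "S z' \<noteq> S z" by blast
    qed
    moreover have "finite (S z)"
    proof (rule finite_subset[OF _ finite_nu_le[of \<beta>]])
      show "S z \<subseteq> {x. nu x \<le> \<beta>}" using le\<beta> by (fastforce simp: S_def)
    qed
    ultimately have "card (S z') < card (S z)" by (intro psubset_card_mono)
    then obtain z'' where "fl.chain J (Suc 0) z''" "fl.kd J z'' = fl.kd J z'" "\<forall>I. below (\<alpha> - 1) (z'' I)"
      using less.hyps[of z'] cz' kz' less.prems(2) unfolding S_def by auto
    then show ?thesis using kz' by (intro exI[of _ z'']) simp
  qed
qed

definition ideal_elements :: "'n cpoly set" where
  "ideal_elements = range (\<lambda>h. \<Sum>j\<in>J. full j * h j)"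

text \<open>Any expression of \<open>g\<close> by the generators is a chain of degree 1, and
  \<open>strict_chain\<close> lowers its weights without changing its boundary.\<close>

lemma strictness:
  assumes nd: "nondegenerate f" and g: "g \<in> ideal_elements" "below \<alpha> g"
  shows "\<exists>h. g = (\<Sum>j\<in>J. full j * h j) \<and> (\<forall>j. below (\<alpha> - 1) (h j))"
proof -
  have "fl.boundary J 0 (fl.degree0 g)"
    unfolding fl.boundary_degree0[OF finite_J] using g(1) by (auto simp: ideal_elements_def)
  then obtain z where z: "fl.chain J (Suc 0) z" "fl.kd J z = fl.degree0 g" by (rule fl.boundaryE)
  have "fl.kd J z {} = g" by (simp add: z(2) fl.degree0_def)
  then obtain z' where z': "fl.kd J z' = fl.kd J z" "\<forall>I. below (\<alpha> - 1) (z' I)"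
    using strict_chain[OF nd z(1)] g(2) by blast
  have "g = fl.kd J z' {}" by (simp add: z' z(2) fl.degree0_def)
  also have "\<dots> = (\<Sum>j\<in>J. full j * z' {j})" by (simp add: fl.kd_def sg_def)
  finally show ?thesis using z'(2) by (intro exI[of _ "\<lambda>j. z' {j}"]) simp
qed

text \<open>In one direction strictness puts the cofactors of \<open>l\<close> in weight at most
  \<alpha> - 1, so that leading parts multiply. In the other, homogeneous cofactors for the leading
  forms are used for the full derivatives as well.\<close>

lemma leading_form_ideal:
  assumes nd: "nondegenerate f" and g: "below \<alpha> g"
  shows "(\<exists>l\<in>ideal_elements. below \<alpha> (g - l) \<and> gpart \<alpha> (g - l) = 0) \<longleftrightarrow> gpart \<alpha> g \<in> gideal J gens"
proof
  assume "\<exists>l\<in>ideal_elements. below \<alpha> (g - l) \<and> gpart \<alpha> (g - l) = 0"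
  then obtain l where l: "l \<in> ideal_elements" "below \<alpha> (g - l)" "gpart \<alpha> (g - l) = 0" by blast
  have "below \<alpha> (g - (g - l))" using g l(2) by (rule below_diff)
  then obtain h where h: "l = (\<Sum>j\<in>J. full j * h j)" "\<forall>j. below (\<alpha> - 1) (h j)"
    using strictness[OF nd l(1)] by auto
  have "gpart \<alpha> g = gpart \<alpha> l" using l(3) by (simp add: gpart_def pm_filter_diff)
  also have "\<dots> = (\<Sum>j\<in>J. gpart \<alpha> (full j * h j))"
    unfolding h(1) by (rule additive_sum) (rule gpart_add)
  also have "\<dots> = (\<Sum>j\<in>J. gmul (gens j) (gpart (\<alpha> - 1) (h j)))"
    using gpart_full_mult[of _ "\<alpha> - 1"] h(2) by (intro sum.cong) auto
  finally show "gpart \<alpha> g \<in> gideal J gens" by (rule gidealI)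
next
  assume "gpart \<alpha> g \<in> gideal J gens"
  then obtain h where h: "gpart \<alpha> g = (\<Sum>j\<in>J. gmul (gens j) (h j))" by (auto simp: gideal_def)
  define h' where "h' j = gpart (\<alpha> - 1) (h j)" for j
  have bh: "below (\<alpha> - 1) (h' j)" for j unfolding h'_def by (rule below_gpiece[OF gpart_mem])
  have "gpart \<alpha> g = gpart \<alpha> (gpart \<alpha> g)" by (simp add: gpart_id gpart_mem)
  also have "\<dots> = (\<Sum>j\<in>J. gpart \<alpha> (gmul (gens j) (h j)))"
    unfolding h by (rule additive_sum) (rule gpart_add)
  also have "\<dots> = (\<Sum>j\<in>J. gmul (gens j) (gpart (\<alpha> - 1) (h' j)))"
    by (intro sum.cong refl) (simp add: gpart_gmul h'_def gpart_id gpart_mem)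
  also have "\<dots> = (\<Sum>j\<in>J. gpart \<alpha> (full j * h' j))"
    using gpart_full_mult[OF _ bh] by (intro sum.cong) auto
  also have "\<dots> = gpart \<alpha> (\<Sum>j\<in>J. full j * h' j)"
    by (rule additive_sum[symmetric]) (rule gpart_add)
  finally have "gpart \<alpha> (g - (\<Sum>j\<in>J. full j * h' j)) = 0" by (simp add: gpart_def pm_filter_diff)
  moreover have "below \<alpha> (g - (\<Sum>j\<in>J. full j * h' j))"
    using below_full[OF bh] by (intro below_diff g below_sum) simp
  ultimately show "\<exists>l\<in>ideal_elements. below \<alpha> (g - l) \<and> gpart \<alpha> (g - l) = 0"
    by (intro bexI[of _ "\<Sum>j\<in>J. full j * h' j"]) (auto simp: ideal_elements_def)
qed

end

section \<open>The graded pieces and the spectrum\<close>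

text \<open>Describes \<open>Q\<close> by representatives, with \<open>K\<close> the kernel of
  \<open>\<pi>\<close> on \<open>X\<close>. The nested cosets of \<open>graded_piece\<close> enter
  the dimension count only through these rules.\<close>

locale vector_quotient = quotient_space scale
  for scale :: "'a::field \<Rightarrow> 'b::ab_group_add \<Rightarrow> 'b" +
  fixes Q :: "('a, 'q) module" and \<pi> :: "'b \<Rightarrow> 'q" and X K :: "'b set"
  assumes subspaces: "subspace X" "subspace K" "K \<subseteq> X"
    and carrier: "carrier Q = \<pi> ` X" and zero: "zero Q = \<pi> 0"
    and add: "\<And>a b. a \<in> X \<Longrightarrow> b \<in> X \<Longrightarrow> add Q (\<pi> a) (\<pi> b) = \<pi> (a + b)"
    and smult: "\<And>c a. a \<in> X \<Longrightarrow> smult Q c (\<pi> a) = \<pi> (scale c a)"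
    and kernel: "\<And>a b. a \<in> X \<Longrightarrow> b \<in> X \<Longrightarrow> \<pi> a = \<pi> b \<longleftrightarrow> a - b \<in> K"
begin

lemma combination_mem: "C \<subseteq> X \<Longrightarrow> (\<Sum>b\<in>C. scale (c b) b) \<in> X"
  by (intro subspace_sum subspace_scale subspaces) auto

sublocale Q: abelian_monoid Q
proof (rule abelian_monoidI)
  show "zero Q \<in> carrier Q" using subspace_0[OF subspaces(1)] by (simp add: carrier zero)
  fix x y z assume "x \<in> carrier Q" "y \<in> carrier Q" "z \<in> carrier Q"
  then obtain a b c where abc: "x = \<pi> a" "y = \<pi> b" "z = \<pi> c" "a \<in> X" "b \<in> X" "c \<in> X"
    by (auto simp: carrier)
  then have "a + b \<in> X" "b + c \<in> X" "0 \<in> X" using subspaces(1) by (simp_all add: subspace_add subspace_0)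
  then show "add Q x y \<in> carrier Q" "add Q (add Q x y) z = add Q x (add Q y z)"
    "add Q (zero Q) x = x" "add Q x y = add Q y x"
    using abc by (simp_all add: add carrier zero ac_simps)
qed

lemma finsum_combination:
  assumes "finite S" "\<And>s. s \<in> S \<Longrightarrow> r s \<in> X" "\<And>s. s \<in> S \<Longrightarrow> \<pi> (r s) = s"
  shows "finsum Q (\<lambda>s. smult Q (c s) s) S = \<pi> (\<Sum>s\<in>S. scale (c s) (r s))"
  using assms
proof (induction S rule: finite_induct)
  case empty
  then show ?case by (simp add: zero)
next
  case (insert s S)
  have sm: "smult Q (c t) t = \<pi> (scale (c t) (r t))" "scale (c t) (r t) \<in> X" if "t \<in> insert s S" for t
    using smult[of "r t" "c t"] insert.prems that subspace_scale[OF subspaces(1)] by auto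
  then have "(\<lambda>t. smult Q (c t) t) \<in> S \<rightarrow> carrier Q" "smult Q (c s) s \<in> carrier Q"
    by (auto simp: carrier)
  then have "finsum Q (\<lambda>t. smult Q (c t) t) (insert s S) =
      add Q (smult Q (c s) s) (finsum Q (\<lambda>t. smult Q (c t) t) S)"
    using insert.hyps by (intro Q.finsum_insert)
  also have "finsum Q (\<lambda>t. smult Q (c t) t) S = \<pi> (\<Sum>t\<in>S. scale (c t) (r t))"
    using insert by simp
  also have "smult Q (c s) s = \<pi> (scale (c s) (r s))" using sm by simp
  also have "add Q (\<pi> (scale (c s) (r s))) (\<pi> (\<Sum>t\<in>S. scale (c t) (r t))) =
      \<pi> (scale (c s) (r s) + (\<Sum>t\<in>S. scale (c t) (r t)))"
    using sm by (intro add subspace_sum subspaces) auto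
  finally show ?case using insert.hyps by simp
qed

lemma complement_basis_inj:
  assumes C: "complement_basis X K C"
  shows "inj_on \<pi> C"
proof (rule inj_onI, rule ccontr)
  note CX = complement_basis_subset[OF C] and finC = complement_basis_finite[OF C]
  fix a b assume ab: "a \<in> C" "b \<in> C" "\<pi> a = \<pi> b" "a \<noteq> b"
  define c :: "'b \<Rightarrow> 'a" where "c e = (if e = a then 1 else if e = b then - 1 else 0)" for e
  have "(\<Sum>e\<in>C. scale (c e) e) = (\<Sum>e\<in>{a, b}. scale (c e) e)"
    using ab finC by (intro sum.mono_neutral_right) (auto simp: c_def)
  also have "\<dots> = a - b" using ab by (simp add: c_def)
  also have "\<dots> \<in> K" using kernel[of a b] ab CX by auto
  finally have "c a = 0" using ab by (intro complement_basis_ind[OF C])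
  then show False by (simp add: c_def)
qed

lemma finite_basis_of_complement:
  assumes C: "complement_basis X K C"
  shows "finite_basis Q (\<pi> ` C)"
proof -
  note CX = complement_basis_subset[OF C] and finC = complement_basis_finite[OF C]
  note inj = complement_basis_inj[OF C]
  have comb: "finsum Q (\<lambda>s. smult Q (c s) s) (\<pi> ` C) = \<pi> (\<Sum>b\<in>C. scale (c (\<pi> b)) b)" for c
  proof -
    have "finsum Q (\<lambda>s. smult Q (c s) s) (\<pi> ` C) = \<pi> (\<Sum>s\<in>\<pi> ` C. scale (c s) (inv_into C \<pi> s))"
      using finC CX by (intro finsum_combination) (auto simp: f_inv_into_f inv_into_into subsetD)
    also have "(\<Sum>s\<in>\<pi> ` C. scale (c s) (inv_into C \<pi> s)) = (\<Sum>b\<in>C. scale (c (\<pi> b)) b)"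
      using inj by (simp add: sum.reindex)
    finally show ?thesis .
  qed
  show ?thesis
    unfolding finite_basis_def
  proof (intro conjI ballI)
    show "finite (\<pi> ` C)" "\<pi> ` C \<subseteq> carrier Q" using finC CX by (auto simp: carrier)
    fix v assume "v \<in> carrier Q"
    then obtain u where u: "u \<in> X" "v = \<pi> u" by (auto simp: carrier)
    obtain c where c: "u - (\<Sum>b\<in>C. scale (c b) b) \<in> K" using complement_basis_gen[OF C u(1)] .
    show "\<exists>!c. c \<in> extensional (\<pi> ` C) \<and> v = finsum Q (\<lambda>s. smult Q (c s) s) (\<pi> ` C)"
    \<comment> \<open>Coefficients are unique only as functions fixed off the basis, hence the
      restriction.\<close>
    proof (rule ex1I[of _ "restrict (\<lambda>s. c (inv_into C \<pi> s)) (\<pi> ` C)"])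
      have "(\<Sum>b\<in>C. scale (restrict (\<lambda>s. c (inv_into C \<pi> s)) (\<pi> ` C) (\<pi> b)) b) = (\<Sum>b\<in>C. scale (c b) b)"
        using inj by (intro sum.cong) auto
      moreover have "\<pi> u = \<pi> (\<Sum>b\<in>C. scale (c b) b)"
        using c kernel[OF u(1) combination_mem[OF CX]] by simp
      ultimately show "restrict (\<lambda>s. c (inv_into C \<pi> s)) (\<pi> ` C) \<in> extensional (\<pi> ` C) \<and>
          v = finsum Q (\<lambda>s. smult Q (restrict (\<lambda>s. c (inv_into C \<pi> s)) (\<pi> ` C) s) s) (\<pi> ` C)"
        unfolding comb u(2) by simp
      fix d assume d: "d \<in> extensional (\<pi> ` C) \<and> v = finsum Q (\<lambda>s. smult Q (d s) s) (\<pi> ` C)"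
      then have "\<pi> (\<Sum>b\<in>C. scale (d (\<pi> b)) b) = \<pi> (\<Sum>b\<in>C. scale (c b) b)"
        using \<open>\<pi> u = \<pi> (\<Sum>b\<in>C. scale (c b) b)\<close> u(2) by (simp add: comb)
      then have "(\<Sum>b\<in>C. scale (d (\<pi> b)) b) - (\<Sum>b\<in>C. scale (c b) b) \<in> K"
        by (simp only: kernel[OF combination_mem[OF CX] combination_mem[OF CX]])
      also have "(\<Sum>b\<in>C. scale (d (\<pi> b)) b) - (\<Sum>b\<in>C. scale (c b) b) = (\<Sum>b\<in>C. scale (d (\<pi> b) - c b) b)"
        by (simp add: scale_left_diff_distrib sum_subtractf)
      finally have dc: "d (\<pi> b) - c b = 0" if "b \<in> C" for b
        using complement_basis_ind[OF C, of "\<lambda>b. d (\<pi> b) - c b" b] that by simp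
      show "d = restrict (\<lambda>s. c (inv_into C \<pi> s)) (\<pi> ` C)"
      proof (rule extensionalityI[of _ "\<pi> ` C"])
        show "d s = restrict (\<lambda>s. c (inv_into C \<pi> s)) (\<pi> ` C) s" if s: "s \<in> \<pi> ` C" for s
          using s dc inj by auto
      qed (use d in auto)
    qed
  qed
qed

text \<open>Makes \<open>dimension_of\<close> well defined: every basis lifts to a complement basis,
  whose size is determined by the dimensions of \<open>X\<close> and \<open>K\<close>.\<close>

lemma complement_of_finite_basis:
  assumes S: "finite_basis Q S"
  shows "\<exists>C. complement_basis X K C \<and> card C = card S"
proof -
  have finS: "finite S" and SX: "S \<subseteq> \<pi> ` X" using S by (auto simp: finite_basis_def carrier)
  have uniq: "\<exists>!c. c \<in> extensional S \<and> v = finsum Q (\<lambda>s. smult Q (c s) s) S" if "v \<in> carrier Q" for v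
    using S that by (simp add: finite_basis_def)
  define r where "r = inv_into X \<pi>"
  have r: "r s \<in> X" "\<pi> (r s) = s" if "s \<in> S" for s
    using that SX by (auto simp: r_def inv_into_into f_inv_into_f subsetD)
  have inj: "inj_on r S" by (rule inj_onI) (metis r(2))
  have comb: "finsum Q (\<lambda>s. smult Q (c s) s) S = \<pi> (\<Sum>s\<in>S. scale (c s) (r s))" for c
    using finS r by (intro finsum_combination)
  define C where "C = r ` S"
  have CX: "C \<subseteq> X" using r by (auto simp: C_def)
  have sumC: "(\<Sum>b\<in>C. scale (c b) b) = (\<Sum>s\<in>S. scale (c (r s)) (r s))" for c
    unfolding C_def using inj by (simp add: sum.reindex)
  have "complement_basis X K C"
    unfolding complement_basis_def
  proof (intro conjI ballI allI impI)
    show "finite C" using finS by (simp add: C_def)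
    show "C \<subseteq> X" by (rule CX)
    fix u assume u: "u \<in> X"
    then have "\<pi> u \<in> carrier Q" by (simp add: carrier)
    then obtain c where c: "\<pi> u = \<pi> (\<Sum>s\<in>S. scale (c s) (r s))" using uniq[of "\<pi> u"] comb by auto
    have "(\<Sum>b\<in>C. scale (c (\<pi> b)) b) = (\<Sum>s\<in>S. scale (c s) (r s))"
      unfolding sumC using r by (intro sum.cong) auto
    then have "\<pi> u = \<pi> (\<Sum>b\<in>C. scale (c (\<pi> b)) b)" using c by simp
    then have "u - (\<Sum>b\<in>C. scale (c (\<pi> b)) b) \<in> K"
      by (simp only: kernel[OF u combination_mem[OF CX]])
    then show "\<exists>c. u - (\<Sum>b\<in>C. scale (c b) b) \<in> K" by (rule exI[of _ "\<lambda>b. c (\<pi> b)"])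
  next
    fix c b assume c: "(\<Sum>b\<in>C. scale (c b) b) \<in> K" and b: "b \<in> C"
    have X0: "0 \<in> X" using subspaces(1) by (rule subspace_0)
    have "\<pi> (\<Sum>b\<in>C. scale (c b) b) = \<pi> 0"
      using kernel[OF combination_mem[OF CX] X0, of c] c by simp
    then have z: "\<pi> (\<Sum>s\<in>S. scale (c (r s)) (r s)) = \<pi> 0" by (simp add: sumC)
    define d where "d = restrict (\<lambda>s. c (r s)) S"
    define e where "e = restrict (\<lambda>s. 0 :: 'a) S"
    have "finsum Q (\<lambda>s. smult Q (d s) s) S = \<pi> 0"
      unfolding comb z[symmetric] by (intro arg_cong[of _ _ \<pi>] sum.cong) (auto simp: d_def)
    moreover have "finsum Q (\<lambda>s. smult Q (e s) s) S = \<pi> 0"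
      unfolding comb by (intro arg_cong[of _ _ \<pi>] sum.neutral) (auto simp: e_def)
    moreover have "d \<in> extensional S" "e \<in> extensional S" by (simp_all add: d_def e_def)
    moreover have "\<pi> 0 \<in> carrier Q" using X0 by (simp add: carrier)
    ultimately have "d = e" using uniq[of "\<pi> 0"] by metis
    obtain s where s: "s \<in> S" "b = r s" using b by (auto simp: C_def)
    then show "c b = 0" using fun_cong[OF \<open>d = e\<close>, of s] by (simp add: d_def e_def)
  qed
  moreover have "card C = card S" unfolding C_def using inj by (rule card_image)
  ultimately show ?thesis by blast
qed

lemma dimension_of_quotient:
  assumes C: "complement_basis X K C" and fin: "finite G" "X \<subseteq> span G"
  shows "finite_dimensional Q" "dimension_of Q = card C"
proof -
  have basis: "finite_basis Q (\<pi> ` C)" by (rule finite_basis_of_complement[OF C])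
  then show "finite_dimensional Q" by (auto simp: finite_dimensional_def)
  have dim: "card D = dim X - dim K" if "complement_basis X K D" for D
    using complement_basis_dim[OF that fin subspaces(2,3,1)] by simp
  have card: "card S = card C" if "finite_basis Q S" for S
  proof -
    obtain D where "complement_basis X K D" "card D = card S" using complement_of_finite_basis[OF \<open>finite_basis Q S\<close>] by blast
    then show ?thesis using dim[of D] dim[OF C] by simp
  qed
  show "dimension_of Q = card C"
    unfolding dimension_of_def
  proof (rule the_equality)
    show "\<exists>S. finite_basis Q S \<and> card S = card C"
      using basis card by blast
    fix d assume "\<exists>S. finite_basis Q S \<and> card S = d"
    then show "d = card C" using card by blast
  qed
qed

end

lemma carrier_cpoly: "carrier cpoly_algebra = UNIV"
  and add_cpoly: "add cpoly_algebra = (+)"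
  and zero_cpoly: "zero cpoly_algebra = 0"
  and mult_cpoly: "mult cpoly_algebra = (*)"
  and one_cpoly: "one cpoly_algebra = 1"
  and smult_cpoly: "smult cpoly_algebra = cscale"
  by (simp_all add: cpoly_algebra_def cscale_def fun_eq_iff)

lemmas cpoly_simps = carrier_cpoly add_cpoly zero_cpoly mult_cpoly one_cpoly smult_cpoly

lemma cring_cpoly: "cring (cpoly_algebra :: (complex, 'n::finite cpoly) module)"
proof (rule cringI)
  show "abelian_group (cpoly_algebra :: (complex, 'n cpoly) module)"
  proof (rule abelian_groupI)
    fix x :: "'n cpoly"
    have "add cpoly_algebra (- x) x = zero cpoly_algebra" by (simp add: cpoly_simps)
    then show "\<exists>y\<in>carrier cpoly_algebra. add cpoly_algebra y x = zero cpoly_algebra"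
      by (intro bexI[of _ "- x"]) (simp_all add: cpoly_simps)
  qed (simp_all add: cpoly_simps ac_simps)
  show "comm_monoid (cpoly_algebra :: (complex, 'n cpoly) module)"
    by (rule comm_monoidI) (simp_all add: cpoly_simps ac_simps)
qed (simp add: cpoly_simps distrib_right)

section \<open>The toric ideal and its residue classes\<close>

context convenient_poly
begin

lemma sum_full: "(\<Sum>j\<in>J. full j * h (idx j)) = (\<Sum>i\<in>UNIV. log_partial i f * h i)"
  unfolding full_def J_def by (rule sum.reindex_bij_betw[OF bij_idx])

lemma ideal_elements_eq: "ideal_elements = range (\<lambda>h. \<Sum>i\<in>UNIV. log_partial i f * h i)"
proof (intro equalityI subsetI)
  fix g assume "g \<in> ideal_elements"
  then obtain h where h: "g = (\<Sum>j\<in>J. full j * h j)" by (auto simp: ideal_elements_def)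
  have inj: "inj_on idx J" using bij_idx by (simp add: bij_betw_def J_def)
  have "g = (\<Sum>j\<in>J. full j * h (inv_into J idx (idx j)))"
    unfolding h using inj by (intro sum.cong) auto
  then show "g \<in> range (\<lambda>h. \<Sum>i\<in>UNIV. log_partial i f * h i)"
    using sum_full[of "\<lambda>i. h (inv_into J idx i)"] by auto
next
  fix g assume "g \<in> range (\<lambda>h. \<Sum>i\<in>UNIV. log_partial i f * h i)"
  then obtain h where "g = (\<Sum>j\<in>J. full j * h (idx j))" unfolding sum_full by blast
  then show "g \<in> ideal_elements" by (simp add: ideal_elements_def)
qed

lemma ideal_elementsI: "(\<Sum>j\<in>J. full j * h j) \<in> ideal_elements"
  by (simp add: ideal_elements_def)

lemma ideal_elements_add:
  assumes "a \<in> ideal_elements" "b \<in> ideal_elements"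
  shows "a + b \<in> ideal_elements"
proof -
  obtain h h' where "a = (\<Sum>j\<in>J. full j * h j)" "b = (\<Sum>j\<in>J. full j * h' j)"
    using assms by (auto simp: ideal_elements_def)
  then show ?thesis
    using ideal_elementsI[of "\<lambda>j. h j + h' j"] by (simp add: distrib_left sum.distrib)
qed

lemma ideal_elements_mult:
  assumes "a \<in> ideal_elements"
  shows "c * a \<in> ideal_elements"
proof -
  obtain h where "a = (\<Sum>j\<in>J. full j * h j)" using assms by (auto simp: ideal_elements_def)
  then show ?thesis
    using ideal_elementsI[of "\<lambda>j. c * h j"] by (simp add: sum_distrib_left ac_simps)
qed

lemma ideal_elements_uminus: "a \<in> ideal_elements \<Longrightarrow> - a \<in> ideal_elements"
  using ideal_elements_mult[of a "- 1"] by simp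

lemma ideal_elements_zero: "0 \<in> ideal_elements"
  using ideal_elementsI[of "\<lambda>_. 0"] by simp

lemma toric_ideal_eq: "toric_ideal f = ideal_elements"
proof -
  interpret A: cring "cpoly_algebra :: (complex, 'n cpoly) module" by (rule cring_cpoly)
  have ideal: "ideal ideal_elements (cpoly_algebra :: (complex, 'n cpoly) module)"
  proof (rule idealI[OF A.ring_axioms])
    have inv: "inv\<^bsub>add_monoid cpoly_algebra\<^esub> a = - a" for a :: "'n cpoly"
      using A.minus_equality[of "- a" a] by (simp add: cpoly_simps a_inv_def)
    show "subgroup ideal_elements (add_monoid (cpoly_algebra :: (complex, 'n cpoly) module))"
    proof (rule subgroup.intro)
      show "inv\<^bsub>add_monoid cpoly_algebra\<^esub> x \<in> ideal_elements" if "x \<in> ideal_elements" for x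
        unfolding inv using that by (rule ideal_elements_uminus)
    qed (simp_all add: cpoly_simps ideal_elements_add ideal_elements_zero)
    fix a x assume "a \<in> ideal_elements"
    then show "x \<otimes>\<^bsub>cpoly_algebra\<^esub> a \<in> ideal_elements" "a \<otimes>\<^bsub>cpoly_algebra\<^esub> x \<in> ideal_elements"
      using ideal_elements_mult[of a x] by (simp_all add: cpoly_simps mult.commute[of a x])
  qed
  show ?thesis
  proof (rule equalityI)
    have "log_partial i f \<in> ideal_elements" for i
    proof -
      have "(\<Sum>k\<in>UNIV. log_partial k f * of_bool (k = i)) = log_partial i f"
        by (simp add: of_bool_def if_distrib cong: if_cong)
      then show ?thesis
        unfolding ideal_elements_eq by (intro range_eqI[where x = "\<lambda>k. of_bool (k = i)"]) simp
    qed
    then have "range (\<lambda>i. log_partial i f) \<subseteq> ideal_elements" by blast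
    then show "toric_ideal f \<subseteq> ideal_elements"
      unfolding toric_ideal_def by (rule A.genideal_minimal[OF ideal])
    have I: "ideal (toric_ideal f) (cpoly_algebra :: (complex, 'n cpoly) module)"
      unfolding toric_ideal_def by (rule A.genideal_ideal) (simp add: cpoly_simps)
    have gen: "log_partial i f \<in> toric_ideal f" for i
      using A.genideal_self[of "range (\<lambda>i. log_partial i f)"] by (auto simp: cpoly_simps toric_ideal_def)
    have "g * h \<in> toric_ideal f" if "g \<in> toric_ideal f" for g h
      using ideal.I_r_closed[OF I that, of h] by (simp add: cpoly_simps)
    moreover have "a + b \<in> toric_ideal f" if "a \<in> toric_ideal f" "b \<in> toric_ideal f" for a b
      using additive_subgroup.a_closed[OF ideal.axioms(1)[OF I] that] by (simp add: cpoly_simps)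
    moreover have "0 \<in> toric_ideal f"
      using additive_subgroup.zero_closed[OF ideal.axioms(1)[OF I]] by (simp add: cpoly_simps)
    ultimately have "(\<Sum>i\<in>Y. log_partial i f * h i) \<in> toric_ideal f" for h and Y :: "'n set"
      using gen by (induction Y rule: infinite_finite_induct) auto
    then show "ideal_elements \<subseteq> toric_ideal f" by (auto simp: ideal_elements_eq)
  qed
qed

definition residue_class :: "'n cpoly \<Rightarrow> 'n cpoly set" where
  "residue_class g = (\<lambda>l. l + g) ` ideal_elements"

lemma residue_class_coset: "toric_ideal f +>\<^bsub>cpoly_algebra\<^esub> g = residue_class g"
  by (auto simp: a_r_coset_def' residue_class_def toric_ideal_eq cpoly_simps)

lemma residue_class_eq_iff: "residue_class a = residue_class b \<longleftrightarrow> a - b \<in> ideal_elements"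
proof
  assume "residue_class a = residue_class b"
  moreover have "a \<in> residue_class a"
    unfolding residue_class_def by (rule image_eqI[of _ _ 0]) (simp_all add: ideal_elements_zero)
  ultimately obtain l where "l \<in> ideal_elements" "a = l + b" by (auto simp: residue_class_def)
  then show "a - b \<in> ideal_elements" by simp
next
  assume ab: "a - b \<in> ideal_elements"
  have "residue_class a \<subseteq> residue_class b" if "a - b \<in> ideal_elements" for a b
  proof
    fix x assume "x \<in> residue_class a"
    then obtain l where l: "l \<in> ideal_elements" "x = l + a" by (auto simp: residue_class_def)
    then have "x = (l + (a - b)) + b" "l + (a - b) \<in> ideal_elements"
      using that by (simp_all add: ideal_elements_add)
    then show "x \<in> residue_class b" unfolding residue_class_def by blast
  qed
  moreover have "b - a \<in> ideal_elements" using ideal_elements_uminus[OF ab] by simp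
  ultimately show "residue_class a = residue_class b" using ab by blast
qed

lemma residue_class_mem: "x \<in> residue_class a \<longleftrightarrow> residue_class x = residue_class a"
proof -
  have "x \<in> residue_class a \<longleftrightarrow> x - a \<in> ideal_elements"
  proof
    assume "x - a \<in> ideal_elements"
    then show "x \<in> residue_class a" unfolding residue_class_def by (rule rev_image_eqI) simp
  qed (auto simp: residue_class_def)
  then show ?thesis by (simp add: residue_class_eq_iff)
qed

lemma residue_class_add: "set_add cpoly_algebra (residue_class a) (residue_class b) = residue_class (a + b)"
proof (intro equalityI subsetI)
  fix x assume "x \<in> set_add cpoly_algebra (residue_class a) (residue_class b)"
  then obtain l l' where l: "l \<in> ideal_elements" "l' \<in> ideal_elements" "x = (l + a) + (l' + b)"
    by (auto simp: set_add_def' residue_class_def cpoly_simps)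
  then have "x = (l + l') + (a + b)" "l + l' \<in> ideal_elements" by (simp_all add: ideal_elements_add)
  then show "x \<in> residue_class (a + b)" unfolding residue_class_def by blast
next
  fix x assume "x \<in> residue_class (a + b)"
  then obtain l where l: "l \<in> ideal_elements" "x = l + (a + b)" by (auto simp: residue_class_def)
  then have "x = (l + a) + (0 + b)" by simp
  then show "x \<in> set_add cpoly_algebra (residue_class a) (residue_class b)"
    unfolding set_add_def' cpoly_simps residue_class_def using l(1) ideal_elements_zero by blast
qed

text \<open>All members of a coset give the same coset after scaling, so the union in
  \<open>quotient_module\<close> is that single coset.\<close>

lemma residue_class_smult:
  "(\<Union>x\<in>residue_class a. toric_ideal f +>\<^bsub>cpoly_algebra\<^esub> (smult cpoly_algebra c x)) = residue_class (cscale c a)"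
proof -
  have "residue_class (cscale c x) = residue_class (cscale c a)" if "x \<in> residue_class a" for x
  proof -
    have "x - a \<in> ideal_elements" using that by (simp add: residue_class_mem residue_class_eq_iff)
    then have "cscale c (x - a) \<in> ideal_elements" unfolding cscale_def by (rule ideal_elements_mult)
    then show ?thesis by (simp add: residue_class_eq_iff cpm.scale_right_diff_distrib)
  qed
  moreover have "a \<in> residue_class a" by (simp add: residue_class_mem)
  ultimately show ?thesis unfolding residue_class_coset cpoly_simps by blast
qed

end

lemma poly_times_series_expand:
  assumes "finite Y" "Poly_Mapping.keys p \<subseteq> Y"
  shows "poly_times_series p s \<gamma> = (\<Sum>\<alpha>\<in>Y. Poly_Mapping.lookup p \<alpha> * s (\<gamma> - \<alpha>))"
  unfolding poly_times_series_def using assms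
  by (intro sum.mono_neutral_left) (auto simp: in_keys_iff)

text \<open>Turns powers of 1 - z into iterated differences, the shape of
  \<open>hilb_insert\<close>.\<close>

lemma poly_times_series_difference:
  "poly_times_series ((1 - Poly_Mapping.single 1 1) * p) s \<gamma> =
    poly_times_series p s \<gamma> - poly_times_series p s (\<gamma> - 1)"
proof -
  define q where "q = (1 - Poly_Mapping.single (1 :: rat) (1 :: int)) * p"
  define Y where "Y = Poly_Mapping.keys p \<union> (+) 1 ` Poly_Mapping.keys p"
  have q: "Poly_Mapping.lookup q \<alpha> = Poly_Mapping.lookup p \<alpha> - Poly_Mapping.lookup p (\<alpha> - 1)" for \<alpha>
  proof -
    have "Poly_Mapping.lookup (Poly_Mapping.single (1 :: rat) 1 * p) \<alpha> =
        (\<Sum>a. (\<Sum>k. Poly_Mapping.lookup p k when \<alpha> = a + k) when a = 1)"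
      unfolding times_poly_mapping.rep_eq prod_fun_def
      by (intro Sum_any.cong) (simp add: lookup_single when_def)
    also have "\<dots> = (\<Sum>k. Poly_Mapping.lookup p k when \<alpha> = 1 + k)" by simp
    also have "\<dots> = (\<Sum>k. Poly_Mapping.lookup p k when k = \<alpha> - 1)"
      by (rule Sum_any.cong) (auto simp: when_def)
    finally show ?thesis by (simp add: q_def left_diff_distrib lookup_minus)
  qed
  have fin: "finite Y" by (simp add: Y_def)
  have "Poly_Mapping.keys q \<subseteq> Y"
  proof
    fix \<alpha> assume "\<alpha> \<in> Poly_Mapping.keys q"
    then have "\<alpha> \<in> Poly_Mapping.keys p \<or> \<alpha> - 1 \<in> Poly_Mapping.keys p" by (auto simp: in_keys_iff q)
    then show "\<alpha> \<in> Y" unfolding Y_def by (auto intro!: image_eqI[of \<alpha> _ "\<alpha> - 1"])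
  qed
  then have "poly_times_series q s \<gamma> = (\<Sum>\<alpha>\<in>Y. Poly_Mapping.lookup q \<alpha> * s (\<gamma> - \<alpha>))"
    using fin by (intro poly_times_series_expand)
  also have "\<dots> = (\<Sum>\<alpha>\<in>Y. Poly_Mapping.lookup p \<alpha> * s (\<gamma> - \<alpha>)) -
      (\<Sum>\<alpha>\<in>Y. Poly_Mapping.lookup p (\<alpha> - 1) * s (\<gamma> - \<alpha>))"
    by (simp add: q left_diff_distrib sum_subtractf)
  also have "(\<Sum>\<alpha>\<in>Y. Poly_Mapping.lookup p \<alpha> * s (\<gamma> - \<alpha>)) = poly_times_series p s \<gamma>"
    using fin by (intro poly_times_series_expand[symmetric]) (auto simp: Y_def)
  also have "(\<Sum>\<alpha>\<in>Y. Poly_Mapping.lookup p (\<alpha> - 1) * s (\<gamma> - \<alpha>)) =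
      (\<Sum>\<alpha>\<in>(+) 1 ` Poly_Mapping.keys p. Poly_Mapping.lookup p (\<alpha> - 1) * s (\<gamma> - \<alpha>))"
  proof (rule sum.mono_neutral_right[OF fin])
    show "\<forall>\<alpha>\<in>Y - (+) 1 ` Poly_Mapping.keys p. Poly_Mapping.lookup p (\<alpha> - 1) * s (\<gamma> - \<alpha>) = 0"
    proof
      fix \<alpha> assume "\<alpha> \<in> Y - (+) 1 ` Poly_Mapping.keys p"
      then have "\<alpha> - 1 \<notin> Poly_Mapping.keys p" using image_eqI[of \<alpha> "(+) 1" "\<alpha> - 1"] by auto
      then show "Poly_Mapping.lookup p (\<alpha> - 1) * s (\<gamma> - \<alpha>) = 0" by (simp add: in_keys_iff)
    qed
  qed (auto simp: Y_def)
  also have "\<dots> = poly_times_series p s (\<gamma> - 1)"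
    by (simp add: sum.reindex poly_times_series_def algebra_simps)
  finally show ?thesis by (simp add: q_def)
qed

section \<open>The graded pieces as quotients of filtration steps\<close>

context convenient_poly
begin

definition strictly_below :: "real \<Rightarrow> 'n cpoly set" where
  "strictly_below a = {g. \<forall>x\<in>Poly_Mapping.keys g. nu x < a}"

lemma strictly_below_iff: "g \<in> strictly_below a \<longleftrightarrow> below a g \<and> gpart a g = 0"
proof
  assume "g \<in> strictly_below a"
  then show "below a g \<and> gpart a g = 0"
    unfolding gpart_def by (intro conjI pm_filter_eq_0) (force simp: strictly_below_def below_def)+
next
  assume g: "below a g \<and> gpart a g = 0"
  have "nu x < a" if "x \<in> Poly_Mapping.keys g" for x
  proof (rule ccontr)
    assume "\<not> nu x < a"
    then have "nu x = a" using g that by (force simp: below_def)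
    then have "x \<in> Poly_Mapping.keys (gpart a g)" using that by (simp add: gpart_def keys_pm_filter)
    then show False using g by simp
  qed
  then show "g \<in> strictly_below a" by (simp add: strictly_below_def)
qed

lemma subspace_keys: "cpm.subspace {g :: 'n cpoly. \<forall>x\<in>Poly_Mapping.keys g. Q x}"
  unfolding cpm.subspace_def
proof (intro conjI ballI allI)
  show "g + h \<in> {g. \<forall>x\<in>Poly_Mapping.keys g. Q x}"
    if "g \<in> {g. \<forall>x\<in>Poly_Mapping.keys g. Q x}" "h \<in> {g. \<forall>x\<in>Poly_Mapping.keys g. Q x}" for g h :: "'n cpoly"
    using that keys_add[of g h] by blast
  show "cscale c g \<in> {g. \<forall>x\<in>Poly_Mapping.keys g. Q x}"
    if "g \<in> {g. \<forall>x\<in>Poly_Mapping.keys g. Q x}" for c and g :: "'n cpoly"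
    using that by (auto simp: in_keys_iff lookup_cscale)
qed simp

lemma subspace_strictly_below: "cpm.subspace (strictly_below a)"
  unfolding strictly_below_def by (rule subspace_keys)

lemma subspace_below: "cpm.subspace (Collect (below a))"
  unfolding below_def by (rule subspace_keys)

lemma quotient_filtration_eq:
  "quotient_filtration f \<beta> = residue_class ` Collect (below (real_of_rat \<beta>))"
proof -
  have nu: "newton_function P x \<le> \<beta> \<longleftrightarrow> nu x \<le> real_of_rat \<beta>" for x
    unfolding newton_function_eq[symmetric] by (simp add: of_rat_less_eq)
  have "newton_filtration P \<beta> = Collect (below (real_of_rat \<beta>))"
    by (rule Set.set_eqI) (simp only: newton_filtration_def mem_Collect_eq below_def nu)
  then show ?thesis unfolding quotient_filtration_def P_def[symmetric] residue_class_coset by (rule arg_cong)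
qed

lemma quotient_filtration_less:
  "(\<Union>\<beta>\<in>{..<\<alpha>}. quotient_filtration f \<beta>) = residue_class ` strictly_below (real_of_rat \<alpha>)"
proof -
  have "(\<exists>\<beta><\<alpha>. below (real_of_rat \<beta>) g) \<longleftrightarrow> g \<in> strictly_below (real_of_rat \<alpha>)" for g
  proof
    assume "\<exists>\<beta><\<alpha>. below (real_of_rat \<beta>) g"
    then obtain \<beta> where \<beta>: "\<beta> < \<alpha>" "below (real_of_rat \<beta>) g" by blast
    then show "g \<in> strictly_below (real_of_rat \<alpha>)"
      using of_rat_less[of \<beta> \<alpha>, where 'a = real] by (force simp: below_def strictly_below_def)
  next
    assume g: "g \<in> strictly_below (real_of_rat \<alpha>)"
    \<comment> \<open>A polynomial has finitely many exponents, so their largest weight works; the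
      extra element \<alpha> - 1 covers the zero polynomial.\<close>
    define \<beta> where "\<beta> = Max (insert (\<alpha> - 1) (newton_function P ` Poly_Mapping.keys g))"
    have "\<forall>x\<in>Poly_Mapping.keys g. newton_function P x < \<alpha>"
      using g by (simp add: strictly_below_def newton_function_eq[symmetric] of_rat_less)
    then have "\<beta> < \<alpha>" by (simp add: \<beta>_def)
    moreover have "newton_function P x \<le> \<beta>" if "x \<in> Poly_Mapping.keys g" for x
      unfolding \<beta>_def using that by (intro Max_ge) auto
    then have "below (real_of_rat \<beta>) g"
      by (simp add: below_def newton_function_eq[symmetric] of_rat_less_eq)
    ultimately show "\<exists>\<beta><\<alpha>. below (real_of_rat \<beta>) g" by blast
  qed
  then have "(\<Union>\<beta>\<in>{..<\<alpha>}. Collect (below (real_of_rat \<beta>))) = strictly_below (real_of_rat \<alpha>)"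
    by (auto simp: lessThan_def)
  then show ?thesis unfolding quotient_filtration_eq image_UN[symmetric] by simp
qed

text \<open>The class of a polynomial in the graded piece, a coset whose elements are themselves
  cosets of the toric ideal.\<close>

definition graded_class :: "real \<Rightarrow> 'n cpoly \<Rightarrow> 'n cpoly set set" where
  "graded_class a g = (\<lambda>y. residue_class (y + g)) ` strictly_below a"

definition graded_kernel :: "real \<Rightarrow> 'n cpoly set" where
  "graded_kernel a = {g. below a g \<and> (\<exists>l\<in>ideal_elements. g - l \<in> strictly_below a)}"

lemma graded_class_eq_iff:
  assumes "below a g" "below a h"
  shows "graded_class a g = graded_class a h \<longleftrightarrow> g - h \<in> graded_kernel a"
proof
  assume "graded_class a g = graded_class a h"
  moreover have "residue_class g \<in> graded_class a g"
    unfolding graded_class_def using cpm.subspace_0[OF subspace_strictly_below]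
    by (rule rev_image_eqI) simp
  ultimately obtain y where y: "y \<in> strictly_below a" "residue_class g = residue_class (y + h)"
    by (auto simp: graded_class_def)
  then have "g - (y + h) \<in> ideal_elements" by (simp add: residue_class_eq_iff)
  moreover have "(g - h) - (g - (y + h)) = y" by simp
  ultimately show "g - h \<in> graded_kernel a"
    using y(1) below_diff[OF assms] unfolding graded_kernel_def by (auto intro!: bexI[of _ "g - (y + h)"])
next
  have "graded_class a g \<subseteq> graded_class a h" if gh: "g - h - l \<in> strictly_below a" "l \<in> ideal_elements" for g h l
  proof
    fix x assume "x \<in> graded_class a g"
    then obtain y where y: "y \<in> strictly_below a" "x = residue_class (y + g)" by (auto simp: graded_class_def)
    have "x = residue_class ((y + (g - h - l)) + h)"
      unfolding y(2) residue_class_eq_iff using gh(2) by (simp add: algebra_simps)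
    moreover have "y + (g - h - l) \<in> strictly_below a"
      by (rule cpm.subspace_add[OF subspace_strictly_below y(1) gh(1)])
    ultimately show "x \<in> graded_class a h" unfolding graded_class_def by blast
  qed note sub = this
  assume "g - h \<in> graded_kernel a"
  then obtain l where l: "l \<in> ideal_elements" "g - h - l \<in> strictly_below a"
    by (auto simp: graded_kernel_def)
  have "- (g - h - l) \<in> strictly_below a" by (rule cpm.subspace_neg[OF subspace_strictly_below l(2)])
  then have "h - g - (- l) \<in> strictly_below a" by (simp add: algebra_simps)
  then show "graded_class a g = graded_class a h"
    using sub[OF l(2,1)] sub[OF _ ideal_elements_uminus[OF l(1)]] by blast
qed

lemma graded_class_coset:
  "residue_class ` strictly_below a +>\<^bsub>toric_quotient f\<lparr>carrier := X\<rparr>\<^esub> residue_class g = graded_class a g"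
  by (auto simp: a_r_coset_def' toric_quotient_def quotient_module_def residue_class_add graded_class_def)

lemma below_strictly_below: "y \<in> strictly_below a \<Longrightarrow> below a y"
  by (simp add: strictly_below_iff)

lemma graded_class_absorb:
  assumes "y \<in> strictly_below a" "below a g"
  shows "graded_class a (y + g) = graded_class a g"
proof -
  have "below a (y + g)" using assms below_strictly_below by (intro below_add) auto
  moreover have "y \<in> graded_kernel a"
    using assms(1) below_strictly_below ideal_elements_zero by (auto simp: graded_kernel_def intro!: bexI[of _ 0])
  ultimately show ?thesis using assms(2) by (simp add: graded_class_eq_iff)
qed

lemma graded_class_add:
  assumes "below a g" "below a h"
  shows "set_add (toric_quotient f\<lparr>carrier := X\<rparr>) (graded_class a g) (graded_class a h) = graded_class a (g + h)"
proof -
  have plus: "add (toric_quotient f\<lparr>carrier := X\<rparr>) = set_add cpoly_algebra"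
    by (simp add: toric_quotient_def quotient_module_def)
  have swap: "(y + g) + (y' + h) = y' + (y + (g + h))" for y y' by (simp add: ac_simps)
  have "set_add (toric_quotient f\<lparr>carrier := X\<rparr>) (graded_class a g) (graded_class a h) =
      (\<Union>y\<in>strictly_below a. \<Union>y'\<in>strictly_below a. {residue_class (y' + (y + (g + h)))})"
    unfolding set_add_def'[of "toric_quotient f\<lparr>carrier := X\<rparr>"] plus
    by (simp add: graded_class_def residue_class_add swap)
  also have "\<dots> = (\<Union>y\<in>strictly_below a. graded_class a (y + (g + h)))"
    by (simp add: graded_class_def UNION_singleton_eq_range)
  also have "\<dots> = (\<Union>y\<in>strictly_below a. graded_class a (g + h))"
    using graded_class_absorb[OF _ below_add[OF assms]] by (rule SUP_cong[OF refl])
  also have "\<dots> = graded_class a (g + h)"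
    using cpm.subspace_0[OF subspace_strictly_below] by auto
  finally show ?thesis .
qed

lemma graded_class_smult:
  assumes "below a g"
  shows "(\<Union>x\<in>graded_class a g. residue_class ` strictly_below a +>\<^bsub>toric_quotient f\<lparr>carrier := X\<rparr>\<^esub>
      (smult (toric_quotient f) c x)) = graded_class a (cscale c g)"
proof -
  have sm: "smult (toric_quotient f) c (residue_class h) = residue_class (cscale c h)" for h
    by (simp add: toric_quotient_def quotient_module_def residue_class_smult)
  have "graded_class a (cscale c (y + g)) = graded_class a (cscale c g)" if "y \<in> strictly_below a" for y
  proof -
    have "cscale c y \<in> strictly_below a" by (rule cpm.subspace_scale[OF subspace_strictly_below that])
    moreover have "below a (cscale c g)" using cpm.subspace_scale[OF subspace_below, of g a c] assms by simp
    ultimately show ?thesis unfolding cpm.scale_right_distrib by (rule graded_class_absorb)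
  qed
  then have "(\<Union>y\<in>strictly_below a. graded_class a (cscale c (y + g))) = (\<Union>y\<in>strictly_below a. graded_class a (cscale c g))"
    by (rule SUP_cong[OF refl])
  also have "\<dots> = graded_class a (cscale c g)"
    using cpm.subspace_0[OF subspace_strictly_below] by auto
  finally show ?thesis
    unfolding graded_class_def[of a g] image_image sm graded_class_coset by (simp only: SUP_image o_def)
qed

lemma subspace_ideal_elements: "cpm.subspace ideal_elements"
  unfolding cpm.subspace_def cscale_def
  by (simp add: ideal_elements_zero ideal_elements_add ideal_elements_mult)

lemma subspace_graded_kernel: "cpm.subspace (graded_kernel a)"
  unfolding cpm.subspace_def
proof (intro conjI ballI allI)
  show "0 \<in> graded_kernel a"
    using cpm.subspace_0[OF subspace_strictly_below] ideal_elements_zero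
    by (auto simp: graded_kernel_def below_zero intro!: bexI[of _ 0])
  fix g assume "g \<in> graded_kernel a"
  then obtain l where l: "below a g" "l \<in> ideal_elements" "g - l \<in> strictly_below a" by (auto simp: graded_kernel_def)
  {
    fix h assume "h \<in> graded_kernel a"
    then obtain l' where l': "below a h" "l' \<in> ideal_elements" "h - l' \<in> strictly_below a" by (auto simp: graded_kernel_def)
    have "(g + h) - (l + l') = (g - l) + (h - l')" by simp
    then have "(g + h) - (l + l') \<in> strictly_below a"
      using cpm.subspace_add[OF subspace_strictly_below l(3) l'(3)] by (simp only:)
    then show "g + h \<in> graded_kernel a"
      using l l' below_add ideal_elements_add unfolding graded_kernel_def by blast
  }
  fix c
  have "cscale c g - cscale c l \<in> strictly_below a"
    using cpm.subspace_scale[OF subspace_strictly_below l(3), of c] by (simp add: cpm.scale_right_diff_distrib)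
  moreover have "below a (cscale c g)" using cpm.subspace_scale[OF subspace_below, of g a c] l(1) by simp
  ultimately show "cscale c g \<in> graded_kernel a"
    using cpm.subspace_scale[OF subspace_ideal_elements l(2), of c] unfolding graded_kernel_def by blast
qed

lemma graded_piece_quotient:
  "vector_quotient cscale (graded_piece f \<alpha>) (graded_class (real_of_rat \<alpha>))
    (Collect (below (real_of_rat \<alpha>))) (graded_kernel (real_of_rat \<alpha>))"
proof unfold_locales
  let ?a = "real_of_rat \<alpha>"
  let ?M = "toric_quotient f\<lparr>carrier := quotient_filtration f \<alpha>\<rparr>"
  have eq: "graded_piece f \<alpha> = quotient_module ?M (residue_class ` strictly_below ?a)"
    by (simp add: graded_piece_def quotient_filtration_less)
  show "cpm.subspace (Collect (below ?a))" by (rule subspace_below)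
  show "cpm.subspace (graded_kernel ?a)" by (rule subspace_graded_kernel)
  show "graded_kernel ?a \<subseteq> Collect (below ?a)" by (auto simp: graded_kernel_def)
  show "carrier (graded_piece f \<alpha>) = graded_class ?a ` Collect (below ?a)"
    unfolding eq quotient_module_def
    by (auto simp: A_RCOSETS_def' quotient_filtration_eq graded_class_coset)
  show "zero (graded_piece f \<alpha>) = graded_class ?a 0"
    by (simp add: eq quotient_module_def graded_class_def)
  show "add (graded_piece f \<alpha>) (graded_class ?a g) (graded_class ?a h) = graded_class ?a (g + h)"
    if "g \<in> Collect (below ?a)" "h \<in> Collect (below ?a)" for g h
    using that by (simp add: eq quotient_module_def graded_class_add)
  show "smult (graded_piece f \<alpha>) c (graded_class ?a g) = graded_class ?a (cscale c g)"
    if "g \<in> Collect (below ?a)" for c g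
    using that by (simp add: eq quotient_module_def graded_class_smult)
  show "graded_class ?a g = graded_class ?a h \<longleftrightarrow> g - h \<in> graded_kernel ?a"
    if "g \<in> Collect (below ?a)" "h \<in> Collect (below ?a)" for g h
    using that by (simp add: graded_class_eq_iff)
qed

text \<open>The point where strictness reaches the spectrum: the kernel is determined by leading
  forms alone.\<close>

lemma graded_kernel_eq:
  assumes "nondegenerate f"
  shows "graded_kernel a = {g. below a g \<and> gpart a g \<in> gideal J gens}"
  using leading_form_ideal[OF assms] by (auto simp: graded_kernel_def strictly_below_iff)

text \<open>Taking the component of weight \<open>a\<close> identifies the graded piece with the
  homogeneous part of the graded ring modulo the forms, so one set of representatives serves both
  quotients.\<close>

lemma graded_piece_dimension:
  assumes nd: "nondegenerate f"
  shows "finite_dimensional (graded_piece f \<alpha>)"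
    "int (dimension_of (graded_piece f \<alpha>)) = hilb J (real_of_rat \<alpha>)"
proof -
  define a where "a = real_of_rat \<alpha>"
  interpret vector_quotient cscale "graded_piece f \<alpha>" "graded_class a" "Collect (below a)" "graded_kernel a"
    unfolding a_def by (rule graded_piece_quotient)
  have WX: "W J a \<subseteq> gpiece a" by (simp add: W_def)
  note gp = finite_gmonos gpiece_span subspace_W WX subspace_gpiece
  obtain C where C: "cpm.complement_basis (gpiece a) (W J a) C"
    using cpm.complement_basis_exists[OF gp] by blast
  have Cg: "C \<subseteq> gpiece a" by (rule cpm.complement_basis_subset[OF C])
  have combg: "(\<Sum>b\<in>C. cscale (c b) b) \<in> gpiece a" for c
    using Cg by (intro cpm.subspace_sum cpm.subspace_scale subspace_gpiece) auto
  have C': "cpm.complement_basis (Collect (below a)) (graded_kernel a) C"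
    unfolding cpm.complement_basis_def
  proof (intro conjI ballI allI impI)
    show "finite C" by (rule cpm.complement_basis_finite[OF C])
    show "C \<subseteq> Collect (below a)" using Cg below_gpiece by blast
  next
    fix u assume u: "u \<in> Collect (below a)"
    obtain c where c: "gpart a u - (\<Sum>b\<in>C. cscale (c b) b) \<in> W J a"
      using cpm.complement_basis_gen[OF C gpart_mem] .
    have "gpart a (u - (\<Sum>b\<in>C. cscale (c b) b)) = gpart a u - (\<Sum>b\<in>C. cscale (c b) b)"
      using gpart_id[OF combg[of c]] by (simp add: gpart_def pm_filter_diff)
    then have "u - (\<Sum>b\<in>C. cscale (c b) b) \<in> graded_kernel a"
      using c u below_diff[OF _ below_gpiece[OF combg[of c]]] by (simp add: graded_kernel_eq[OF nd] W_def)
    then show "\<exists>c. u - (\<Sum>b\<in>C. cscale (c b) b) \<in> graded_kernel a" by blast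
  next
    fix c b assume "(\<Sum>b\<in>C. cscale (c b) b) \<in> graded_kernel a" and b: "b \<in> C"
    then have "(\<Sum>b\<in>C. cscale (c b) b) \<in> W J a"
      using combg[of c] by (simp add: graded_kernel_eq[OF nd] W_def gpart_id)
    then show "c b = 0" using b by (rule cpm.complement_basis_ind[OF C])
  qed
  have fin: "finite ((\<lambda>x. Poly_Mapping.single x (1 :: complex)) ` {x. nu x \<le> a})"
    by (intro finite_imageI finite_nu_le)
  have span: "Collect (below a) \<subseteq> cpm.span ((\<lambda>x. Poly_Mapping.single x 1) ` {x. nu x \<le> a})"
    by (auto simp: below_def intro!: span_monomials)
  show "finite_dimensional (graded_piece f \<alpha>)" by (rule dimension_of_quotient(1)[OF C' fin span])
  have "int (dimension_of (graded_piece f \<alpha>)) = int (card C)"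
    using dimension_of_quotient(2)[OF C' fin span] by simp
  also have "\<dots> = hilb J a"
    using cpm.complement_basis_dim[OF C gp] by (simp add: hilb_def)
  finally show "int (dimension_of (graded_piece f \<alpha>)) = hilb J (real_of_rat \<alpha>)" by (simp add: a_def)
qed

lemma monomial_series_newton: "monomial_series (newton_function P) \<gamma> = hilb {} (real_of_rat \<gamma>)"
  by (simp add: monomial_series_def hilb_empty newton_function_eq[symmetric])

lemma hilb_series:
  assumes nd: "nondegenerate f" and "finite T" "T \<subseteq> J"
  shows "hilb T (real_of_rat \<gamma>) =
    poly_times_series ((1 - Poly_Mapping.single 1 1) ^ card T) (monomial_series (newton_function P)) \<gamma>"
  using assms(2,3)
proof (induction T arbitrary: \<gamma> rule: finite_induct)
  case empty
  then show ?case by (simp add: poly_times_series_def monomial_series_newton)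
next
  case (insert j T)
  then have "hilb (insert j T) (real_of_rat \<gamma>) = hilb T (real_of_rat \<gamma>) - hilb T (real_of_rat (\<gamma> - 1))"
    using hilb_insert[OF nd insert.prems insert.hyps(2)] by (simp add: of_rat_diff)
  then show ?case using insert by (simp add: poly_times_series_difference)
qed

lemma toric_newton_spectrum_eq:
  assumes "nondegenerate f"
  shows "toric_newton_spectrum f =
    poly_times_series ((1 - Poly_Mapping.single 1 1) ^ CARD('n)) (monomial_series (newton_function P))"
  using graded_piece_dimension(2)[OF assms] hilb_series[OF assms finite_J subset_refl]
  by (simp add: toric_newton_spectrum_def fun_eq_iff J_def)

lemma monomial_summable_newton: "monomial_summable (newton_function P)"
proof -
  have "{v. newton_function P v = \<alpha>} = {v. nu v = real_of_rat \<alpha>}" for \<alpha>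
    by (simp add: newton_function_eq[symmetric])
  then show ?thesis by (simp add: monomial_summable_def finite_nu_eq)
qed

end

theorem theorem3p2:
  fixes f :: "'n::finite cpoly"
  assumes "convenient f" and "nondegenerate f"
  shows "(\<forall>\<alpha>. finite_dimensional (graded_piece f \<alpha>)) \<and>
    monomial_summable (newton_function (newton_polytope f)) \<and>
    toric_newton_spectrum f =
      poly_times_series ((1 - Poly_Mapping.single 1 1) ^ CARD('n))
        (monomial_series (newton_function (newton_polytope f))) \<and>
    (\<forall>g :: 'n cpoly. convenient g \<and> nondegenerate g \<and> newton_polytope g = newton_polytope f \<longrightarrow>
       toric_newton_spectrum g = toric_newton_spectrum f)"
proof -
  \<comment> \<open>Proved for every \<open>g\<close>, since the right hand side sees
    \<open>g\<close> only through its polytope; this gives the last claim.\<close>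
  have formula: "toric_newton_spectrum g = poly_times_series ((1 - Poly_Mapping.single 1 1) ^ CARD('n))
      (monomial_series (newton_function (newton_polytope g)))" if "convenient g" "nondegenerate g" for g :: "'n cpoly"
  proof -
    interpret convenient_poly g by unfold_locales (rule that(1))
    show ?thesis using toric_newton_spectrum_eq[OF that(2)] by (simp add: P_def)
  qed
  interpret convenient_poly f by unfold_locales (rule assms(1))
  have "finite_dimensional (graded_piece f \<alpha>)" for \<alpha> by (rule graded_piece_dimension(1)[OF assms(2)])
  moreover have "monomial_summable (newton_function (newton_polytope f))" using monomial_summable_newton by (simp add: P_def)
  ultimately show ?thesis using formula assms by simp
qed

end
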